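(* (Soundness.) Let $\bar x,\bar y$ be tuples of variables, $\bar x',\bar y'$ the corresponding tuples of differential variables, $F,G$ formulas of first-order real arithmetic, $P$ a dAL formula, and $e$ a term. Each of the following formulas is valid (true in every state), subject to the stated side conditions: (DW) $[\{\bar x : F\}]F$. (C) $[\{\bar x : F\wedge G\}]P \leftrightarrow [\{\bar x : G\wedge F\}]P$. (DE) $[\{\bar x : e=0\}]\,(e)'=0$, provided no variable of $\bar x'$ is free in $e$. (DX) $[\{\bar x : F\}]P \rightarrow [?F]P$. (DI) $\big(F\rightarrow [\{\bar x : F\}](P)'\big)\rightarrow\big([?F]P\rightarrow[\{\bar x : F\}]P\big)$, provided no variable of $\bar x'$ is free in $P$. (DR) $[\{\bar x : F\}]P \rightarrow \forall \bar y\,\forall \bar y'\,[\{\bar x,\bar y : F\wedge G\}]P$, provided no variable of $\bar y,\bar y'$ is free in $P$ or $F$. (AG) For a formula $G(\cdot)$ with an argument tuple and a tuple of terms $h(\bar x,\bar x')$: $[\{\bar x : F\}]G(h(\bar x,\bar x'))\rightarrow\Big(\forall\bar y\,\forall\bar y'\,[\{\bar x,\bar y : F\wedge G(\bar y)\}]P\rightarrow[\{\bar x : F\}]P\Big)$, provided no variable of $\bar y,\bar y'$ is free in $P$, $F$, $G(\cdot)$ or $h(\cdot,\cdot)$. (BDG) For a tuple of terms $g(\bar x,\bar x',\bar y)$ (of the same length as $\bar y$) and a term $h(\bar x,\bar x')$: $[\{\bar x,\bar y : F\wedge \bar y'=g(\bar x,\bar x',\bar y)\}]\,\|\bar y\|^2\le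 h(\bar x,\bar x') \rightarrow \Big([\{\bar x : F\}]P\leftrightarrow[\{\bar x,\bar y : F\wedge \bar y'=g(\bar x,\bar x',\bar y)\}]P\Big)$, provided no variable of $\bar y,\bar y'$ is free in $P$, $F$ or $h(\cdot,\cdot)$. (GS) $[\{\bar x : F\vee G\}]\big(\mathrm{consis}(F,G)\wedge\mathrm{consis}(G,F)\big)\rightarrow\Big(\big(F\vee G\rightarrow[(\{\bar x : F\}\cup\{\bar x : G\})^*]P\big)\rightarrow[\{\bar x : F\vee G\}]P\Big)$.
   Context: Setting (differential-algebraic dynamic logic dAL). There is a set $\mathcal V$ of variables; for each $x\in\mathcal V$ there is a differential variable $x'\in\mathcal V$. A state is a map $\omega:\mathcal V\to\mathbb R$; $\omega_x^r$ is $\omega$ with the value of $x$ replaced by $r$. Terms: $e,g ::= x \mid c \mid f(e_1,\dots,e_k)\mid e\cdot g\mid e+g\mid (e)'$ ($c$ rational, $f$ a function symbol denoting a fixed (analytic) real function), with the usual semantics $\omega[\![e]\!]$ and $\omega[\![(e)']\!]=\sum_{x\in\mathcal V}\omega(x')\,\frac{\partial\,\omega[\![e]\!]}{\partial x}$ (partial derivative of the value of $e$ with respect to the value of $x$; the sum is finite). Formulas: $e\le g\mid P(e_1,\dots,e_k)\mid F\wedge G\mid\neg F\mid\forall x F\mid[\alpha]F$, with $<,=,\ne,\vee,\rightarrow,\leftrightarrow,\exists$ defined as usual and $\langle\alpha\rangle F\equiv\neg[\alpha]\neg F$; $[\![F]\!]$ is the set of states where $F$ is true, and $\omega\in[\![[\alpha]F]\!]$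 iff $\nu\in[\![F]\!]$ for all $(\omega,\nu)\in[\![\alpha]\!]$. For tuples, $\bar x=\bar y$ abbreviates the conjunction of componentwise equalities, $\bar x\neq\bar y$ is $\neg(\bar x=\bar y)$, $\|\bar y\|^2$ is the sum of squares. Programs: $x:=e$ (sets $x$ to the value of $e$), $?F$ (test: $\{(\omega,\omega):\omega\in[\![F]\!]\}$), $\alpha;\beta$ (relational composition), $\alpha\cup\beta$ (union), $\alpha^*$ (union of all $n$-fold compositions, $n\in\mathbb N$), and the differential-algebraic program $\{\bar x : F\}$ with $\bar x$ a tuple of variables and $F$ a first-order real-arithmetic formula (which may mention differential variables). A flow in $\bar x$ on an open interval $(a,b)$ is a map $\varphi:(a,b)\to$ states such that for each $x$ in $\bar x$, $t\mapsto\varphi(t)(x)$ is real-analytic on $(a,b)$ and $\varphi(t)(x')=\frac{d}{dt}\varphi(t)(x)$ for all $t$, and $\varphi(t)=\varphi(0)$ on all variables outside $\bar x\cup\bar x'$. $\varphi(I)\subseteq[\![F]\!]$ means $\varphi(t)\in[\![F]\!]$ for all $t\in I$. $(\omega,\nu)\in[\![\{\bar x:F\}]\!]$ iff there are $T\ge0$, $\epsilon>0$ and a flow $\varphi$ in $\bar x$ on $(-\epsilon,T+\epsilon)$ with $\varphi([0,T])\subseteq[\![F]\!]$, $\varphi(0)=\omega$, $\varphi(T)=\nu$. For a formula $F$ built from comparisons with $\wedge,\vee$, its differential $(F)'$ is as in differential dynamic logic: $(e\ge g)'\equiv(e)'\ge(g)'$ (similarly for $>,\le,<,=$), $(A\wedge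 B)'\equiv(A\vee B)'\equiv(A)'\wedge(B)'$. Local progress formula (for fresh tuples $\bar y,\bar y'$ not occurring in $F$): $\mathrm{prog}\{\bar x:F\}\equiv\exists\bar y\,\exists\bar y'\big(\bar x=\bar y\wedge\bar x'=\bar y'\wedge\langle\{\bar x : F\vee(\bar x=\bar y\wedge\bar x'=\bar y')\}\rangle\,\bar x\ne\bar y\big)$. For a formula $A$, $A^-\equiv[\bar x':=-\bar x']A$ (simultaneous negation of the differential variables). Exit and entry formulas: $\mathrm{exit}\{\bar x:F\}\equiv(\mathrm{prog}\{\bar x:\neg F\}\wedge F)\vee((\mathrm{prog}\{\bar x:F^-\})^-\wedge\neg F)$ and $\mathrm{enter}\{\bar x:F\}\equiv(\mathrm{prog}\{\bar x:F\}\wedge\neg F)\vee((\mathrm{prog}\{\bar x:\neg F^-\})^-\wedge F)$. Mode consistency: $\mathrm{consis}(F,G)\equiv(\mathrm{exit}\{\bar x:F\}\wedge\mathrm{enter}\{\bar x:G\})\rightarrow(F\leftrightarrow G)$.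
   Formalization: DE as written fails at duration 0 and is given under [?e=0](e)'=0; DE and DI also assume z'=0 for variables z of e or P outside x̄; BDG assumes ȳ'=g in the initial state; ȳ,ȳ' are pairwise distinct and new to x̄,x̄', and x̄,x̄' are pairwise distinct in GS. *)

theory Defs
  imports "HOL-Analysis.Analysis"
begin

text \<open>
  The differential symbol can be iterated: the differential variable of a variable is itself a
  variable, and every variable arises from a base name by finitely many primes.
\<close>

datatype 'v var = Base 'v | Prime "'v var"

type_synonym 'v state = "'v var \<Rightarrow> real"

abbreviation primes :: "'v var list \<Rightarrow> 'v var list" where
  "primes xs \<equiv> map Prime xs"

text \<open>
  A function or predicate symbol may be applied to any number of arguments; the occurrences with
  \<open>k\<close> arguments play the role of a \<open>k\<close>-ary symbol.
\<close>

datatype ('v, 'f) trm =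
    Var "'v var"
  | Const rat
  | Fun 'f "('v, 'f) trm list"
  | Mul "('v, 'f) trm" "('v, 'f) trm"
  | Add "('v, 'f) trm" "('v, 'f) trm"
  | Differential "('v, 'f) trm"

datatype ('v, 'f, 'p) fml =
    Leq "('v, 'f) trm" "('v, 'f) trm"
  | Pred 'p "('v, 'f) trm list"
  | And "('v, 'f, 'p) fml" "('v, 'f, 'p) fml"
  | Neg "('v, 'f, 'p) fml"
  | Forall "'v var" "('v, 'f, 'p) fml"
  | Box "('v, 'f, 'p) prog" "('v, 'f, 'p) fml"
and ('v, 'f, 'p) prog =
    Assign "'v var" "('v, 'f) trm"
  | Test "('v, 'f, 'p) fml"
  | Seq "('v, 'f, 'p) prog" "('v, 'f, 'p) prog"
  | Choice "('v, 'f, 'p) prog" "('v, 'f, 'p) prog"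
  | Loop "('v, 'f, 'p) prog"
  | DAP "'v var list" "('v, 'f, 'p) fml"

text \<open>
  The constraint of a \<open>DAP\<close> is syntactically an arbitrary formula, because the entry and exit
  formulas below use constraints that contain assignments to differential variables.
\<close>


subsection \<open>Derived connectives\<close>

definition Lt :: "('v, 'f) trm \<Rightarrow> ('v, 'f) trm \<Rightarrow> ('v, 'f, 'p) fml" where
  "Lt e g = Neg (Leq g e)"

definition Eq :: "('v, 'f) trm \<Rightarrow> ('v, 'f) trm \<Rightarrow> ('v, 'f, 'p) fml" where
  "Eq e g = And (Leq e g) (Leq g e)"

definition Or :: "('v, 'f, 'p) fml \<Rightarrow> ('v, 'f, 'p) fml \<Rightarrow> ('v, 'f, 'p) fml" where
  "Or A B = Neg (And (Neg A) (Neg B))"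

definition Imp :: "('v, 'f, 'p) fml \<Rightarrow> ('v, 'f, 'p) fml \<Rightarrow> ('v, 'f, 'p) fml" where
  "Imp A B = Or (Neg A) B"

definition Iff :: "('v, 'f, 'p) fml \<Rightarrow> ('v, 'f, 'p) fml \<Rightarrow> ('v, 'f, 'p) fml" where
  "Iff A B = And (Imp A B) (Imp B A)"

definition Exists :: "'v var \<Rightarrow> ('v, 'f, 'p) fml \<Rightarrow> ('v, 'f, 'p) fml" where
  "Exists x A = Neg (Forall x (Neg A))"

definition Diamond :: "('v, 'f, 'p) prog \<Rightarrow> ('v, 'f, 'p) fml \<Rightarrow> ('v, 'f, 'p) fml" where
  "Diamond \<alpha> A = Neg (Box \<alpha> (Neg A))"

definition Truth :: "('v, 'f, 'p) fml" where
  "Truth = Leq (Const 0) (Const 0)"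

definition Foralls :: "'v var list \<Rightarrow> ('v, 'f, 'p) fml \<Rightarrow> ('v, 'f, 'p) fml" where
  "Foralls xs A = foldr Forall xs A"

definition Exs :: "'v var list \<Rightarrow> ('v, 'f, 'p) fml \<Rightarrow> ('v, 'f, 'p) fml" where
  "Exs xs A = foldr Exists xs A"

definition Eqs :: "('v, 'f) trm list \<Rightarrow> ('v, 'f) trm list \<Rightarrow> ('v, 'f, 'p) fml" where
  "Eqs es gs = foldr And (map2 Eq es gs) Truth"

abbreviation VarEqs :: "'v var list \<Rightarrow> 'v var list \<Rightarrow> ('v, 'f, 'p) fml" where
  "VarEqs xs ys \<equiv> Eqs (map Var xs) (map Var ys)"

definition sqnorm :: "'v var list \<Rightarrow> ('v, 'f) trm" where
  "sqnorm ys = foldr (\<lambda>y e. Add (Mul (Var y) (Var y)) e) ys (Const 0)"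


subsection \<open>Free variables\<close>

fun fvt :: "('v, 'f) trm \<Rightarrow> 'v var set" where
  "fvt (Var x) = {x}"
| "fvt (Const c) = {}"
| "fvt (Fun f es) = (\<Union>e\<in>set es. fvt e)"
| "fvt (Mul e g) = fvt e \<union> fvt g"
| "fvt (Add e g) = fvt e \<union> fvt g"
| "fvt (Differential e) = fvt e \<union> Prime ` fvt e"

text \<open>
  Variables written on every run (must-bound variables), and free variables, following the static
  semantics of differential dynamic logic. The initial values of the variables of a \<open>DAP\<close> and
  of their differentials are read, since its flows start in the initial state.
\<close>

fun mbv :: "('v, 'f, 'p) prog \<Rightarrow> 'v var set" where
  "mbv (Assign x e) = {x}"
| "mbv (Test A) = {}"
| "mbv (Seq \<alpha> \<beta>) = mbv \<alpha> \<union> mbv \<beta>"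
| "mbv (Choice \<alpha> \<beta>) = mbv \<alpha> \<inter> mbv \<beta>"
| "mbv (Loop \<alpha>) = {}"
| "mbv (DAP xs A) = set xs \<union> set (primes xs)"

fun fvf :: "('v, 'f, 'p) fml \<Rightarrow> 'v var set"
  and fvp :: "('v, 'f, 'p) prog \<Rightarrow> 'v var set" where
  "fvf (Leq e g) = fvt e \<union> fvt g"
| "fvf (Pred p es) = (\<Union>e\<in>set es. fvt e)"
| "fvf (And A B) = fvf A \<union> fvf B"
| "fvf (Neg A) = fvf A"
| "fvf (Forall x A) = fvf A - {x}"
| "fvf (Box \<alpha> A) = fvp \<alpha> \<union> (fvf A - mbv \<alpha>)"
| "fvp (Assign x e) = fvt e"
| "fvp (Test A) = fvf A"
| "fvp (Seq \<alpha> \<beta>) = fvp \<alpha> \<union> (fvp \<beta> - mbv \<alpha>)"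
| "fvp (Choice \<alpha> \<beta>) = fvp \<alpha> \<union> fvp \<beta>"
| "fvp (Loop \<alpha>) = fvp \<alpha>"
| "fvp (DAP xs A) = set xs \<union> set (primes xs) \<union> fvf A"


subsection \<open>Analytic functions and flows\<close>

definition real_analytic_on :: "(real \<Rightarrow> real) \<Rightarrow> real set \<Rightarrow> bool" where
  "real_analytic_on f S \<longleftrightarrow> (\<forall>t\<in>S. \<exists>A. (\<lambda>h. f (t + h)) has_fps_expansion A)"

text \<open>
  A function of \<open>k\<close> real arguments (lists of length \<open>k\<close>) is analytic if around every point it is
  the sum of an unconditionally convergent power series; the multi-indices are lists of length
  \<open>k\<close>.
\<close>

definition real_analytic_args :: "nat \<Rightarrow> (real list \<Rightarrow> real) \<Rightarrow> bool" where
  "real_analytic_args k f \<longleftrightarrow>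
     (\<forall>p. length p = k \<longrightarrow>
        (\<exists>c. \<exists>r>0. \<forall>q. length q = k \<and> (\<forall>i<k. \<bar>q ! i - p ! i\<bar> < r) \<longrightarrow>
           ((\<lambda>a. c a * (\<Prod>i<k. (q ! i - p ! i) ^ (a ! i))) has_sum f q)
             {a :: nat list. length a = k}))"

definition analytic_interp :: "('f \<Rightarrow> real list \<Rightarrow> real) \<Rightarrow> bool" where
  "analytic_interp fi \<longleftrightarrow> (\<forall>f k. real_analytic_args k (fi f))"

definition is_flow :: "'v var list \<Rightarrow> real \<Rightarrow> real \<Rightarrow> (real \<Rightarrow> 'v state) \<Rightarrow> bool" where
  "is_flow xs a b \<phi> \<longleftrightarrow>
     (\<forall>x\<in>set xs. real_analytic_on (\<lambda>t. \<phi> t x) {a<..<b} \<and>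
        (\<forall>t\<in>{a<..<b}. ((\<lambda>s. \<phi> s x) has_real_derivative \<phi> t (Prime x)) (at t))) \<and>
     (\<forall>t\<in>{a<..<b}. \<forall>z. z \<notin> set xs \<union> set (primes xs) \<longrightarrow> \<phi> t z = \<phi> 0 z)"


subsection \<open>Semantics\<close>

text \<open>
  In the differential of a term the sum over all variables reduces to the variables of the term,
  the other partial derivatives being zero.
\<close>

primrec eval :: "('f \<Rightarrow> real list \<Rightarrow> real) \<Rightarrow> ('v, 'f) trm \<Rightarrow> 'v state \<Rightarrow> real" where
  "eval fi (Var x) = (\<lambda>\<mu>. \<mu> x)"
| "eval fi (Const c) = (\<lambda>\<mu>. of_rat c)"
| "eval fi (Fun f es) = (\<lambda>\<mu>. fi f (map (\<lambda>v. v \<mu>) (map (eval fi) es)))"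
| "eval fi (Mul e g) = (\<lambda>\<mu>. eval fi e \<mu> * eval fi g \<mu>)"
| "eval fi (Add e g) = (\<lambda>\<mu>. eval fi e \<mu> + eval fi g \<mu>)"
| "eval fi (Differential e) =
     (\<lambda>\<mu>. \<Sum>x\<in>fvt e. \<mu> (Prime x) * deriv (\<lambda>r. eval fi e (\<mu>(x := r))) (\<mu> x))"

primrec
  fsem :: "('f \<Rightarrow> real list \<Rightarrow> real) \<Rightarrow> ('p \<Rightarrow> real list \<Rightarrow> bool) \<Rightarrow>
    ('v, 'f, 'p) fml \<Rightarrow> 'v state set"
  and psem :: "('f \<Rightarrow> real list \<Rightarrow> real) \<Rightarrow> ('p \<Rightarrow> real list \<Rightarrow> bool) \<Rightarrow>
    ('v, 'f, 'p) prog \<Rightarrow> ('v state \<times> 'v state) set" where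
  "fsem fi qi (Leq e g) = {\<mu>. eval fi e \<mu> \<le> eval fi g \<mu>}"
| "fsem fi qi (Pred p es) = {\<mu>. qi p (map (\<lambda>e. eval fi e \<mu>) es)}"
| "fsem fi qi (And A B) = fsem fi qi A \<inter> fsem fi qi B"
| "fsem fi qi (Neg A) = - fsem fi qi A"
| "fsem fi qi (Forall x A) = {\<mu>. \<forall>r. \<mu>(x := r) \<in> fsem fi qi A}"
| "fsem fi qi (Box \<alpha> A) = {\<mu>. \<forall>\<nu>. (\<mu>, \<nu>) \<in> psem fi qi \<alpha> \<longrightarrow> \<nu> \<in> fsem fi qi A}"
| "psem fi qi (Assign x e) = {(\<mu>, \<nu>). \<nu> = \<mu>(x := eval fi e \<mu>)}"
| "psem fi qi (Test A) = {(\<mu>, \<nu>). \<nu> = \<mu> \<and> \<mu> \<in> fsem fi qi A}"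
| "psem fi qi (Seq \<alpha> \<beta>) = psem fi qi \<alpha> O psem fi qi \<beta>"
| "psem fi qi (Choice \<alpha> \<beta>) = psem fi qi \<alpha> \<union> psem fi qi \<beta>"
| "psem fi qi (Loop \<alpha>) = (\<Union>n. psem fi qi \<alpha> ^^ n)"
| "psem fi qi (DAP xs A) =
     {(\<mu>, \<nu>). \<exists>T \<epsilon> \<phi>. T \<ge> 0 \<and> \<epsilon> > 0 \<and> is_flow xs (- \<epsilon>) (T + \<epsilon>) \<phi> \<and>
        (\<forall>t\<in>{0..T}. \<phi> t \<in> fsem fi qi A) \<and> \<phi> 0 = \<mu> \<and> \<phi> T = \<nu>}"

definition valid ::
  "('f \<Rightarrow> real list \<Rightarrow> real) \<Rightarrow> ('p \<Rightarrow> real list \<Rightarrow> bool) \<Rightarrow> ('v, 'f, 'p) fml \<Rightarrow> bool" where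
  "valid fi qi A \<longleftrightarrow> (\<forall>\<mu>. \<mu> \<in> fsem fi qi A)"


subsection \<open>First-order real arithmetic\<close>

fun arith_trm :: "('v, 'f) trm \<Rightarrow> bool" where
  "arith_trm (Var x) \<longleftrightarrow> True"
| "arith_trm (Const c) \<longleftrightarrow> True"
| "arith_trm (Mul e g) \<longleftrightarrow> arith_trm e \<and> arith_trm g"
| "arith_trm (Add e g) \<longleftrightarrow> arith_trm e \<and> arith_trm g"
| "arith_trm (Fun f es) \<longleftrightarrow> False"
| "arith_trm (Differential e) \<longleftrightarrow> False"

fun fo_arith :: "('v, 'f, 'p) fml \<Rightarrow> bool" where
  "fo_arith (Leq e g) \<longleftrightarrow> arith_trm e \<and> arith_trm g"
| "fo_arith (And A B) \<longleftrightarrow> fo_arith A \<and> fo_arith B"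
| "fo_arith (Neg A) \<longleftrightarrow> fo_arith A"
| "fo_arith (Forall x A) \<longleftrightarrow> fo_arith A"
| "fo_arith (Pred p es) \<longleftrightarrow> False"
| "fo_arith (Box \<alpha> A) \<longleftrightarrow> False"

text \<open>
  Capture-avoiding simultaneous substitution. It is meant for formulas of first-order real
  arithmetic only: differentials of terms and modalities are left unchanged.
\<close>

fun tsubst :: "('v var \<Rightarrow> ('v, 'f) trm) \<Rightarrow> ('v, 'f) trm \<Rightarrow> ('v, 'f) trm" where
  "tsubst \<sigma> (Var x) = \<sigma> x"
| "tsubst \<sigma> (Const c) = Const c"
| "tsubst \<sigma> (Fun f es) = Fun f (map (tsubst \<sigma>) es)"
| "tsubst \<sigma> (Mul e g) = Mul (tsubst \<sigma> e) (tsubst \<sigma> g)"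
| "tsubst \<sigma> (Add e g) = Add (tsubst \<sigma> e) (tsubst \<sigma> g)"
| "tsubst \<sigma> (Differential e) = Differential e"

definition avoid :: "'v var \<Rightarrow> 'v var set \<Rightarrow> 'v var" where
  "avoid x X = (if x \<notin> X then x else (SOME z. z \<notin> X))"

fun fsubst :: "('v var \<Rightarrow> ('v, 'f) trm) \<Rightarrow> ('v, 'f, 'p) fml \<Rightarrow> ('v, 'f, 'p) fml" where
  "fsubst \<sigma> (Leq e g) = Leq (tsubst \<sigma> e) (tsubst \<sigma> g)"
| "fsubst \<sigma> (Pred p es) = Pred p (map (tsubst \<sigma>) es)"
| "fsubst \<sigma> (And A B) = And (fsubst \<sigma> A) (fsubst \<sigma> B)"
| "fsubst \<sigma> (Neg A) = Neg (fsubst \<sigma> A)"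
| "fsubst \<sigma> (Forall x A) =
     (let z = avoid x (\<Union>v\<in>fvf A - {x}. fvt (\<sigma> v)) in Forall z (fsubst (\<sigma>(x := Var z)) A))"
| "fsubst \<sigma> (Box \<alpha> A) = Box \<alpha> A"

text \<open>
  A formula \<open>G(\<cdot>)\<close> with an argument tuple is a formula \<open>G\<close> together with a tuple \<open>us\<close> of formal
  parameters; \<open>apply_args us G hs\<close> is \<open>G(hs)\<close>.
\<close>

definition apply_args ::
  "'v var list \<Rightarrow> ('v, 'f, 'p) fml \<Rightarrow> ('v, 'f) trm list \<Rightarrow> ('v, 'f, 'p) fml" where
  "apply_args us G hs =
     fsubst (\<lambda>v. case map_of (zip us hs) v of None \<Rightarrow> Var v | Some h \<Rightarrow> h) G"


subsection \<open>Differentials of formulas\<close>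

text \<open>
  \<open>comparisons\<close> singles out the formulas built from comparisons with conjunction and disjunction,
  and \<open>fdiff\<close> is their differential. In terms of the derived connectives, the second equation is
  the strict comparison \<open>Lt g e\<close> and the fourth is \<open>Or A B\<close>; \<open>Eq e g\<close> is covered by the third,
  and its differential is \<open>Eq (Differential e) (Differential g)\<close>.
\<close>

fun comparisons :: "('v, 'f, 'p) fml \<Rightarrow> bool" where
  "comparisons (Leq e g) \<longleftrightarrow> True"
| "comparisons (Neg (Leq e g)) \<longleftrightarrow> True"
| "comparisons (And A B) \<longleftrightarrow> comparisons A \<and> comparisons B"
| "comparisons (Neg (And (Neg A) (Neg B))) \<longleftrightarrow> comparisons A \<and> comparisons B"
| "comparisons _ \<longleftrightarrow> False"

fun fdiff :: "('v, 'f, 'p) fml \<Rightarrow> ('v, 'f, 'p) fml" where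
  "fdiff (Leq e g) = Leq (Differential e) (Differential g)"
| "fdiff (Neg (Leq e g)) = Neg (Leq (Differential e) (Differential g))"
| "fdiff (And A B) = And (fdiff A) (fdiff B)"
| "fdiff (Neg (And (Neg A) (Neg B))) = And (fdiff A) (fdiff B)"
| "fdiff A = undefined"


subsection \<open>Local progress, entry, exit and mode consistency\<close>

text \<open>
  The tuple \<open>ws\<close> supplies the fresh variables bound in the progress formula.
\<close>

definition progress ::
  "'v var list \<Rightarrow> 'v var list \<Rightarrow> ('v, 'f, 'p) fml \<Rightarrow> ('v, 'f, 'p) fml" where
  "progress ws xs A =
     Exs ws (Exs (primes ws)
       (And (VarEqs xs ws) (And (VarEqs (primes xs) (primes ws))
         (Diamond (DAP xs (Or A (And (VarEqs xs ws) (VarEqs (primes xs) (primes ws)))))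
           (Neg (VarEqs xs ws))))))"

text \<open>
  For a tuple without repetitions the consecutive assignments below negate all differential
  variables simultaneously.
\<close>

definition reverse :: "'v var list \<Rightarrow> ('v, 'f, 'p) fml \<Rightarrow> ('v, 'f, 'p) fml" where
  "reverse xs A = foldr (\<lambda>x B. Box (Assign x (Mul (Const (-1)) (Var x))) B) (primes xs) A"

definition exit_fml ::
  "'v var list \<Rightarrow> 'v var list \<Rightarrow> ('v, 'f, 'p) fml \<Rightarrow> ('v, 'f, 'p) fml" where
  "exit_fml ws xs A =
     Or (And (progress ws xs (Neg A)) A)
        (And (reverse xs (progress ws xs (reverse xs A))) (Neg A))"

definition enter_fml ::
  "'v var list \<Rightarrow> 'v var list \<Rightarrow> ('v, 'f, 'p) fml \<Rightarrow> ('v, 'f, 'p) fml" where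
  "enter_fml ws xs A =
     Or (And (progress ws xs A) (Neg A))
        (And (reverse xs (progress ws xs (Neg (reverse xs A)))) A)"

definition consis ::
  "'v var list \<Rightarrow> 'v var list \<Rightarrow> ('v, 'f, 'p) fml \<Rightarrow> ('v, 'f, 'p) fml \<Rightarrow> ('v, 'f, 'p) fml" where
  "consis ws xs A B = Imp (And (exit_fml ws xs A) (enter_fml ws xs B)) (Iff A B)"


subsection \<open>Side conditions\<close>

definition no_free :: "'v var list \<Rightarrow> 'v var set \<Rightarrow> bool" where
  "no_free ys X \<longleftrightarrow> (set ys \<union> set (primes ys)) \<inter> X = {}"

text \<open>
  The variables of \<open>ys\<close> and their differentials are pairwise distinct and new with respect to
  \<open>xs\<close> and its differentials.
\<close>

definition new_tuple :: "'v var list \<Rightarrow> 'v var list \<Rightarrow> bool" where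
  "new_tuple ys xs \<longleftrightarrow> distinct (ys @ primes ys) \<and> no_free ys (set xs \<union> set (primes xs))"

text \<open>
  A variable \<open>z\<close> outside \<open>xs\<close> is constant along flows in \<open>xs\<close>, but \<open>z'\<close> keeps its arbitrary
  initial value and enters differentials of terms that mention \<open>z\<close>. The relation \<open>parameters\<close> says that
  \<open>zs\<close> lists all such parameters among the variables \<open>X\<close> and that their differentials are not
  changed by flows either; \<open>Constant zs\<close> says that these differentials vanish.
\<close>

definition parameters :: "'v var list \<Rightarrow> 'v var list \<Rightarrow> 'v var set \<Rightarrow> bool" where
  "parameters zs xs X \<longleftrightarrow> X \<subseteq> set xs \<union> set zs \<and> set (primes zs) \<inter> set xs = {}"

definition Constant :: "'v var list \<Rightarrow> ('v, 'f, 'p) fml" where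
  "Constant zs = Eqs (map Var (primes zs)) (map (\<lambda>_. Const 0) zs)"

end

theory Submission
  imports "HOL-Complex_Analysis.Complex_Analysis" Defs
begin

text \<open>
  Terms denote real analytic functions. We work with local complex extensions that are bounded and
  holomorphic along every holomorphic curve: this class contains the convergent power series and is
  closed under composition and, as difference quotients converge uniformly, under partial
  derivatives. Hence the value of a term along a flow is analytic in time, and its derivative is the
  value of the differential of the term whenever the parameters have differential zero; this gives
  DE, DI and AG.

  For BDG the ghost equation is solved locally by Picard iteration in a complex disc, with an
  existence time that is locally uniform in the initial data. The bound on \<open>\<parallel>y\<parallel>\<^sup>2\<close> and a convergent
  subsequence of values then carry the solution up to the final time.

  For GS the constraints may contain quantifiers, so one needs that they change their truth value
  only finitely often along a flow. By the Cohen--Hoermander elimination procedure the truth value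
  of a formula of real arithmetic depends only on the signs of finitely many polynomials. It is
  carried out semantically: if two states agree in the signs of suitable polynomials in the
  parameters, then an order isomorphism of the real line matches the signs of a given family of
  polynomials at the two states. Signs of analytic functions are constant on one-sided
  neighbourhoods, and mode consistency says precisely that at every time some mode holds on a
  closed one-sided neighbourhood; so the run decomposes into finitely many runs inside one mode.
\<close>

subsection \<open>Derived connectives\<close>

text \<open>A state assigns values to infinitely many variables, but a flow moves only finitely many
  of them. Hence analyticity is tested along one-parameter complex curves: Cauchy estimates in one
  variable supply all bounds, and holomorphy survives uniform limits, which covers difference
  quotients, power series and Picard iterates alike. A run of duration 0 constrains its flow at a
  single instant and says nothing about derivatives. This is why DE carries a test premise for the
  initial differential, and why BDG demands the ghost equation in the initial state: the ghosts have
  to start with the given values of \<open>ys\<close> and of their primes. Box premises speak about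
  end states only. Since every initial segment of a run is itself a run, they nevertheless control
  all times; in BDG this turns the bound into an a priori estimate for partial solutions, before it
  is known that any solution reaches the final time. In GS a supremum over time replaces the
  counting of switches, so it is enough to understand one-sided neighbourhoods of a single
  instant.\<close>

lemma fsem_Or [simp]: "fsem fi qi (Or A B) = fsem fi qi A \<union> fsem fi qi B"
  by (auto simp: Or_def)

lemma fsem_Imp: "\<mu> \<in> fsem fi qi (Imp A B) \<longleftrightarrow> (\<mu> \<in> fsem fi qi A \<longrightarrow> \<mu> \<in> fsem fi qi B)"
  by (auto simp: Imp_def)

lemma fsem_Iff: "\<mu> \<in> fsem fi qi (Iff A B) \<longleftrightarrow> (\<mu> \<in> fsem fi qi A \<longleftrightarrow> \<mu> \<in> fsem fi qi B)"
  by (auto simp: Iff_def fsem_Imp)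

lemma fsem_Eq: "\<mu> \<in> fsem fi qi (Eq e g) \<longleftrightarrow> eval fi e \<mu> = eval fi g \<mu>"
  by (auto simp: Eq_def)

lemma fsem_Diamond:
  "\<mu> \<in> fsem fi qi (Diamond \<alpha> A) \<longleftrightarrow> (\<exists>\<nu>. (\<mu>, \<nu>) \<in> psem fi qi \<alpha> \<and> \<nu> \<in> fsem fi qi A)"
  by (auto simp: Diamond_def)

lemma fsem_Foralls:
  "\<mu> \<in> fsem fi qi (Foralls zs A) \<longleftrightarrow>
     (\<forall>\<nu>. (\<forall>z. z \<notin> set zs \<longrightarrow> \<nu> z = \<mu> z) \<longrightarrow> \<nu> \<in> fsem fi qi A)"
proof (induction zs arbitrary: \<mu>)
  case Nil
  have "\<nu> = \<mu>" if "\<forall>z. \<nu> z = \<mu> z" for \<nu>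
    using that by auto
  then show ?case
    by (auto simp: Foralls_def)
next
  case (Cons x zs)
  have "\<mu> \<in> fsem fi qi (Foralls (x # zs) A) \<longleftrightarrow> (\<forall>r. \<mu>(x := r) \<in> fsem fi qi (Foralls zs A))"
    by (simp add: Foralls_def)
  also have "\<dots> \<longleftrightarrow>
      (\<forall>r \<nu>. (\<forall>z. z \<notin> set zs \<longrightarrow> \<nu> z = (\<mu>(x := r)) z) \<longrightarrow> \<nu> \<in> fsem fi qi A)"
    by (simp add: Cons.IH)
  also have "\<dots> \<longleftrightarrow> (\<forall>\<nu>. (\<forall>z. z \<notin> set (x # zs) \<longrightarrow> \<nu> z = \<mu> z) \<longrightarrow> \<nu> \<in> fsem fi qi A)"
  proof (intro iffI allI impI)
    fix \<nu>
    assume "\<forall>r \<nu>. (\<forall>z. z \<notin> set zs \<longrightarrow> \<nu> z = (\<mu>(x := r)) z) \<longrightarrow> \<nu> \<in> fsem fi qi A"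
      and "\<forall>z. z \<notin> set (x # zs) \<longrightarrow> \<nu> z = \<mu> z"
    then show "\<nu> \<in> fsem fi qi A"
      by (elim allE[of _ "\<nu> x"] allE[of _ \<nu>]) auto
  qed auto
  finally show ?case .
qed

lemma fsem_Exs:
  "\<mu> \<in> fsem fi qi (Exs zs A) \<longleftrightarrow>
     (\<exists>\<nu>. (\<forall>z. z \<notin> set zs \<longrightarrow> \<nu> z = \<mu> z) \<and> \<nu> \<in> fsem fi qi A)"
proof -
  have "fsem fi qi (Exs zs A) = - fsem fi qi (Foralls zs (Neg A))"
    by (induction zs) (auto simp: Exs_def Foralls_def Exists_def)
  then show ?thesis
    by (auto simp: fsem_Foralls)
qed

lemma fsem_Eqs:
  "\<mu> \<in> fsem fi qi (Eqs es gs) \<longleftrightarrow> (\<forall>(e, g)\<in>set (zip es gs). eval fi e \<mu> = eval fi g \<mu>)"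
proof -
  have "\<mu> \<in> fsem fi qi (foldr And (map (case_prod Eq) ps) Truth) \<longleftrightarrow>
      (\<forall>(e, g)\<in>set ps. eval fi e \<mu> = eval fi g \<mu>)" for ps
    by (induction ps) (auto simp: fsem_Eq Truth_def)
  then show ?thesis
    by (simp add: Eqs_def)
qed

lemma fsem_Eqs_nth:
  assumes "length es = length gs"
  shows "\<mu> \<in> fsem fi qi (Eqs es gs) \<longleftrightarrow> (\<forall>i<length es. eval fi (es ! i) \<mu> = eval fi (gs ! i) \<mu>)"
  unfolding fsem_Eqs set_zip using assms by auto

lemma fsem_Constant: "\<mu> \<in> fsem fi qi (Constant zs) \<longleftrightarrow> (\<forall>z\<in>set zs. \<mu> (Prime z) = 0)"
  by (simp add: Constant_def fsem_Eqs_nth all_set_conv_all_nth)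

lemma fsem_VarEqs:
  assumes "length ws = length xs"
  shows "\<mu> \<in> fsem fi qi (VarEqs xs ws) \<longleftrightarrow> (\<forall>i<length xs. \<mu> (xs ! i) = \<mu> (ws ! i))"
  using assms by (simp add: fsem_Eqs_nth)

lemma eval_sqnorm: "eval fi (sqnorm ys) \<mu> = (\<Sum>y\<leftarrow>ys. (\<mu> y)\<^sup>2)"
  by (induction ys) (auto simp: sqnorm_def power2_eq_square)


subsection \<open>Coincidence\<close>

lemma finite_fvt [simp]: "finite (fvt e)"
  by (induction e) auto

lemma finite_fvf_fo_arith: "fo_arith A \<Longrightarrow> finite (fvf A)"
  by (induction A rule: fo_arith.induct) auto

lemma eval_coincidence:
  "(\<And>x. x \<in> fvt e \<Longrightarrow> \<mu> x = \<nu> x) \<Longrightarrow> eval fi e \<mu> = eval fi e \<nu>"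
proof (induction e arbitrary: \<mu> \<nu>)
  case (Fun f es)
  have "eval fi e \<mu> = eval fi e \<nu>" if "e \<in> set es" for e
    by (rule Fun.IH[OF that]) (use that Fun.prems in auto)
  then show ?case
    by (simp cong: map_cong)
next
  case (Mul e1 e2)
  have "eval fi e1 \<mu> = eval fi e1 \<nu>" "eval fi e2 \<mu> = eval fi e2 \<nu>"
    by (rule Mul.IH; use Mul.prems in simp)+
  then show ?case
    by simp
next
  case (Add e1 e2)
  have "eval fi e1 \<mu> = eval fi e1 \<nu>" "eval fi e2 \<mu> = eval fi e2 \<nu>"
    by (rule Add.IH; use Add.prems in simp)+
  then show ?case
    by simp
next
  case (Differential e)
  have "(\<lambda>r. eval fi e (\<mu>(x := r))) = (\<lambda>r. eval fi e (\<nu>(x := r)))" for x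
    by (rule ext, rule Differential.IH) (use Differential.prems in auto)
  moreover have "\<mu> x = \<nu> x" "\<mu> (Prime x) = \<nu> (Prime x)" if "x \<in> fvt e" for x
    using Differential.prems that by auto
  ultimately show ?case
    by (auto intro!: sum.cong)
qed auto

lemma DAP_I:
  assumes "T \<ge> 0" "\<epsilon> > 0" "is_flow xs (- \<epsilon>) (T + \<epsilon>) \<phi>"
    "\<And>t. 0 \<le> t \<Longrightarrow> t \<le> T \<Longrightarrow> \<phi> t \<in> fsem fi qi A" "\<phi> 0 = \<mu>" "\<phi> T = \<nu>"
  shows "(\<mu>, \<nu>) \<in> psem fi qi (DAP xs A)"
  unfolding psem.simps using assms by (intro CollectI case_prodI exI[of _ T] exI[of _ \<epsilon>] exI[of _ \<phi>]) auto

lemma DAP_E: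
  assumes "(\<mu>, \<nu>) \<in> psem fi qi (DAP xs A)"
  obtains T \<epsilon> \<phi> where "T \<ge> 0" "\<epsilon> > 0" "is_flow xs (- \<epsilon>) (T + \<epsilon>) \<phi>"
    "\<forall>t\<in>{0..T}. \<phi> t \<in> fsem fi qi A" "\<phi> 0 = \<mu>" "\<phi> T = \<nu>"
  using assms unfolding psem.simps by blast

lemma is_flow_outside:
  "is_flow xs a b \<phi> \<Longrightarrow> a < t \<Longrightarrow> t < b \<Longrightarrow> z \<notin> set xs \<Longrightarrow> z \<notin> Prime ` set xs \<Longrightarrow> \<phi> t z = \<phi> 0 z"
  by (simp add: is_flow_def)

text \<open>Everything outside \<open>xs\<close> and its primes is frozen by a flow, so these values
  may be replaced by those of another state \<open>\<mu>\<close>.\<close>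

lemma is_flow_coincidence:
  assumes "is_flow xs a b \<phi>" "\<And>z. z \<in> set xs \<union> set (primes xs) \<Longrightarrow> \<phi> 0 z = \<mu> z"
  shows "is_flow xs a b (\<lambda>t z. if z \<in> set xs \<union> set (primes xs) then \<phi> t z else \<mu> z)"
  using assms by (auto simp: is_flow_def)

text \<open>The second part is stated for every superset \<open>V\<close> of the free variables
  because agreement has to be propagated: after the first half of a sequence the states also agree
  on its must-bound variables, and those may be free in the second half. A loop binds nothing for
  certain, so agreement on \<open>V\<close> is what passes from one iteration to the next.\<close>

lemma fsem_psem_coincidence:
  fixes A :: "('v, 'f, 'p) fml" and \<alpha> :: "('v, 'f, 'p) prog"
  shows "\<And>\<mu> \<nu>. (\<And>x. x \<in> fvf A \<Longrightarrow> \<mu> x = \<nu> x) \<Longrightarrow> \<mu> \<in> fsem fi qi A \<Longrightarrow> \<nu> \<in> fsem fi qi A"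
    and "\<And>V \<mu> \<mu>' \<nu>. fvp \<alpha> \<subseteq> V \<Longrightarrow> (\<And>x. x \<in> V \<Longrightarrow> \<mu> x = \<mu>' x) \<Longrightarrow> (\<mu>, \<nu>) \<in> psem fi qi \<alpha> \<Longrightarrow>
           \<exists>\<nu>'. (\<mu>', \<nu>') \<in> psem fi qi \<alpha> \<and> (\<forall>x\<in>V \<union> mbv \<alpha>. \<nu> x = \<nu>' x)"
proof (induction A and \<alpha> rule: fml.induct prog.induct)
  case (Leq e g)
  then show ?case
    using eval_coincidence[of e \<mu> \<nu> fi] eval_coincidence[of g \<mu> \<nu> fi] by simp
next
  case (Pred p es)
  have "map (\<lambda>e. eval fi e \<mu>) es = map (\<lambda>e. eval fi e \<nu>) es"
    using Pred.prems(1) by (auto intro!: eval_coincidence)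
  with Pred.prems(2) show ?case
    by (metis fsem.simps(2) mem_Collect_eq)
next
  case (And A B)
  then show ?case
    by (metis Int_iff UnCI fsem.simps(3) fvf.simps(3))
next
  case (Neg A)
  then show ?case
    by (metis Compl_iff fsem.simps(4) fvf.simps(4))
next
  case (Forall x A)
  have "\<nu>(x := r) \<in> fsem fi qi A" for r
  proof (rule Forall.IH)
    show "\<mu>(x := r) \<in> fsem fi qi A"
      using Forall.prems(2) by simp
  qed (use Forall.prems(1) in auto)
  then show ?case
    by simp
next
  case (Box \<alpha> A)
  have "\<nu>' \<in> fsem fi qi A" if \<nu>': "(\<nu>, \<nu>') \<in> psem fi qi \<alpha>" for \<nu>'
  proof -
    obtain \<mu>' where "(\<mu>, \<mu>') \<in> psem fi qi \<alpha>" and *: "\<forall>x\<in>fvf (Box \<alpha> A) \<union> mbv \<alpha>. \<nu>' x = \<mu>' x"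
      using Box.IH(1)[of "fvf (Box \<alpha> A)" \<nu> \<mu> \<nu>'] Box.prems(1) \<nu>' by auto
    then have "\<mu>' \<in> fsem fi qi A"
      using Box.prems(2) by simp
    then show ?thesis
      using * by (intro Box.IH(2)[of \<mu>' \<nu>']) auto
  qed
  then show ?case
    by simp
next
  case (Assign x e)
  have "eval fi e \<mu> = eval fi e \<mu>'"
    using Assign.prems by (intro eval_coincidence) auto
  with Assign.prems show ?case
    by auto
next
  case (Test A)
  then have "\<mu>' \<in> fsem fi qi A" "\<nu> = \<mu>"
    using Test.IH[of \<mu> \<mu>'] by auto
  with Test.prems show ?case
    by auto
next
  case (Seq \<alpha> \<beta>)
  obtain \<kappa> where \<kappa>: "(\<mu>, \<kappa>) \<in> psem fi qi \<alpha>" "(\<kappa>, \<nu>) \<in> psem fi qi \<beta>"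
    using Seq.prems(3) by auto
  obtain \<kappa>' where \<kappa>': "(\<mu>', \<kappa>') \<in> psem fi qi \<alpha>" "\<forall>x\<in>V \<union> mbv \<alpha>. \<kappa> x = \<kappa>' x"
    using Seq.IH(1)[of V \<mu> \<mu>' \<kappa>] Seq.prems \<kappa> by auto
  moreover have "fvp \<beta> \<subseteq> V \<union> mbv \<alpha>"
    using Seq.prems(1) by auto
  ultimately obtain \<nu>' where "(\<kappa>', \<nu>') \<in> psem fi qi \<beta>" "\<forall>x\<in>(V \<union> mbv \<alpha>) \<union> mbv \<beta>. \<nu> x = \<nu>' x"
    using Seq.IH(2)[of "V \<union> mbv \<alpha>" \<kappa> \<kappa>' \<nu>] \<kappa>(2) by blast
  with \<kappa>' show ?case
    by auto
next
  case (Choice \<alpha> \<beta>)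
  from Choice.prems(3) consider "(\<mu>, \<nu>) \<in> psem fi qi \<alpha>" | "(\<mu>, \<nu>) \<in> psem fi qi \<beta>"
    by auto
  then show ?case
  proof cases
    case 1
    then obtain \<nu>' where "(\<mu>', \<nu>') \<in> psem fi qi \<alpha>" "\<forall>x\<in>V \<union> mbv \<alpha>. \<nu> x = \<nu>' x"
      using Choice.IH(1)[of V \<mu> \<mu>' \<nu>] Choice.prems by auto
    then show ?thesis
      by auto
  next
    case 2
    then obtain \<nu>' where "(\<mu>', \<nu>') \<in> psem fi qi \<beta>" "\<forall>x\<in>V \<union> mbv \<beta>. \<nu> x = \<nu>' x"
      using Choice.IH(2)[of V \<mu> \<mu>' \<nu>] Choice.prems by auto
    then show ?thesis
      by auto
  qed
next
  case (Loop \<alpha>)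
  have "\<exists>\<nu>'. (\<mu>', \<nu>') \<in> psem fi qi \<alpha> ^^ n \<and> (\<forall>x\<in>V. \<nu> x = \<nu>' x)"
    if "(\<mu>, \<nu>) \<in> psem fi qi \<alpha> ^^ n" for n \<nu>
    using that
  proof (induction n arbitrary: \<nu>)
    case 0
    then show ?case
      using Loop.prems by auto
  next
    case (Suc n)
    then obtain \<kappa> where \<kappa>: "(\<mu>, \<kappa>) \<in> psem fi qi \<alpha> ^^ n" "(\<kappa>, \<nu>) \<in> psem fi qi \<alpha>"
      by auto
    obtain \<kappa>' where \<kappa>': "(\<mu>', \<kappa>') \<in> psem fi qi \<alpha> ^^ n" "\<forall>x\<in>V. \<kappa> x = \<kappa>' x"
      using Suc.IH[OF \<kappa>(1)] by auto
    obtain \<nu>' where "(\<kappa>', \<nu>') \<in> psem fi qi \<alpha>" "\<forall>x\<in>V \<union> mbv \<alpha>. \<nu> x = \<nu>' x"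
      using Loop.IH[of V \<kappa> \<kappa>' \<nu>] Loop.prems(1) \<kappa> \<kappa>' by auto
    with \<kappa>' show ?case
      by (intro exI[of _ \<nu>']) auto
  qed
  moreover obtain n where "(\<mu>, \<nu>) \<in> psem fi qi \<alpha> ^^ n"
    using Loop.prems(3) by auto
  ultimately obtain \<nu>' where "(\<mu>', \<nu>') \<in> psem fi qi \<alpha> ^^ n" "\<forall>x\<in>V. \<nu> x = \<nu>' x"
    by blast
  then show ?case
    by (intro exI[of _ \<nu>']) auto
next
  case (DAP xs A)
  from DAP.prems(3) obtain T \<epsilon> \<phi> where \<phi>: "T \<ge> 0" "\<epsilon> > 0" "is_flow xs (- \<epsilon>) (T + \<epsilon>) \<phi>"
      "\<forall>t\<in>{0..T}. \<phi> t \<in> fsem fi qi A" "\<phi> 0 = \<mu>" "\<phi> T = \<nu>"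
    by (rule DAP_E)
  define \<psi> where "\<psi> = (\<lambda>t z. if z \<in> set xs \<union> set (primes xs) then \<phi> t z else \<mu>' z)"
  have \<psi>: "is_flow xs (- \<epsilon>) (T + \<epsilon>) \<psi>"
    unfolding \<psi>_def using \<phi>(3,5) DAP.prems by (intro is_flow_coincidence) auto
  have V: "\<phi> t z = \<psi> t z" if "t \<in> {0..T}" "z \<in> V \<union> set xs \<union> set (primes xs)" for t z
  proof (cases "z \<in> set xs \<union> set (primes xs)")
    case False
    then have "\<phi> t z = \<phi> 0 z"
      using \<phi>(2) that(1) by (intro is_flow_outside[OF \<phi>(3)]) auto
    moreover have "\<mu> z = \<mu>' z"
      using False that DAP.prems(2) by blast
    moreover have "\<psi> t z = \<mu>' z"
      using False by (simp add: \<psi>_def)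
    ultimately show ?thesis
      using \<phi>(5) by simp
  qed (auto simp: \<psi>_def)
  have \<psi>A: "\<psi> t \<in> fsem fi qi A" if "0 \<le> t" "t \<le> T" for t
  proof (rule DAP.IH)
    show "\<phi> t \<in> fsem fi qi A"
      using \<phi>(4) that by simp
    show "\<phi> t x = \<psi> t x" if "x \<in> fvf A" for x
      using V[of t x] DAP.prems(1) that \<open>0 \<le> t\<close> \<open>t \<le> T\<close> by auto
  qed
  have "\<psi> 0 = \<mu>'"
    using \<phi>(5) DAP.prems by (auto simp: \<psi>_def fun_eq_iff)
  then have "(\<mu>', \<psi> T) \<in> psem fi qi (DAP xs A)"
    using \<phi>(1,2) \<psi> \<psi>A by (intro DAP_I) auto
  moreover have "\<forall>x\<in>V \<union> mbv (DAP xs A). \<nu> x = \<psi> T x"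
    using V[of T] \<phi>(1,6) by auto
  ultimately show ?case
    by blast
qed

lemma fsem_coincidence:
  assumes "\<And>x. x \<in> fvf A \<Longrightarrow> \<mu> x = \<nu> x"
  shows "\<mu> \<in> fsem fi qi A \<longleftrightarrow> \<nu> \<in> fsem fi qi A"
  using assms fsem_psem_coincidence(1)[of A \<mu> \<nu>] fsem_psem_coincidence(1)[of A \<nu> \<mu>] by auto


subsection \<open>Substitution\<close>

lemma size_Prime_pow: "size ((Prime ^^ n) z) = n + size z"
  by (induction n) auto

text \<open>The iterated primes of \<open>z\<close> are pairwise different because each prime
  increases the size. This supplies fresh bound variables for substitution, and the end of the chain
  \<open>z\<close>, \<open>z'\<close>, \<open>z''\<close>, ... inside a tuple.\<close>

lemma Prime_pow_leaves_finite:
  assumes "finite X"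
  shows "\<exists>n. (Prime ^^ n) z \<notin> X"
proof (rule ccontr)
  assume "\<nexists>n. (Prime ^^ n) z \<notin> X"
  then have "range (\<lambda>n. (Prime ^^ n) z) \<subseteq> X"
    by auto
  moreover have "inj (\<lambda>n. (Prime ^^ n) z)"
    by (rule injI) (metis add_right_cancel size_Prime_pow)
  ultimately show False
    using assms finite_subset range_inj_infinite by blast
qed

lemma infinite_UNIV_var: "infinite (UNIV :: 'v var set)"
  using Prime_pow_leaves_finite[of UNIV] by auto

lemma avoid_notin: "finite X \<Longrightarrow> avoid x X \<notin> X"
  unfolding avoid_def by (metis (mono_tags) ex_new_if_finite infinite_UNIV_var someI_ex)

lemma eval_tsubst:
  "arith_trm e \<Longrightarrow> eval fi (tsubst \<sigma> e) \<mu> = eval fi e (\<lambda>v. eval fi (\<sigma> v) \<mu>)"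
  by (induction e rule: arith_trm.induct) auto

text \<open>Substitution amounts to evaluation in the state of substituted values. Under a
  quantifier the renamed variable \<open>z\<close> does not occur in what is substituted for the
  free variables other than \<open>x\<close>, so updating \<open>z\<close> leaves those values
  alone.\<close>

lemma fsem_fsubst:
  "fo_arith A \<Longrightarrow> \<mu> \<in> fsem fi qi (fsubst \<sigma> A) \<longleftrightarrow> (\<lambda>v. eval fi (\<sigma> v) \<mu>) \<in> fsem fi qi A"
proof (induction A arbitrary: \<sigma> \<mu> rule: fo_arith.induct)
  case (4 x A)
  define z where "z = avoid x (\<Union>v\<in>fvf A - {x}. fvt (\<sigma> v))"
  have z: "z \<notin> (\<Union>v\<in>fvf A - {x}. fvt (\<sigma> v))"
    unfolding z_def using 4 by (intro avoid_notin) (auto simp: finite_fvf_fo_arith)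
  have "(\<lambda>v. eval fi ((\<sigma>(x := Var z)) v) (\<mu>(z := r))) \<in> fsem fi qi A \<longleftrightarrow>
      ((\<lambda>v. eval fi (\<sigma> v) \<mu>)(x := r)) \<in> fsem fi qi A" for r
    by (rule fsem_coincidence) (use z in \<open>auto intro!: eval_coincidence\<close>)
  moreover have "fsubst \<sigma> (Forall x A) = Forall z (fsubst (\<sigma>(x := Var z)) A)"
    by (simp add: Let_def z_def)
  ultimately show ?case
    using 4 by simp
qed (simp_all add: eval_tsubst)

lemma fsem_apply_args:
  assumes "fo_arith G"
  shows "\<mu> \<in> fsem fi qi (apply_args us G hs) \<longleftrightarrow>
     (\<lambda>v. case map_of (zip us hs) v of None \<Rightarrow> \<mu> v | Some h \<Rightarrow> eval fi h \<mu>) \<in> fsem fi qi G"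
proof -
  have "eval fi (case map_of (zip us hs) v of None \<Rightarrow> Var v | Some h \<Rightarrow> h) \<mu> =
      (case map_of (zip us hs) v of None \<Rightarrow> \<mu> v | Some h \<Rightarrow> eval fi h \<mu>)" for v
    by (simp split: option.split)
  then show ?thesis
    by (simp add: apply_args_def fsem_fsubst[OF assms])
qed

subsection \<open>Functions of infinitely many real variables with a complex extension\<close>

text \<open>One radius serves all variables at once. On infinitely many coordinates this is a strong
  notion of nearness; a moving curve satisfies it because only finitely many coordinates
  move.\<close>

definition cnear :: "('x \<Rightarrow> real) \<Rightarrow> real \<Rightarrow> ('x \<Rightarrow> complex) \<Rightarrow> bool" where
  "cnear s r c \<longleftrightarrow> (\<forall>x. cmod (c x - of_real (s x)) < r)"

text \<open>
  \<open>E\<close> is a bounded complex extension of \<open>f\<close> near \<open>s\<close>. Holomorphy is only required along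
  holomorphic curves, a notion for which sums, products and compositions need no calculus in
  several complex variables.
\<close>

definition cext ::
  "(('x \<Rightarrow> real) \<Rightarrow> real) \<Rightarrow> ('x \<Rightarrow> real) \<Rightarrow> real \<Rightarrow> real \<Rightarrow> (('x \<Rightarrow> complex) \<Rightarrow> complex) \<Rightarrow> bool" where
  "cext f s r B E \<longleftrightarrow> r > 0 \<and>
     (\<forall>U c. open U \<longrightarrow> (\<forall>z\<in>U. cnear s r (c z)) \<longrightarrow> (\<forall>x. (\<lambda>z. c z x) holomorphic_on U) \<longrightarrow>
        (\<lambda>z. E (c z)) holomorphic_on U) \<and>
     (\<forall>c. cnear s r c \<longrightarrow> cmod (E c) \<le> B) \<and>
     (\<forall>u. cnear s r (\<lambda>x. of_real (u x)) \<longrightarrow> E (\<lambda>x. of_real (u x)) = of_real (f u))"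

definition analytic_fun :: "(('x \<Rightarrow> real) \<Rightarrow> real) \<Rightarrow> bool" where
  "analytic_fun f \<longleftrightarrow> (\<forall>s. \<exists>r B E. cext f s r B E)"

lemma cnear_of_real: "cnear s r (\<lambda>x. of_real (u x)) \<longleftrightarrow> (\<forall>x. \<bar>u x - s x\<bar> < r)"
  unfolding cnear_def by (metis norm_of_real of_real_diff)

lemma cnear_mono: "cnear s r c \<Longrightarrow> r \<le> r' \<Longrightarrow> cnear s r' c"
  by (auto simp: cnear_def intro: less_le_trans)

lemma cnear_self: "r > 0 \<Longrightarrow> cnear s r (\<lambda>x. of_real (s x))"
  by (simp add: cnear_def)

lemma cextD:
  assumes "cext f s r B E"
  shows "r > 0"
    and "\<And>U c. open U \<Longrightarrow> (\<And>z. z \<in> U \<Longrightarrow> cnear s r (c z)) \<Longrightarrow> (\<And>x. (\<lambda>z. c z x) holomorphic_on U) \<Longrightarrow>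
        (\<lambda>z. E (c z)) holomorphic_on U"
    and "\<And>c. cnear s r c \<Longrightarrow> cmod (E c) \<le> B"
    and "\<And>u. cnear s r (\<lambda>x. of_real (u x)) \<Longrightarrow> E (\<lambda>x. of_real (u x)) = of_real (f u)"
    and "B \<ge> 0"
proof -
  show "r > 0" using assms by (simp add: cext_def)
  then have "cmod (E (\<lambda>x. of_real (s x))) \<le> B"
    using assms cnear_self[of r s] by (auto simp: cext_def)
  then show "B \<ge> 0"
    by (meson norm_ge_zero order_trans)
qed (use assms in \<open>auto simp: cext_def\<close>)

lemma cextI:
  assumes "r > 0"
    and "\<And>U c. open U \<Longrightarrow> (\<And>z. z \<in> U \<Longrightarrow> cnear s r (c z)) \<Longrightarrow> (\<And>x. (\<lambda>z. c z x) holomorphic_on U) \<Longrightarrow>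
        (\<lambda>z. E (c z)) holomorphic_on U"
    and "\<And>c. cnear s r c \<Longrightarrow> cmod (E c) \<le> B"
    and "\<And>u. cnear s r (\<lambda>x. of_real (u x)) \<Longrightarrow> E (\<lambda>x. of_real (u x)) = of_real (f u)"
  shows "cext f s r B E"
  using assms unfolding cext_def by blast

lemma cext_mono: "cext f s r B E \<Longrightarrow> 0 < r' \<Longrightarrow> r' \<le> r \<Longrightarrow> cext f s r' B E"
  unfolding cext_def by (meson cnear_mono)

lemma cext_const: "cext (\<lambda>u. a) s 1 \<bar>a\<bar> (\<lambda>c. of_real a)"
  by (rule cextI) auto

lemma cext_var: "cext (\<lambda>u. u x) s 1 (\<bar>s x\<bar> + 1) (\<lambda>c. c x)"
proof (rule cextI)
  fix c :: "'a \<Rightarrow> complex"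
  assume "cnear s 1 c"
  then have "cmod (c x - of_real (s x)) \<le> 1"
    by (auto simp: cnear_def intro: less_imp_le)
  then show "cmod (c x) \<le> \<bar>s x\<bar> + 1"
    using norm_triangle_sub[of "c x" "of_real (s x)"] by simp
qed auto

lemma cext_add:
  assumes "cext f s r B E" "cext g s r B' E'"
  shows "cext (\<lambda>u. f u + g u) s r (B + B') (\<lambda>c. E c + E' c)"
proof (rule cextI)
  show "cmod (E c + E' c) \<le> B + B'" if "cnear s r c" for c
    using norm_triangle_mono[OF cextD(3)[OF assms(1) that] cextD(3)[OF assms(2) that]] .
  show "(\<lambda>z. E (c z) + E' (c z)) holomorphic_on U"
    if "open U" "\<And>z. z \<in> U \<Longrightarrow> cnear s r (c z)" "\<And>x. (\<lambda>z. c z x) holomorphic_on U" for U c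
    using that by (intro holomorphic_on_add cextD(2)[OF assms(1)] cextD(2)[OF assms(2)])
  show "r > 0"
    using cextD(1)[OF assms(1)] .
qed (use cextD(4)[OF assms(1)] cextD(4)[OF assms(2)] in auto)

lemma cext_mult:
  assumes "cext f s r B E" "cext g s r B' E'"
  shows "cext (\<lambda>u. f u * g u) s r (B * B') (\<lambda>c. E c * E' c)"
proof (rule cextI)
  show "cmod (E c * E' c) \<le> B * B'" if "cnear s r c" for c
    unfolding norm_mult using cextD(3,5)[OF assms(1)] cextD(3)[OF assms(2)] that by (intro mult_mono) auto
  show "(\<lambda>z. E (c z) * E' (c z)) holomorphic_on U"
    if "open U" "\<And>z. z \<in> U \<Longrightarrow> cnear s r (c z)" "\<And>x. (\<lambda>z. c z x) holomorphic_on U" for U c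
    using that by (intro holomorphic_on_mult cextD(2)[OF assms(1)] cextD(2)[OF assms(2)])
  show "r > 0"
    using cextD(1)[OF assms(1)] .
qed (use cextD(4)[OF assms(1)] cextD(4)[OF assms(2)] in auto)

lemma analytic_funI: "(\<And>s. cext f s (r s) (B s) (E s)) \<Longrightarrow> analytic_fun f"
  unfolding analytic_fun_def by blast

lemma analytic_funE:
  assumes "analytic_fun f"
  obtains r B E where "cext f s r B E"
  using assms unfolding analytic_fun_def by blast

lemma analytic_fun_const: "analytic_fun (\<lambda>u. a)"
  by (rule analytic_funI, rule cext_const)

lemma analytic_fun_var: "analytic_fun (\<lambda>u. u x)"
  by (rule analytic_funI, rule cext_var)

lemma analytic_fun_binary:
  assumes "analytic_fun f" "analytic_fun g"
  obtains r B E B' E' where "cext f s r B E" "cext g s r B' E'"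
proof -
  obtain r1 B E r2 B' E' where *: "cext f s r1 B E" "cext g s r2 B' E'"
    using assms unfolding analytic_fun_def by meson
  then have "r1 > 0" "r2 > 0"
    by (auto dest: cextD(1))
  then have "cext f s (min r1 r2) B E" "cext g s (min r1 r2) B' E'"
    using * by (auto intro: cext_mono)
  then show ?thesis
    using that by blast
qed

lemma analytic_fun_add:
  assumes "analytic_fun f" "analytic_fun g"
  shows "analytic_fun (\<lambda>u. f u + g u)"
  unfolding analytic_fun_def
proof
  fix s
  obtain r B E B' E' where "cext f s r B E" "cext g s r B' E'"
    by (rule analytic_fun_binary[OF assms])
  then show "\<exists>r B E. cext (\<lambda>u. f u + g u) s r B E"
    using cext_add by blast
qed

lemma analytic_fun_mult:
  assumes "analytic_fun f" "analytic_fun g"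
  shows "analytic_fun (\<lambda>u. f u * g u)"
  unfolding analytic_fun_def
proof
  fix s
  obtain r B E B' E' where "cext f s r B E" "cext g s r B' E'"
    by (rule analytic_fun_binary[OF assms])
  then show "\<exists>r B E. cext (\<lambda>u. f u * g u) s r B E"
    using cext_mult by blast
qed

lemma analytic_fun_sum:
  "finite I \<Longrightarrow> (\<And>i. i \<in> I \<Longrightarrow> analytic_fun (f i)) \<Longrightarrow> analytic_fun (\<lambda>u. \<Sum>i\<in>I. f i u)"
  by (induction I rule: finite_induct) (auto intro: analytic_fun_const analytic_fun_add)

section \<open>Cauchy estimates and Lipschitz bounds for complex extensions\<close>

lemma holomorphic_Cauchy_bound:
  assumes "g holomorphic_on ball a R" "\<And>w. w \<in> ball a R \<Longrightarrow> cmod (g w) \<le> B"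
    and "0 < \<rho>" "cmod (w - a) + \<rho> < R"
  shows "cmod ((deriv ^^ n) g w) \<le> fact n * B / \<rho> ^ n"
proof -
  have sub: "cball w \<rho> \<subseteq> ball a R"
  proof
    fix v assume "v \<in> cball w \<rho>"
    then have "dist a v \<le> cmod (w - a) + \<rho>"
      using dist_triangle[of a v w] by (simp add: dist_norm norm_minus_commute)
    then show "v \<in> ball a R"
      using assms(4) by simp
  qed
  show ?thesis
  proof (rule Cauchy_inequality)
    show "g holomorphic_on ball w \<rho>"
      using assms(1) sub ball_subset_cball by (blast intro: holomorphic_on_subset)
    show "continuous_on (cball w \<rho>) g"
      using assms(1) sub by (blast intro: holomorphic_on_imp_continuous_on holomorphic_on_subset)
    show "cmod (g v) \<le> B" if "cmod (w - v) = \<rho>" for v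
      using that sub by (intro assms(2)) (auto simp: dist_norm)
  qed fact
qed

text \<open>On the complex line through \<open>c\<close> and \<open>c'\<close> the extension is
  holomorphic and bounded by \<open>B\<close> on a disc that is large when \<open>c\<close> and
  \<open>c'\<close> are close. A Cauchy estimate on the unit disc then bounds the difference, so
  calculus in one variable is enough.\<close>

lemma cext_Lipschitz:
  assumes E: "cext f s r B E" and c: "cnear s (r/4) c" "cnear s (r/4) c'"
    and d: "\<And>x. cmod (c x - c' x) \<le> d" "d \<le> r / 2"
  shows "cmod (E c - E c') \<le> 6 * B / r * d"
proof (cases "d > 0")
  case False
  then have "c = c'"
    using d(1) by (metis eq_iff_diff_eq_0 ext linorder_not_less norm_le_zero_iff order_trans)
  moreover have "d \<ge> 0"
    using d(1) norm_ge_zero order_trans by blast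
  ultimately show ?thesis
    using cextD(1,5)[OF E] by simp
next
  case True
  have r: "r > 0" and B: "B \<ge> 0"
    using cextD[OF E] by auto
  \<comment> \<open>Chosen so that \<open>\<rho> * d = 3 * r / 4\<close>: starting within
    \<open>r/4\<close> of \<open>s\<close>, the line stays within \<open>r\<close>. The condition
    \<open>d \<le> r / 2\<close> gives \<open>\<rho> \<ge> 3/2\<close>, so discs of radius
    \<open>\<rho>/4\<close> about points of the unit disc stay inside; the resulting
    \<open>16/3\<close> is rounded up to \<open>6\<close>.\<close>
  define \<rho> where "\<rho> = 3 * r / (4 * d)"
  have \<rho>: "\<rho> \<ge> 3 / 2" "\<rho> * d = 3 * r / 4"
    using True d(2) by (auto simp: \<rho>_def field_simps)
  define L where "L = (\<lambda>z x. c x + z * (c' x - c x))"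
  have near: "cnear s r (L z)" if "z \<in> ball 0 \<rho>" for z
    unfolding cnear_def
  proof
    fix x
    have "cmod (L z x - of_real (s x)) \<le> cmod (c x - of_real (s x)) + cmod z * cmod (c' x - c x)"
      unfolding L_def using norm_triangle_ineq[of "c x - of_real (s x)" "z * (c' x - c x)"]
      by (simp add: norm_mult diff_add_eq)
    also have "cmod z * cmod (c' x - c x) \<le> \<rho> * d"
      using that d(1)[of x] \<rho> by (intro mult_mono) (auto simp: norm_minus_commute)
    finally show "cmod (L z x - of_real (s x)) < r"
      using c(1)[unfolded cnear_def, rule_format, of x] \<rho>(2) by linarith
  qed
  define h where "h = (\<lambda>z. E (L z))"
  have hol: "h holomorphic_on ball 0 \<rho>"
    unfolding h_def using near by (intro cextD(2)[OF E]) (auto simp: L_def intro!: holomorphic_intros)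
  have bound: "cmod (h z) \<le> B" if "z \<in> ball 0 \<rho>" for z
    unfolding h_def using near[OF that] cextD(3)[OF E] by blast
  have "cmod (h 0 - h 1) \<le> (4 * B / \<rho>) * cmod (0 - 1)"
  proof (rule field_differentiable_bound)
    fix z :: complex assume z: "z \<in> cball 0 1"
    have "z \<in> ball 0 \<rho>"
      using z \<rho> by simp
    then show "(h has_field_derivative deriv h z) (at z within cball 0 1)"
      using hol holomorphic_derivI by (blast intro: open_ball)
    have "cmod ((deriv ^^ 1) h z) \<le> fact 1 * B / (\<rho>/4) ^ 1"
      using hol bound by (rule holomorphic_Cauchy_bound) (use z \<rho> in auto)
    then show "cmod (deriv h z) \<le> 4 * B / \<rho>"
      by (simp add: mult.commute)
  qed auto
  then have "cmod (E c - E c') \<le> 4 * B / \<rho>"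
    by (simp add: h_def L_def)
  also have "\<dots> = 16 / 3 * (B / r * d)"
    using True r by (simp add: \<rho>_def field_simps)
  also have "\<dots> \<le> 6 * (B / r * d)"
    using True r B by (intro mult_right_mono) auto
  finally show ?thesis
    by simp
qed

section \<open>Real and complex partial derivatives\<close>

lemma has_real_derivative_complex_restrict:
  assumes g: "(g has_field_derivative D) (at (of_real a))"
    and r: "r > 0" "\<And>t. \<bar>t - a\<bar> < r \<Longrightarrow> g (of_real t) = of_real (f t)"
  shows "(f has_real_derivative Re D) (at a)" "D = of_real (Re D)"
proof -
  have v: "((\<lambda>t. g (of_real t)) has_vector_derivative D) (at a)"
    using has_vector_derivative_real_field[OF g] by simp
  have ev: "eventually (\<lambda>t. \<bar>t - a\<bar> < r) (nhds a)"
    unfolding eventually_nhds_metric using r(1) by (auto simp: dist_real_def)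
  have "((\<lambda>t. Re (g (of_real t))) has_vector_derivative Re D) (at a)"
    by (rule bounded_linear.has_vector_derivative[OF bounded_linear_Re v])
  then have "((\<lambda>t. Re (g (of_real t))) has_real_derivative Re D) (at a)"
    by (simp add: has_real_derivative_iff_has_vector_derivative)
  moreover have "eventually (\<lambda>t. Re (g (of_real t)) = f t) (nhds a)"
    using ev by eventually_elim (simp add: r(2))
  ultimately show "(f has_real_derivative Re D) (at a)"
    by (simp only: DERIV_cong_ev[OF refl _ refl, of "\<lambda>t. Re (g (of_real t))" f a])
  \<comment> \<open>\<open>g\<close> is real on the real axis near \<open>a\<close>, so its
    imaginary part has derivative 0 along the axis; hence \<open>D\<close> is real.\<close>
  have "((\<lambda>t. Im (g (of_real t))) has_vector_derivative Im D) (at a)"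
    by (rule bounded_linear.has_vector_derivative[OF bounded_linear_Im v])
  then have "((\<lambda>t. Im (g (of_real t))) has_real_derivative Im D) (at a)"
    by (simp add: has_real_derivative_iff_has_vector_derivative)
  moreover have "eventually (\<lambda>t. Im (g (of_real t)) = 0) (nhds a)"
    using ev by eventually_elim (simp add: r(2))
  ultimately have "((\<lambda>t. 0) has_real_derivative Im D) (at a)"
    by (simp only: DERIV_cong_ev[OF refl _ refl, of "\<lambda>t. Im (g (of_real t))" "\<lambda>t. 0" a])
  then have "Im D = 0"
    using DERIV_const DERIV_unique by blast
  then show "D = of_real (Re D)"
    by (simp add: complex_eq_iff)
qed

lemma cext_slice:
  assumes E: "cext f s r B E" and c: "cnear s r c"
  shows "(\<lambda>w. E (c(x := w))) holomorphic_on ball (of_real (s x)) r"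
    and "\<And>w. w \<in> ball (of_real (s x)) r \<Longrightarrow> cmod (E (c(x := w))) \<le> B"
proof -
  have near: "cnear s r (c(x := w))" if "w \<in> ball (of_real (s x)) r" for w
    using that c by (auto simp: cnear_def dist_norm norm_minus_commute)
  show "(\<lambda>w. E (c(x := w))) holomorphic_on ball (of_real (s x)) r"
  proof (rule cextD(2)[OF E])
    show "(\<lambda>w. (c(x := w)) y) holomorphic_on ball (of_real (s x)) r" for y
      by (cases "y = x") auto
  qed (use near in auto)
  show "cmod (E (c(x := w))) \<le> B" if "w \<in> ball (of_real (s x)) r" for w
    using near[OF that] cextD(3)[OF E] by blast
qed

lemma cext_slice_real_derivative:
  assumes E: "cext f s r B E" and u: "\<And>y. \<bar>u y - s y\<bar> < r"
  shows "((\<lambda>t. f (u(x := t))) has_real_derivative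
           Re (deriv (\<lambda>w. E ((\<lambda>y. of_real (u y))(x := w))) (of_real (u x)))) (at (u x))"
    and "deriv (\<lambda>w. E ((\<lambda>y. of_real (u y))(x := w))) (of_real (u x)) =
           of_real (deriv (\<lambda>t. f (u(x := t))) (u x))"
proof -
  let ?g = "\<lambda>w. E ((\<lambda>y. of_real (u y))(x := w))"
  have near: "cnear s r (\<lambda>y. of_real (u y))"
    using u by (simp add: cnear_of_real)
  have ux: "of_real (u x) \<in> ball (complex_of_real (s x)) r"
    using u[of x] by (simp add: dist_norm abs_minus_commute flip: of_real_diff)
  have "(?g has_field_derivative deriv ?g (of_real (u x))) (at (of_real (u x)))"
    using holomorphic_derivI[OF cext_slice(1)[OF E near] _ ux] by simp
  moreover have "?g (of_real t) = of_real (f (u(x := t)))" if "\<bar>t - u x\<bar> < r - \<bar>u x - s x\<bar>" for t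
  proof -
    have "cnear s r (\<lambda>y. of_real ((u(x := t)) y))"
      unfolding cnear_of_real using u that by auto
    moreover have "(\<lambda>y. of_real ((u(x := t)) y)) = (\<lambda>y. complex_of_real (u y))(x := of_real t)"
      by auto
    ultimately show ?thesis
      using cextD(4)[OF E] by metis
  qed
  ultimately have *: "((\<lambda>t. f (u(x := t))) has_real_derivative Re (deriv ?g (of_real (u x)))) (at (u x))"
      "deriv ?g (of_real (u x)) = of_real (Re (deriv ?g (of_real (u x))))"
    using has_real_derivative_complex_restrict[of ?g _ "u x" "r - \<bar>u x - s x\<bar>" "\<lambda>t. f (u(x := t))"] u[of x]
    by auto
  show "((\<lambda>t. f (u(x := t))) has_real_derivative Re (deriv ?g (of_real (u x)))) (at (u x))"
    by (fact *(1))
  show "deriv ?g (of_real (u x)) = of_real (deriv (\<lambda>t. f (u(x := t))) (u x))"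
    using *(2) DERIV_imp_deriv[OF *(1)] by simp
qed

lemma analytic_fun_slice_derivative:
  assumes "analytic_fun f"
  shows "((\<lambda>t. f (u(x := t))) has_real_derivative deriv (\<lambda>t. f (u(x := t))) (u x)) (at (u x))"
proof -
  obtain r B E where E: "cext f u r B E"
    using assms unfolding analytic_fun_def by blast
  have "(\<lambda>t. f (u(x := t))) field_differentiable at (u x)"
    using cext_slice_real_derivative(1)[OF E, of u] cextD(1)[OF E]
    unfolding field_differentiable_def by auto
  then show ?thesis
    by (simp add: DERIV_deriv_iff_field_differentiable)
qed

text \<open>
  Along a curve the partial derivative is the uniform limit of difference quotients, which are
  holomorphic because they only involve values of \<open>E\<close> along curves.
\<close>

lemma cext_partial_derivative:
  assumes E: "cext f s r B E"
  shows "cext (\<lambda>u. deriv (\<lambda>t. f (u(x := t))) (u x)) s (r/4) (4 * B / r)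
           (\<lambda>c. deriv (\<lambda>w. E (c(x := w))) (c x))"
proof (rule cextI)
  have r: "r > 0" and B: "B \<ge> 0"
    using cextD[OF E] by auto
  then show "r / 4 > 0"
    by simp
  note near_mono = cnear_mono[of s "r/4" _ r]
  {
    fix c assume c: "cnear s (r/4) c"
    have "cmod ((deriv ^^ 1) (\<lambda>w. E (c(x := w))) (c x)) \<le> fact 1 * B / (r/4) ^ 1"
      by (rule holomorphic_Cauchy_bound[OF cext_slice[OF E near_mono[OF c]]])
        (use c r in \<open>auto simp: cnear_def dest!: spec[of _ x]\<close>)
    then show "cmod (deriv (\<lambda>w. E (c(x := w))) (c x)) \<le> 4 * B / r"
      by (simp add: mult.commute)
  }
  {
    fix u assume "cnear s (r/4) (\<lambda>x. of_real (u x))"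
    then have "\<bar>u y - s y\<bar> < r" for y
      using r by (auto simp: cnear_of_real dest!: spec[of _ y])
    then show "deriv (\<lambda>w. E ((\<lambda>x. of_real (u x))(x := w))) (of_real (u x)) =
        of_real (deriv (\<lambda>t. f (u(x := t))) (u x))"
      by (rule cext_slice_real_derivative(2)[OF E])
  }
  fix U and c :: "complex \<Rightarrow> 'a \<Rightarrow> complex"
  assume U: "open U" and c: "\<And>z. z \<in> U \<Longrightarrow> cnear s (r/4) (c z)" "\<And>y. (\<lambda>z. c z y) holomorphic_on U"
  \<comment> \<open>Increments of at most \<open>r/4\<close> keep a shifted curve, which starts
    within \<open>r/4\<close> of \<open>s\<close>, inside the domain of \<open>E\<close>; hence the
    quotients \<open>q n\<close> are holomorphic along \<open>c\<close>.\<close>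
  define \<eta> where "\<eta> = (\<lambda>n. (r/4) / of_nat (Suc n) :: real)"
  have \<eta>: "0 < \<eta> n" "\<eta> n \<le> r/4" for n
    using r by (auto simp: \<eta>_def field_simps)
  define q where "q = (\<lambda>n z. (E ((c z)(x := c z x + of_real (\<eta> n))) - E (c z)) / of_real (\<eta> n))"
  define D where "D = (\<lambda>z. deriv (\<lambda>w. E ((c z)(x := w))) (c z x))"
  \<comment> \<open>First-order Taylor remainder. On the ball of radius \<open>r/2\<close> the
    second derivative is at most \<open>2 * B / (r/4)^2\<close>, that is
    \<open>32 * B / r^2\<close>; dividing by the increment leaves one factor
    \<open>\<eta> n\<close>. The bound is the same for all \<open>z\<close>, whence uniform
    convergence.\<close>
  have estimate: "cmod (q n z - D z) \<le> 32 * B / r^2 * \<eta> n" if "z \<in> U" for n z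
  proof -
    define g where "g = (\<lambda>w. E ((c z)(x := w)))"
    have g: "g holomorphic_on ball (of_real (s x)) r" "\<And>w. w \<in> ball (of_real (s x)) r \<Longrightarrow> cmod (g w) \<le> B"
      unfolding g_def using cext_slice[OF E near_mono[OF c(1)[OF that]]] r by auto
    have cz: "cmod (c z x - of_real (s x)) < r/4"
      using c(1)[OF that] by (auto simp: cnear_def)
    have "cmod ((deriv ^^ 0) g (c z x + of_real (\<eta> n)) -
        (\<Sum>i\<le>1. (deriv ^^ i) g (c z x) * ((c z x + of_real (\<eta> n)) - c z x) ^ i / fact i))
        \<le> (32 * B / r^2) * cmod ((c z x + of_real (\<eta> n)) - c z x) ^ Suc 1 / fact 1"
    proof (rule complex_Taylor)
      show "convex (ball (complex_of_real (s x)) (r/2))"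
        by simp
      show "c z x \<in> ball (of_real (s x)) (r/2)"
        using cz r by (simp add: dist_norm norm_minus_commute)
      have "cmod (c z x - of_real (s x)) + cmod (of_real (\<eta> n)) < r/2"
        using cz \<eta>[of n] by simp
      then show "c z x + of_real (\<eta> n) \<in> ball (of_real (s x)) (r/2)"
        using norm_triangle_ineq[of "c z x - of_real (s x)" "of_real (\<eta> n)"]
        by (simp add: dist_norm norm_minus_commute algebra_simps)
      fix w :: complex assume w: "w \<in> ball (of_real (s x)) (r/2)"
      then have w': "w \<in> ball (of_real (s x)) r"
        using r by simp
      have "cmod ((deriv ^^ 2) g w) \<le> fact 2 * B / (r/4)^2"
        by (rule holomorphic_Cauchy_bound[OF g]) (use w r in \<open>auto simp: dist_norm norm_minus_commute\<close>)
      then show "cmod ((deriv ^^ Suc 1) g w) \<le> 32 * B / r\<^sup>2"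
        by (simp add: power2_eq_square numeral_2_eq_2)
      fix i :: nat
      have "(deriv ^^ i) g holomorphic_on ball (of_real (s x)) r"
        using g(1) by (intro holomorphic_higher_deriv) auto
      then have "((deriv ^^ i) g has_field_derivative deriv ((deriv ^^ i) g) w) (at w)"
        using holomorphic_derivI w' open_ball by blast
      then show "((deriv ^^ i) g has_field_derivative (deriv ^^ Suc i) g w)
          (at w within ball (of_real (s x)) (r/2))"
        using has_field_derivative_at_within by simp
    qed
    then have est: "cmod (g (c z x + of_real (\<eta> n)) - g (c z x) - deriv g (c z x) * of_real (\<eta> n))
        \<le> (32 * B / r^2) * (\<eta> n)^2"
      using \<eta>[of n] by (simp add: algebra_simps power2_eq_square)
    have "q n z - D z =
        (g (c z x + of_real (\<eta> n)) - g (c z x) - deriv g (c z x) * of_real (\<eta> n)) / of_real (\<eta> n)"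
      using \<eta>(1)[of n] by (simp add: q_def D_def g_def field_simps)
    then have "cmod (q n z - D z) =
        cmod (g (c z x + of_real (\<eta> n)) - g (c z x) - deriv g (c z x) * of_real (\<eta> n)) / \<eta> n"
      using \<eta>(1)[of n] by (simp add: norm_divide)
    also have "\<dots> \<le> (32 * B / r^2) * (\<eta> n)^2 / \<eta> n"
      using est \<eta>(1)[of n] by (intro divide_right_mono) auto
    finally show ?thesis
      using \<eta>(1)[of n] by (simp add: power2_eq_square)
  qed
  have "\<eta> \<longlonglongrightarrow> 0"
    unfolding \<eta>_def by (intro real_tendsto_divide_at_top[OF tendsto_const]
        filterlim_compose[OF filterlim_real_sequentially filterlim_Suc])
  then have "(\<lambda>n. 32 * B / r^2 * \<eta> n) \<longlonglongrightarrow> 0"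
    by (rule tendsto_mult_right_zero)
  note \<eta>_lim = this
  have lim: "uniform_limit U q D sequentially"
  proof (rule uniform_limitI)
    fix e :: real assume "e > 0"
    with \<eta>_lim have "eventually (\<lambda>n. 32 * B / r^2 * \<eta> n < e) sequentially"
      by (rule order_tendstoD(2))
    then show "\<forall>\<^sub>F n in sequentially. \<forall>z\<in>U. dist (q n z) (D z) < e"
      unfolding dist_norm by eventually_elim (use estimate le_less_trans in blast)
  qed
  show "(\<lambda>z. deriv (\<lambda>w. E ((c z)(x := w))) (c z x)) holomorphic_on U"
    unfolding D_def[symmetric]
  proof (rule holomorphic_uniform_sequence[OF U])
    fix n
    have "(\<lambda>z. E ((c z)(x := c z x + of_real (\<eta> n)))) holomorphic_on U"
    proof (rule cextD(2)[OF E U])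
      show "cnear s r ((c z)(x := c z x + of_real (\<eta> n)))" if "z \<in> U" for z
        unfolding cnear_def
      proof
        fix y
        have "cmod (c z y - of_real (s y)) < r/4"
          using c(1)[OF that] by (auto simp: cnear_def)
        moreover have "cmod (c z y + of_real (\<eta> n) - of_real (s y)) \<le> cmod (c z y - of_real (s y)) + \<eta> n"
          using norm_triangle_ineq[of "c z y - of_real (s y)" "of_real (\<eta> n)"] \<eta>(1)[of n]
          by (simp add: algebra_simps)
        ultimately show "cmod (((c z)(x := c z x + of_real (\<eta> n))) y - of_real (s y)) < r"
          using \<eta>[of n] by auto
      qed
      show "(\<lambda>z. ((c z)(x := c z x + of_real (\<eta> n))) y) holomorphic_on U" for y
        using c(2) by (cases "y = x") (auto intro!: holomorphic_intros)
    qed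
    moreover have "(\<lambda>z. E (c z)) holomorphic_on U"
      using near_mono[OF c(1)] c(2) r by (intro cextD(2)[OF E U]) auto
    ultimately show "q n holomorphic_on U"
      unfolding q_def using \<eta>(1)[of n] by (intro holomorphic_intros) auto
    fix z assume "z \<in> U"
    then obtain d where "d > 0" "cball z d \<subseteq> U"
      using U open_contains_cball by blast
    then show "\<exists>d>0. cball z d \<subseteq> U \<and> uniform_limit (cball z d) q D sequentially"
      using uniform_limit_on_subset[OF lim] by blast
  qed
qed

lemma analytic_fun_partial_derivative:
  assumes "analytic_fun f"
  shows "analytic_fun (\<lambda>u. deriv (\<lambda>t. f (u(x := t))) (u x))"
proof -
  obtain r B E where "\<And>s. cext f s (r s) (B s) (E s)"
    using assms unfolding analytic_fun_def by metis
  then have "cext (\<lambda>u. deriv (\<lambda>t. f (u(x := t))) (u x)) s (r s / 4) (4 * B s / r s)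
      (\<lambda>c. deriv (\<lambda>w. E s (c(x := w))) (c x))" for s
    by (rule cext_partial_derivative)
  then show ?thesis
    by (rule analytic_funI)
qed

section \<open>Continuity of analytic functions and composition with power series\<close>

lemma cext_continuous:
  assumes E: "cext f s r B E" and "\<epsilon> > 0"
  shows "\<exists>\<delta>>0. \<delta> \<le> r \<and> (\<forall>c. cnear s \<delta> c \<longrightarrow> cmod (E c - of_real (f s)) < \<epsilon>)"
proof -
  have r: "r > 0" and B: "B \<ge> 0"
    using cextD[OF E] by auto
  \<comment> \<open>The second entry makes the Lipschitz bound \<open>6 * B / r * \<delta>\<close>
    smaller than \<open>\<epsilon>\<close>; the \<open>+ 1\<close> covers
    \<open>B = 0\<close>.\<close>
  define \<delta> where "\<delta> = min (r/4) (\<epsilon> * r / (6 * B + 1) / 2)"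
  have \<delta>4: "\<delta> \<le> r/4"
    unfolding \<delta>_def by (rule min.cobounded1)
  have \<delta>: "\<delta> > 0" "\<delta> \<le> r"
    using r B assms(2) \<delta>4 unfolding \<delta>_def by auto
  have "cmod (E c - of_real (f s)) < \<epsilon>" if c: "cnear s \<delta> c" for c
  proof -
    have n: "cnear s (r/4) c" "cnear s (r/4) (\<lambda>x. of_real (s x))"
      using cnear_mono[OF c \<delta>4] r cnear_self[of "r/4" s] by auto
    have "cmod (E c - E (\<lambda>x. of_real (s x))) \<le> 6 * B / r * \<delta>"
    proof (rule cext_Lipschitz[OF E n])
      show "cmod (c x - complex_of_real (s x)) \<le> \<delta>" for x
        using c by (auto simp: cnear_def intro: less_imp_le)
      show "\<delta> \<le> r / 2"
        using r \<delta>4 by auto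
    qed
    moreover have "E (\<lambda>x. of_real (s x)) = of_real (f s)"
      using r by (intro cextD(4)[OF E] cnear_self)
    ultimately have "cmod (E c - of_real (f s)) \<le> 6 * B / r * \<delta>"
      by simp
    also have "\<dots> \<le> 6 * B / r * (\<epsilon> * r / (6 * B + 1) / 2)"
      using B r by (intro mult_left_mono) (auto simp: \<delta>_def)
    also have "\<dots> < \<epsilon>"
      using B r assms(2) by (simp add: field_simps add_pos_nonneg)
    finally show ?thesis .
  qed
  with \<delta> show ?thesis
    by blast
qed

text \<open>For arbitrary filters, since an unordered sum is a limit along the finite subsets of its
  index set.\<close>

lemma holomorphic_on_uniform_limit:
  assumes "open U" "\<And>n. f n holomorphic_on U" "uniform_limit U f g F" "F \<noteq> bot"
  shows "g holomorphic_on U"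
proof -
  have "g field_differentiable at z" if "z \<in> U" for z
  proof -
    obtain d where d: "d > 0" "cball z d \<subseteq> U"
      using assms(1) \<open>z \<in> U\<close> open_contains_cball by blast
    have "ball z d \<subseteq> U"
      using d(2) ball_subset_cball by blast
    then have hol: "eventually (\<lambda>n. continuous_on (cball z d) (f n) \<and> f n holomorphic_on ball z d) F"
      using assms(2) d(2) holomorphic_on_subset holomorphic_on_imp_continuous_on by (intro always_eventually) blast
    have "g holomorphic_on ball z d"
      by (rule holomorphic_uniform_limit[OF hol uniform_limit_on_subset[OF assms(3) d(2)]]) (use assms(4) in auto)
    then show ?thesis
      using d(1) holomorphic_on_imp_differentiable_at by auto
  qed
  then show ?thesis
    using assms(1) field_differentiable_at_within unfolding holomorphic_on_def by blast
qed

text \<open>Unconditional convergence of a real series is absolute convergence. At the single point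
  with coordinates \<open>p i + \<rho>\<close> it therefore yields a summable majorant for the
  series on the complex polydisc of radius \<open>\<rho>\<close>, and the inner extensions are
  shrunk until they map into that polydisc. The Weierstrass test then makes the composed series a
  uniform limit of holomorphic functions along every curve.\<close>

lemma analytic_fun_compose_args:
  assumes F: "real_analytic_args (length fs) F" and fs: "\<And>f. f \<in> set fs \<Longrightarrow> analytic_fun f"
  shows "analytic_fun (\<lambda>u. F (map (\<lambda>f. f u) fs))"
  unfolding analytic_fun_def
proof
  fix s :: "'a \<Rightarrow> real"
  define k where "k = length fs"
  define A where "A = {a :: nat list. length a = k}"
  define p where "p = (\<lambda>i. (fs ! i) s)"
  obtain c r where r: "r > 0" and sum: "\<And>q. length q = k \<Longrightarrow> (\<And>i. i < k \<Longrightarrow> \<bar>q ! i - p i\<bar> < r) \<Longrightarrow>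
      ((\<lambda>a. c a * (\<Prod>i<k. (q ! i - p i) ^ (a ! i))) has_sum F q) A"
  proof -
    have "length (map (\<lambda>f. f s) fs) = length fs"
      by simp
    then obtain c r where "r > 0" and *: "\<And>q. length q = length fs \<and> (\<forall>i<length fs. \<bar>q ! i - map (\<lambda>f. f s) fs ! i\<bar> < r) \<Longrightarrow>
           ((\<lambda>a. c a * (\<Prod>i<length fs. (q ! i - map (\<lambda>f. f s) fs ! i) ^ (a ! i))) has_sum F q)
             {a :: nat list. length a = length fs}"
      using F unfolding real_analytic_args_def by meson
    have "((\<lambda>a. c a * (\<Prod>i<k. (q ! i - p i) ^ (a ! i))) has_sum F q) A"
      if "length q = k" "\<And>i. i < k \<Longrightarrow> \<bar>q ! i - p i\<bar> < r" for q
      using *[of q] that by (simp add: k_def p_def A_def)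
    then show ?thesis
      using that \<open>r > 0\<close> by blast
  qed
  \<comment> \<open>Half of \<open>r\<close>, so that the point with coordinates
    \<open>p i + \<rho>\<close> still lies in the region where the series is known to
    converge.\<close>
  define \<rho> where "\<rho> = r / 2"
  have \<rho>: "\<rho> > 0" "\<rho> < r"
    using r by (auto simp: \<rho>_def)
  define M where "M = (\<lambda>a. \<bar>c a\<bar> * (\<Prod>i<k. \<rho> ^ (a ! i)))"
  have M: "M summable_on A"
  proof -
    have "((\<lambda>a. c a * (\<Prod>i<k. (map (\<lambda>i. p i + \<rho>) [0..<k] ! i - p i) ^ (a ! i))) has_sum
        F (map (\<lambda>i. p i + \<rho>) [0..<k])) A"
      by (rule sum) (use \<rho> in auto)
    then have "(\<lambda>a. c a * (\<Prod>i<k. \<rho> ^ (a ! i))) summable_on A"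
      by (auto simp: summable_on_def)
    then have "(\<lambda>a. norm (c a * (\<Prod>i<k. \<rho> ^ (a ! i)))) summable_on A"
      by (rule summable_on_iff_abs_summable_on_real[THEN iffD1])
    then show ?thesis
      using \<rho> by (simp add: M_def abs_mult abs_prod)
  qed
  have "\<forall>i\<in>{..<k}. \<exists>\<delta> B E. cext (fs ! i) s \<delta> B E \<and> (\<forall>c. cnear s \<delta> c \<longrightarrow> cmod (E c - of_real (p i)) < \<rho>)"
  proof
    fix i assume "i \<in> {..<k}"
    then have "analytic_fun (fs ! i)"
      using fs by (simp add: k_def)
    then obtain r B E where E: "cext (fs ! i) s r B E"
      by (rule analytic_funE)
    obtain \<delta> where "\<delta> > 0" "\<delta> \<le> r" "\<forall>c. cnear s \<delta> c \<longrightarrow> cmod (E c - of_real (p i)) < \<rho>"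
      using cext_continuous[OF E \<rho>(1)] unfolding p_def by blast
    then show "\<exists>\<delta> B E. cext (fs ! i) s \<delta> B E \<and> (\<forall>c. cnear s \<delta> c \<longrightarrow> cmod (E c - of_real (p i)) < \<rho>)"
      using cext_mono[OF E] by blast
  qed
  then obtain \<delta>' B E where E': "\<And>i. i < k \<Longrightarrow> cext (fs ! i) s (\<delta>' i) (B i) (E i)"
      "\<And>i c. i < k \<Longrightarrow> cnear s (\<delta>' i) c \<Longrightarrow> cmod (E i c - of_real (p i)) < \<rho>"
    unfolding bchoice_iff lessThan_iff Ball_def by metis
  \<comment> \<open>The inserted \<open>1\<close> keeps the minimum meaningful for
    \<open>k = 0\<close>.\<close>
  define \<delta> where "\<delta> = Min (insert 1 (\<delta>' ` {..<k}))"
  have \<delta>: "\<delta> > 0" "\<And>i. i < k \<Longrightarrow> \<delta> \<le> \<delta>' i"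
    using cextD(1)[OF E'(1)] by (auto simp: \<delta>_def)
  have E: "\<And>i. i < k \<Longrightarrow> cext (fs ! i) s \<delta> (B i) (E i)"
    and Ep: "\<And>i c. i < k \<Longrightarrow> cnear s \<delta> c \<Longrightarrow> cmod (E i c - of_real (p i)) < \<rho>"
    using E' \<delta> cext_mono cnear_mono by blast+
  define G where "G = (\<lambda>v a. of_real (c a) * (\<Prod>i<k. (E i v - of_real (p i)) ^ (a ! i)))"
  have GM: "cmod (G v a) \<le> M a" if "cnear s \<delta> v" for v a
    unfolding G_def M_def norm_mult norm_of_real
    by (intro mult_left_mono order_trans[OF norm_prod_le] prod_mono conjI)
      (auto simp: norm_power intro!: power_mono less_imp_le[OF Ep] that)
  have Gsum: "(G v has_sum infsum (G v) A) A" if "cnear s \<delta> v" for v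
  proof (rule has_sum_infsum, rule abs_summable_summable)
    have "(\<lambda>a. norm (M a)) summable_on A"
      using M by (rule summable_on_iff_abs_summable_on_real[THEN iffD1])
    then show "(\<lambda>a. norm (G v a)) summable_on A"
    proof (rule Infinite_Sum.abs_summable_on_comparison_test)
      show "cmod (G v a) \<le> norm (M a)" for a
        using GM[OF that, of a] by simp
    qed
  qed
  have "cext (\<lambda>u. F (map (\<lambda>f. f u) fs)) s \<delta> (infsum M A) (\<lambda>v. infsum (G v) A)"
  proof (rule cextI)
    show "cmod (infsum (G v) A) \<le> infsum M A" if "cnear s \<delta> v" for v
      by (rule norm_infsum_le[OF Gsum[OF that] has_sum_infsum[OF M]]) (rule GM[OF that])
    show "infsum (G (\<lambda>x. of_real (u x))) A = of_real (F (map (\<lambda>f. f u) fs))"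
      if u: "cnear s \<delta> (\<lambda>x. complex_of_real (u x))" for u
    proof -
      have Eu: "E i (\<lambda>x. of_real (u x)) = of_real ((fs ! i) u)" if "i < k" for i
        by (rule cextD(4)[OF E[OF that] u])
      have "((\<lambda>a. c a * (\<Prod>i<k. (map (\<lambda>f. f u) fs ! i - p i) ^ (a ! i))) has_sum F (map (\<lambda>f. f u) fs)) A"
      proof (rule sum)
        fix i assume i: "i < k"
        have "cmod (of_real ((fs ! i) u) - of_real (p i)) < \<rho>"
          using Ep[OF i u] Eu[OF i] by simp
        then have "\<bar>(fs ! i) u - p i\<bar> < \<rho>"
          by (metis norm_of_real of_real_diff)
        then show "\<bar>map (\<lambda>f. f u) fs ! i - p i\<bar> < r"
          using \<rho> i by (simp add: k_def)
      qed (simp add: k_def)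
      then have "((\<lambda>a. complex_of_real (c a * (\<Prod>i<k. (map (\<lambda>f. f u) fs ! i - p i) ^ (a ! i))))
          has_sum of_real (F (map (\<lambda>f. f u) fs))) A"
        by (rule has_sum_of_real)
      moreover have "(\<lambda>a. complex_of_real (c a * (\<Prod>i<k. (map (\<lambda>f. f u) fs ! i - p i) ^ (a ! i)))) =
          G (\<lambda>x. of_real (u x))"
        using Eu by (auto simp: G_def k_def)
      ultimately show ?thesis
        by (simp add: infsumI)
    qed
    show "(\<lambda>z. infsum (G (v z)) A) holomorphic_on U"
      if U: "open U" and v: "\<And>z. z \<in> U \<Longrightarrow> cnear s \<delta> (v z)" "\<And>x. (\<lambda>z. v z x) holomorphic_on U" for U v
    proof (rule holomorphic_on_uniform_limit[OF U])
      show "uniform_limit U (\<lambda>X z. \<Sum>a\<in>X. G (v z) a) (\<lambda>z. infsum (G (v z)) A) (finite_subsets_at_top A)"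
        by (rule Weierstrass_m_test_general[OF _ M]) (rule GM[OF v(1)])
      show "(\<lambda>z. \<Sum>a\<in>X. G (v z) a) holomorphic_on U" for X
        unfolding G_def using v by (intro holomorphic_intros cextD(2)[OF E U]) auto
    qed simp
  qed (use \<delta> in auto)
  then show "\<exists>r B E. cext (\<lambda>u. F (map (\<lambda>f. f u) fs)) s r B E"
    by blast
qed

lemma analytic_fun_eval:
  assumes "analytic_interp fi"
  shows "analytic_fun (eval fi e)"
proof (induction e)
  case (Fun f es)
  have "real_analytic_args (length (map (eval fi) es)) (fi f)"
    using assms by (simp add: analytic_interp_def)
  then show ?case
    unfolding eval.simps using Fun by (intro analytic_fun_compose_args) auto
next
  case (Differential e)
  then show ?case
    unfolding eval.simps
    by (intro analytic_fun_sum analytic_fun_mult analytic_fun_var analytic_fun_partial_derivative) auto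
qed (auto intro: analytic_fun_var analytic_fun_const analytic_fun_mult analytic_fun_add)

section \<open>The chain rule along a real curve\<close>

lemma real_mvt:
  fixes h :: "real \<Rightarrow> real"
  assumes "\<And>r. (h has_real_derivative h' r) (at r)"
  shows "\<exists>\<xi>. \<bar>\<xi> - a\<bar> \<le> \<bar>b - a\<bar> \<and> h b - h a = (b - a) * h' \<xi>"
proof (cases a b rule: linorder_cases)
  case less
  then show ?thesis
    using MVT2[OF less, of h h'] assms by force
next
  case greater
  then obtain \<xi> where "b < \<xi>" "\<xi> < a" "h a - h b = (a - b) * h' \<xi>"
    using MVT2[OF greater, of h h'] assms by blast
  then show ?thesis
    by (intro exI[of _ \<xi>]) (auto simp: algebra_simps)
qed auto

lemma analytic_fun_continuous:
  assumes "analytic_fun f" "\<epsilon> > 0"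
  shows "\<exists>\<delta>>0. \<forall>u. (\<forall>x. \<bar>u x - s x\<bar> < \<delta>) \<longrightarrow> \<bar>f u - f s\<bar> < \<epsilon>"
proof -
  obtain r B E where E: "cext f s r B E"
    using assms(1) by (rule analytic_funE)
  obtain \<delta> where \<delta>: "\<delta> > 0" "\<delta> \<le> r" "\<And>c. cnear s \<delta> c \<Longrightarrow> cmod (E c - of_real (f s)) < \<epsilon>"
    using cext_continuous[OF E assms(2)] by blast
  have "\<bar>f u - f s\<bar> < \<epsilon>" if "\<forall>x. \<bar>u x - s x\<bar> < \<delta>" for u
  proof -
    have n: "cnear s \<delta> (\<lambda>x. of_real (u x))"
      using that by (simp add: cnear_of_real)
    then have "E (\<lambda>x. of_real (u x)) = of_real (f u)"
      using \<delta>(2) by (intro cextD(4)[OF E]) (rule cnear_mono)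
    then show ?thesis
      using \<delta>(3)[OF n] by (metis norm_of_real of_real_diff)
  qed
  with \<delta>(1) show ?thesis
    by blast
qed

text \<open>The coordinates in \<open>X\<close> are set in motion one at a time. By the mean value
  theorem each increment is the increment of the moving coordinate times a partial derivative at an
  intermediate point; that partial derivative is again an analytic function, hence continuous, so it
  converges as \<open>t\<close> tends to \<open>t0\<close>. Differentiability of the curve at
  \<open>t0\<close> alone is enough.\<close>

lemma analytic_fun_chain_rule:
  assumes f: "analytic_fun f" and X: "finite X" "\<And>u v. (\<And>x. x \<in> X \<Longrightarrow> u x = v x) \<Longrightarrow> f u = f v"
    and \<phi>: "\<And>x. x \<in> X \<Longrightarrow> ((\<lambda>t. \<phi> t x) has_real_derivative d x) (at t0)"
  shows "((\<lambda>t. f (\<phi> t)) has_real_derivative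
           (\<Sum>x\<in>X. d x * deriv (\<lambda>r. f ((\<phi> t0)(x := r))) (\<phi> t0 x))) (at t0)"
proof -
  define \<psi> where "\<psi> = (\<lambda>Y t x. if x \<in> Y then \<phi> t x else \<phi> t0 x)"
  have \<psi>0: "\<psi> Y t0 = \<phi> t0" for Y
    by (auto simp: \<psi>_def)
  have "((\<lambda>t. f (\<psi> Y t)) has_real_derivative
           (\<Sum>x\<in>Y. d x * deriv (\<lambda>r. f ((\<phi> t0)(x := r))) (\<phi> t0 x))) (at t0)" if "Y \<subseteq> X" for Y
    using finite_subset[OF that X(1)] that
  proof (induction Y rule: finite_induct)
    case empty
    then show ?case
      by (simp add: \<psi>_def)
  next
    case (insert y Y)
    define q where "q = (\<lambda>u. deriv (\<lambda>r. f (u(y := r))) (u y))"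
    have "analytic_fun q"
      unfolding q_def using f by (rule analytic_fun_partial_derivative)
    have "\<exists>\<xi>. \<bar>\<xi> - \<phi> t0 y\<bar> \<le> \<bar>\<phi> t y - \<phi> t0 y\<bar> \<and>
        f ((\<psi> Y t)(y := \<phi> t y)) - f ((\<psi> Y t)(y := \<phi> t0 y)) = (\<phi> t y - \<phi> t0 y) * q ((\<psi> Y t)(y := \<xi>))" for t
    proof (rule real_mvt)
      show "((\<lambda>r. f ((\<psi> Y t)(y := r))) has_real_derivative q ((\<psi> Y t)(y := r))) (at r)" for r
        using analytic_fun_slice_derivative[OF f, of "(\<psi> Y t)(y := r)" y] by (simp add: q_def)
    qed
    then obtain \<xi> where \<xi>: "\<And>t. \<bar>\<xi> t - \<phi> t0 y\<bar> \<le> \<bar>\<phi> t y - \<phi> t0 y\<bar>"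
        "\<And>t. f ((\<psi> Y t)(y := \<phi> t y)) - f ((\<psi> Y t)(y := \<phi> t0 y)) = (\<phi> t y - \<phi> t0 y) * q ((\<psi> Y t)(y := \<xi> t))"
      by metis
    define v where "v = (\<lambda>t. (\<psi> Y t)(y := \<xi> t))"
    have ins: "(\<psi> Y t)(y := \<phi> t y) = \<psi> (insert y Y) t" "(\<psi> Y t)(y := \<phi> t0 y) = \<psi> Y t" for t
      using insert.hyps by (auto simp: \<psi>_def)
    have cont: "((\<lambda>t. \<phi> t x) \<longlongrightarrow> \<phi> t0 x) (at t0)" if "x \<in> insert y Y" for x
      using \<phi>[of x] insert.prems that DERIV_isCont isCont_def by blast
    have "((\<lambda>t. q (v t)) \<longlongrightarrow> q (\<phi> t0)) (at t0)"
    proof (rule tendstoI)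
      fix e :: real assume "e > 0"
      then obtain \<delta> where \<delta>: "\<delta> > 0" "\<And>u. (\<forall>x. \<bar>u x - \<phi> t0 x\<bar> < \<delta>) \<Longrightarrow> \<bar>q u - q (\<phi> t0)\<bar> < e"
        using analytic_fun_continuous[OF \<open>analytic_fun q\<close>, of e "\<phi> t0"] by blast
      have "eventually (\<lambda>t. \<forall>x\<in>insert y Y. \<bar>\<phi> t x - \<phi> t0 x\<bar> < \<delta>) (at t0)"
        using insert.hyps(1) tendstoD[OF cont \<delta>(1)] by (intro eventually_ball_finite) (auto simp: dist_real_def)
      then show "eventually (\<lambda>t. dist (q (v t)) (q (\<phi> t0)) < e) (at t0)"
      proof eventually_elim
        case (elim t)
        have "\<bar>v t x - \<phi> t0 x\<bar> < \<delta>" for x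
          using elim \<xi>(1)[of t] \<delta>(1) by (auto simp: v_def \<psi>_def)
        then show ?case
          using \<delta>(2) by (simp add: dist_real_def)
      qed
    qed
    moreover have "((\<lambda>t. (\<phi> t y - \<phi> t0 y) / (t - t0)) \<longlongrightarrow> d y) (at t0)"
      using \<phi>[of y] insert.prems by (simp add: has_field_derivative_iff)
    ultimately have "((\<lambda>t. (\<phi> t y - \<phi> t0 y) / (t - t0) * q (v t)) \<longlongrightarrow> d y * q (\<phi> t0)) (at t0)"
      by (intro tendsto_mult)
    then have B: "((\<lambda>t. f (\<psi> (insert y Y) t) - f (\<psi> Y t)) has_real_derivative d y * q (\<phi> t0)) (at t0)"
      using \<xi>(2) by (simp add: has_field_derivative_iff \<psi>0 ins v_def)
    have "Y \<subseteq> X"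
      using insert.prems by simp
    from DERIV_add[OF B insert.IH[OF this]] show ?case
      by (simp only: sum.insert[OF insert.hyps] q_def diff_add_cancel)
  qed
  from this[of X] have "((\<lambda>t. f (\<psi> X t)) has_real_derivative
           (\<Sum>x\<in>X. d x * deriv (\<lambda>r. f ((\<phi> t0)(x := r))) (\<phi> t0 x))) (at t0)"
    by simp
  moreover have "f (\<psi> X t) = f (\<phi> t)" for t
    by (rule X(2)) (auto simp: \<psi>_def)
  ultimately show ?thesis
    by simp
qed

subsection \<open>Real analytic curves\<close>

definition real_ext :: "(real \<Rightarrow> real) \<Rightarrow> real \<Rightarrow> real \<Rightarrow> (complex \<Rightarrow> complex) \<Rightarrow> bool" where
  "real_ext g t0 \<delta> G \<longleftrightarrow> \<delta> > 0 \<and> G holomorphic_on ball (of_real t0) \<delta> \<and>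
     (\<forall>t. \<bar>t - t0\<bar> < \<delta> \<longrightarrow> G (of_real t) = of_real (g t))"

lemma of_real_in_ball: "complex_of_real t \<in> ball (of_real t0) \<delta> \<longleftrightarrow> \<bar>t - t0\<bar> < \<delta>"
  by (simp add: dist_norm abs_minus_commute flip: of_real_diff)

lemma real_ext_mono: "real_ext g t0 \<delta> G \<Longrightarrow> 0 < \<delta>' \<Longrightarrow> \<delta>' \<le> \<delta> \<Longrightarrow> real_ext g t0 \<delta>' G"
  unfolding real_ext_def by (auto intro: holomorphic_on_subset)

lemma has_fps_expansion_imp_real_ext:
  fixes g :: "real \<Rightarrow> real"
  assumes "(\<lambda>h. g (t0 + h)) has_fps_expansion A"
  shows "\<exists>\<delta> G. real_ext g t0 \<delta> G"
proof -
  define A' where "A' = Abs_fps (\<lambda>n. complex_of_real (fps_nth A n))"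
  have rad: "fps_conv_radius A' = fps_conv_radius A"
    by (simp add: fps_conv_radius_def conv_radius_def A'_def)
  have pos: "fps_conv_radius A > 0" and "eventually (\<lambda>h. eval_fps A h = g (t0 + h)) (nhds 0)"
    using assms by (auto simp: has_fps_expansion_def)
  then obtain d where d: "d > 0" "\<And>h. \<bar>h\<bar> < d \<Longrightarrow> eval_fps A h = g (t0 + h)"
    unfolding eventually_nhds_metric by (auto simp: dist_real_def)
  obtain r where r: "r > 0" "ereal r < fps_conv_radius A"
    using pos by (metis ereal_dense2 ereal_less(2) zero_ereal_def)
  define G where "G = (\<lambda>z. eval_fps A' (z - of_real t0))"
  have "eval_fps A' (of_real h) = of_real (eval_fps A h)" if "\<bar>h\<bar> < r" for h
  proof -
    have "ereal (norm h) < fps_conv_radius A"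
      using that r(2) by (metis ereal_less_eq(3) le_less_trans less_imp_le real_norm_def)
    then have "(\<lambda>n. fps_nth A n * h ^ n) sums eval_fps A h"
      by (rule sums_eval_fps)
    then have "(\<lambda>n. complex_of_real (fps_nth A n * h ^ n)) sums of_real (eval_fps A h)"
      by (rule sums_of_real)
    then show ?thesis
      by (simp add: A'_def eval_fps_def sums_iff)
  qed
  note val = this
  have im: "(\<lambda>z. z - complex_of_real t0) ` ball (of_real t0) (min d r) \<subseteq> eball 0 (fps_conv_radius A')"
  proof (rule image_subsetI)
    fix z assume "z \<in> ball (complex_of_real t0) (min d r)"
    then have "ereal (cmod (z - of_real t0)) < ereal r"
      by (simp add: dist_norm norm_minus_commute)
    then show "z - of_real t0 \<in> eball 0 (fps_conv_radius A')"
      using less_trans[OF _ r(2)] rad by simp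
  qed
  have ev: "eval_fps A' holomorphic_on eball 0 (fps_conv_radius A')"
    by (rule holomorphic_on_eval_fps) simp
  have "(\<lambda>z. z - complex_of_real t0) holomorphic_on ball (of_real t0) (min d r)"
    by (intro holomorphic_intros)
  from holomorphic_on_compose_gen[OF this ev im]
  have "G holomorphic_on ball (of_real t0) (min d r)"
    by (simp add: G_def o_def)
  moreover have "G (of_real t) = of_real (g t)" if "\<bar>t - t0\<bar> < min d r" for t
    using val[of "t - t0"] d(2)[of "t - t0"] that by (simp add: G_def)
  ultimately show ?thesis
    unfolding real_ext_def using d(1) r(1) by (intro exI[of _ "min d r"] exI[of _ G]) auto
qed

lemma real_ext_imp_has_fps_expansion:
  assumes "real_ext g t0 \<delta> G"
  shows "\<exists>A. (\<lambda>h. g (t0 + h)) has_fps_expansion A"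
proof -
  have \<delta>: "\<delta> > 0" and hol: "G holomorphic_on ball (of_real t0) \<delta>"
    and val: "\<And>t. \<bar>t - t0\<bar> < \<delta> \<Longrightarrow> G (of_real t) = of_real (g t)"
    using assms by (auto simp: real_ext_def)
  define a where "a = (\<lambda>n. (deriv ^^ n) G (of_real t0) / fact n)"
  have "(\<lambda>n. Re (a n) * h ^ n) sums g (t0 + h)" if "\<bar>h\<bar> < \<delta>" for h
  proof -
    have "(\<lambda>n. a n * (of_real (t0 + h) - of_real t0) ^ n) sums G (of_real (t0 + h))"
      unfolding a_def using that by (intro holomorphic_power_series[OF hol]) (unfold of_real_in_ball, simp)
    then have "(\<lambda>n. Re (a n * of_real (h ^ n))) sums Re (G (of_real (t0 + h)))"
      by (intro sums_Re) simp
    then show ?thesis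
      using val[of "t0 + h"] that by simp
  qed
  then have "eventually (\<lambda>h. (\<lambda>n. fps_nth (Abs_fps (\<lambda>n. Re (a n))) n * h ^ n) sums g (t0 + h)) (nhds 0)"
    unfolding eventually_nhds_metric using \<delta> by (auto simp: dist_real_def)
  from has_fps_expansionI[OF this] show ?thesis
    by (rule exI)
qed

text \<open>Translates the power series formulation of flows into complex extensions: the real
  coefficients are read as complex ones with the same radius of convergence, and conversely the real
  parts of the complex Taylor coefficients are taken.\<close>

lemma real_analytic_on_iff_real_ext:
  "real_analytic_on g S \<longleftrightarrow> (\<forall>t\<in>S. \<exists>\<delta> G. real_ext g t \<delta> G)"
  unfolding real_analytic_on_def
  using has_fps_expansion_imp_real_ext real_ext_imp_has_fps_expansion by blast

lemma real_ext_const: "\<delta> > 0 \<Longrightarrow> (\<And>t. \<bar>t - t0\<bar> < \<delta> \<Longrightarrow> g t = a) \<Longrightarrow> real_ext g t0 \<delta> (\<lambda>z. of_real a)"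
  by (simp add: real_ext_def)

lemma real_ext_cong: "real_ext f t0 \<delta> G \<Longrightarrow> (\<And>t. \<bar>t - t0\<bar> < \<delta> \<Longrightarrow> f t = g t) \<Longrightarrow> real_ext g t0 \<delta> G"
  by (simp add: real_ext_def)

lemma real_ext_cong_near:
  assumes "real_ext f t0 \<delta> G" "d > 0" "\<And>t. \<bar>t - t0\<bar> < d \<Longrightarrow> f t = g t"
  shows "real_ext g t0 (min \<delta> d) G"
proof (rule real_ext_cong[OF real_ext_mono[OF assms(1)]])
  show "min \<delta> d > 0"
    using assms(1,2) by (auto simp: real_ext_def)
qed (use assms(3) in auto)

lemma real_ext_has_derivative:
  assumes "real_ext g t0 \<delta> G" "\<bar>t - t0\<bar> < \<delta>"
  shows "(g has_real_derivative Re (deriv G (of_real t))) (at t)"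
    and "deriv G (of_real t) = of_real (Re (deriv G (of_real t)))"
proof -
  have hol: "G holomorphic_on ball (of_real t0) \<delta>"
    and val: "\<And>t. \<bar>t - t0\<bar> < \<delta> \<Longrightarrow> G (of_real t) = of_real (g t)"
    using assms(1) by (auto simp: real_ext_def)
  have D: "(G has_field_derivative deriv G (of_real t)) (at (of_real t))"
    using holomorphic_derivI[OF hol open_ball, of "of_real t"] assms(2) unfolding of_real_in_ball by blast
  have pos: "\<delta> - \<bar>t - t0\<bar> > 0"
    using assms(2) by simp
  have "\<And>s. \<bar>s - t\<bar> < \<delta> - \<bar>t - t0\<bar> \<Longrightarrow> G (of_real s) = of_real (g s)"
    by (rule val) auto
  from has_real_derivative_complex_restrict[OF D pos this]
  show "(g has_real_derivative Re (deriv G (of_real t))) (at t)"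
    and "deriv G (of_real t) = of_real (Re (deriv G (of_real t)))"
    by auto
qed

lemma real_ext_deriv:
  assumes "real_ext g t0 \<delta> G" "d > 0" "\<And>t. \<bar>t - t0\<bar> < d \<Longrightarrow> (g has_real_derivative g' t) (at t)"
  shows "real_ext g' t0 (min \<delta> d) (deriv G)"
proof -
  have "deriv G holomorphic_on ball (of_real t0) \<delta>"
    using assms(1) by (auto simp: real_ext_def intro: holomorphic_deriv)
  moreover have "deriv G (of_real t) = of_real (g' t)" if "\<bar>t - t0\<bar> < min \<delta> d" for t
  proof -
    have t: "\<bar>t - t0\<bar> < \<delta>" "\<bar>t - t0\<bar> < d"
      using that by auto
    have "g' t = Re (deriv G (of_real t))"
      using DERIV_unique[OF assms(3)[OF t(2)] real_ext_has_derivative(1)[OF assms(1) t(1)]] .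
    then show ?thesis
      using real_ext_has_derivative(2)[OF assms(1) t(1)] by simp
  qed
  ultimately show ?thesis
    using assms(1,2) by (auto simp: real_ext_def intro: holomorphic_on_subset)
qed

text \<open>The finiteness clause says that all but finitely many components are constant, also at
  complex times; it turns continuity of the single components into nearness in the sense of
  \<open>cnear\<close>.\<close>

definition curve_ext :: "(real \<Rightarrow> 'x \<Rightarrow> real) \<Rightarrow> real \<Rightarrow> real \<Rightarrow> (complex \<Rightarrow> 'x \<Rightarrow> complex) \<Rightarrow> bool" where
  "curve_ext \<phi> t0 \<delta> \<Phi> \<longleftrightarrow> (\<forall>x. real_ext (\<lambda>t. \<phi> t x) t0 \<delta> (\<lambda>z. \<Phi> z x)) \<and>
     finite {x. \<exists>z. \<Phi> z x \<noteq> of_real (\<phi> t0 x)}"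

lemma curve_extI:
  assumes "finite X" "\<And>x. x \<in> X \<Longrightarrow> \<exists>\<delta> G. real_ext (\<lambda>t. \<phi> t x) t0 \<delta> G"
    and "d > 0" "\<And>x t. x \<notin> X \<Longrightarrow> \<bar>t - t0\<bar> < d \<Longrightarrow> \<phi> t x = \<phi> t0 x"
  shows "\<exists>\<delta> \<Phi>. curve_ext \<phi> t0 \<delta> \<Phi>"
proof -
  obtain \<delta>' G where G: "\<And>x. x \<in> X \<Longrightarrow> real_ext (\<lambda>t. \<phi> t x) t0 (\<delta>' x) (G x)"
    using assms(2) by metis
  define \<delta> where "\<delta> = Min (insert d (\<delta>' ` X))"
  have "\<delta>' x > 0" if "x \<in> X" for x
    using G[OF that] by (simp add: real_ext_def)
  then have \<delta>: "\<delta> > 0" "\<delta> \<le> d" "\<And>x. x \<in> X \<Longrightarrow> \<delta> \<le> \<delta>' x"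
    using assms(1,3) by (auto simp: \<delta>_def)
  define \<Phi> where "\<Phi> = (\<lambda>z x. if x \<in> X then G x z else of_real (\<phi> t0 x))"
  have "real_ext (\<lambda>t. \<phi> t x) t0 \<delta> (\<lambda>z. \<Phi> z x)" for x
  proof (cases "x \<in> X")
    case True
    then show ?thesis
      using real_ext_mono[OF G[OF True] \<delta>(1) \<delta>(3)[OF True]] by (simp add: \<Phi>_def)
  next
    case False
    have "real_ext (\<lambda>t. \<phi> t x) t0 \<delta> (\<lambda>z. of_real (\<phi> t0 x))"
      by (rule real_ext_const[OF \<delta>(1)], rule assms(4)[OF False]) (use \<delta>(2) in simp)
    with False show ?thesis
      by (simp add: \<Phi>_def)
  qed
  moreover have "{x. \<exists>z. \<Phi> z x \<noteq> of_real (\<phi> t0 x)} \<subseteq> X"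
    by (auto simp: \<Phi>_def)
  ultimately show ?thesis
    unfolding curve_ext_def using assms(1) finite_subset by blast
qed

lemma curve_ext_near:
  assumes "curve_ext \<phi> t0 \<delta> \<Phi>" "r > 0"
  shows "\<exists>d>0. d \<le> \<delta> \<and> (\<forall>z\<in>ball (of_real t0) d. cnear (\<phi> t0) r (\<Phi> z))"
proof -
  define X where "X = {x. \<exists>z. \<Phi> z x \<noteq> of_real (\<phi> t0 x)}"
  have X: "finite X" and ext: "\<And>x. real_ext (\<lambda>t. \<phi> t x) t0 \<delta> (\<lambda>z. \<Phi> z x)"
    using assms(1) by (auto simp: curve_ext_def X_def)
  have \<delta>: "\<delta> > 0"
    using ext by (auto simp: real_ext_def)
  have "eventually (\<lambda>z. cmod (\<Phi> z x - of_real (\<phi> t0 x)) < r) (nhds (of_real t0))" for x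
  proof -
    have "(\<lambda>z. \<Phi> z x) holomorphic_on ball (of_real t0) \<delta>" "\<Phi> (of_real t0) x = of_real (\<phi> t0 x)"
      using ext[of x] \<delta> by (auto simp: real_ext_def)
    moreover have "complex_of_real t0 \<in> ball (of_real t0) \<delta>"
      using \<delta> by simp
    ultimately have "isCont (\<lambda>z. \<Phi> z x) (of_real t0)"
      by (meson continuous_on_eq_continuous_at holomorphic_on_imp_continuous_on open_ball)
    then have "((\<lambda>z. \<Phi> z x) \<longlongrightarrow> \<Phi> (of_real t0) x) (nhds (of_real t0))"
      unfolding isCont_def using tendsto_at_iff_tendsto_nhds[of "\<lambda>z. \<Phi> z x"] by simp
    then show ?thesis
      using assms(2) \<open>\<Phi> (of_real t0) x = _\<close> by (auto dest!: tendstoD simp: dist_norm)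
  qed
  then have "eventually (\<lambda>z. \<forall>x\<in>X. cmod (\<Phi> z x - of_real (\<phi> t0 x)) < r) (nhds (of_real t0))"
    using X by (intro eventually_ball_finite) auto
  then obtain d where d: "d > 0" "\<And>z x. dist z (of_real t0) < d \<Longrightarrow> x \<in> X \<Longrightarrow> cmod (\<Phi> z x - of_real (\<phi> t0 x)) < r"
    unfolding eventually_nhds_metric by blast
  have "cnear (\<phi> t0) r (\<Phi> z)" if "z \<in> ball (of_real t0) (min d \<delta>)" for z
    unfolding cnear_def
  proof
    fix x
    show "cmod (\<Phi> z x - of_real (\<phi> t0 x)) < r"
    proof (cases "x \<in> X")
      case True
      then show ?thesis
        using d(2) that by (simp add: dist_commute)
    next
      case False
      then show ?thesis
        using assms(2) by (simp add: X_def)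
    qed
  qed
  then show ?thesis
    using d(1) \<delta> by (intro exI[of _ "min d \<delta>"]) auto
qed

lemma analytic_fun_curve:
  assumes f: "analytic_fun f" and \<phi>: "curve_ext \<phi> t0 \<delta> \<Phi>"
  shows "\<exists>d G. real_ext (\<lambda>t. f (\<phi> t)) t0 d G"
proof -
  obtain r B E where E: "cext f (\<phi> t0) r B E"
    using f by (rule analytic_funE)
  obtain d where d: "d > 0" "d \<le> \<delta>" "\<And>z. z \<in> ball (of_real t0) d \<Longrightarrow> cnear (\<phi> t0) r (\<Phi> z)"
    using curve_ext_near[OF \<phi> cextD(1)[OF E]] by blast
  have ext: "\<And>x. real_ext (\<lambda>t. \<phi> t x) t0 d (\<lambda>z. \<Phi> z x)"
    using \<phi> d real_ext_mono by (fastforce simp: curve_ext_def)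
  have "(\<lambda>z. E (\<Phi> z)) holomorphic_on ball (of_real t0) d"
    using d(3) ext by (intro cextD(2)[OF E]) (auto simp: real_ext_def)
  moreover have "E (\<Phi> (of_real t)) = of_real (f (\<phi> t))" if t: "\<bar>t - t0\<bar> < d" for t
  proof -
    have "\<Phi> (of_real t) = (\<lambda>x. of_real (\<phi> t x))"
      using ext t by (auto simp: real_ext_def)
    then show ?thesis
      using cextD(4)[OF E, of "\<phi> t"] d(3)[of "of_real t"] t unfolding of_real_in_ball by simp
  qed
  ultimately show ?thesis
    unfolding real_ext_def using d(1) by (intro exI[of _ d] exI[of _ "\<lambda>z. E (\<Phi> z)"]) blast
qed

lemma is_flow_has_derivative:
  "is_flow xs a b \<phi> \<Longrightarrow> a < t \<Longrightarrow> t < b \<Longrightarrow> x \<in> set xs \<Longrightarrow>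
     ((\<lambda>s. \<phi> s x) has_real_derivative \<phi> t (Prime x)) (at t)"
  by (simp add: is_flow_def)

text \<open>A flow is required to be analytic in \<open>xs\<close> only; the primed variables follow
  because they are derivatives of analytic functions.\<close>

lemma is_flow_real_ext:
  assumes \<phi>: "is_flow xs a b \<phi>" "a < t0" "t0 < b"
  shows "x \<in> set xs \<Longrightarrow> \<exists>\<delta> G. real_ext (\<lambda>t. \<phi> t x) t0 \<delta> G"
    and "x \<in> Prime ` set xs \<Longrightarrow> \<exists>\<delta> G. real_ext (\<lambda>t. \<phi> t x) t0 \<delta> G"
proof -
  have *: "\<exists>\<delta> G. real_ext (\<lambda>t. \<phi> t x) t0 \<delta> G" if "x \<in> set xs" for x
    using \<phi> that by (simp add: is_flow_def real_analytic_on_iff_real_ext)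
  then show "x \<in> set xs \<Longrightarrow> \<exists>\<delta> G. real_ext (\<lambda>t. \<phi> t x) t0 \<delta> G" .
  assume "x \<in> Prime ` set xs"
  then obtain y where y: "y \<in> set xs" "x = Prime y"
    by blast
  obtain \<delta> G where G: "real_ext (\<lambda>t. \<phi> t y) t0 \<delta> G"
    using *[OF y(1)] by blast
  have "real_ext (\<lambda>t. \<phi> t (Prime y)) t0 (min \<delta> (min (t0 - a) (b - t0))) (deriv G)"
    by (rule real_ext_deriv[OF G]) (use \<phi> y(1) in \<open>auto intro!: is_flow_has_derivative[OF \<phi>(1)]\<close>)
  then show "\<exists>\<delta> G. real_ext (\<lambda>t. \<phi> t x) t0 \<delta> G"
    using y(2) by blast
qed

lemma is_flow_curve_ext:
  assumes \<phi>: "is_flow xs a b \<phi>" "a < t0" "t0 < b"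
  shows "\<exists>\<delta> \<Phi>. curve_ext \<phi> t0 \<delta> \<Phi>"
proof (rule curve_extI)
  show "finite (set xs \<union> Prime ` set xs)"
    by simp
  show "\<exists>\<delta> G. real_ext (\<lambda>t. \<phi> t x) t0 \<delta> G" if "x \<in> set xs \<union> Prime ` set xs" for x
    using is_flow_real_ext[OF \<phi>] that by blast
  show "min (t0 - a) (b - t0) > 0"
    using \<phi> by simp
  show "\<phi> t x = \<phi> t0 x" if "x \<notin> set xs \<union> Prime ` set xs" "\<bar>t - t0\<bar> < min (t0 - a) (b - t0)" for x t
    using is_flow_outside[OF \<phi>(1), of t x] is_flow_outside[OF \<phi>(1), of t0 x] \<phi>(2,3) that by auto
qed

lemma eval_flow_real_ext:
  assumes "analytic_interp fi" "is_flow xs a b \<phi>" "a < t0" "t0 < b"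
  shows "\<exists>\<delta> G. real_ext (\<lambda>t. eval fi e (\<phi> t)) t0 \<delta> G"
  using is_flow_curve_ext[OF assms(2-4)] analytic_fun_curve[OF analytic_fun_eval[OF assms(1)]] by blast

text \<open>In the differential a parameter \<open>z\<close> contributes \<open>z'\<close> times a
  partial derivative. Along the flow \<open>z\<close> is constant, and \<open>z'\<close> keeps its
  initial value 0, since \<open>parameters\<close> keeps it out of \<open>xs\<close> and
  \<open>z\<close> itself lies outside \<open>xs\<close>. So this summand agrees with the chain
  rule, as do those of the flowing variables.\<close>

lemma eval_flow_derivative:
  assumes fi: "analytic_interp fi" and \<phi>: "is_flow xs a b \<phi>" "a < t" "t < b"
    and e: "set (primes xs) \<inter> fvt e = {}" "fvt e \<subseteq> X" and zs: "parameters zs xs X"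
    and const: "\<And>z. z \<in> set zs \<Longrightarrow> \<phi> 0 (Prime z) = 0"
  shows "((\<lambda>s. eval fi e (\<phi> s)) has_real_derivative eval fi (Differential e) (\<phi> t)) (at t)"
  unfolding eval.simps
proof (rule analytic_fun_chain_rule[OF analytic_fun_eval[OF fi]])
  show "eval fi e u = eval fi e v" if "\<And>x. x \<in> fvt e \<Longrightarrow> u x = v x" for u v
    using that by (rule eval_coincidence)
  show "((\<lambda>s. \<phi> s x) has_real_derivative \<phi> t (Prime x)) (at t)" if x: "x \<in> fvt e" for x
  proof (cases "x \<in> set xs")
    case True
    then show ?thesis
      using is_flow_has_derivative[OF \<phi>] by blast
  next
    case False
    then have "x \<in> set zs" "x \<notin> Prime ` set xs"
      using x e zs by (auto simp: parameters_def)
    then have "\<phi> 0 (Prime x) = 0" "Prime x \<notin> set xs"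
      using const zs by (auto simp: parameters_def)
    moreover have "Prime x \<notin> Prime ` set xs"
      using False by auto
    ultimately have "\<phi> t (Prime x) = 0"
      using is_flow_outside[OF \<phi>] by simp
    moreover have "((\<lambda>s. \<phi> s x) has_real_derivative 0) (at t)"
    proof (rule has_field_derivative_transform_within_open)
      show "((\<lambda>s. \<phi> 0 x) has_real_derivative 0) (at t)"
        by simp
      show "\<phi> 0 x = \<phi> s x" if "s \<in> {a<..<b}" for s
        using is_flow_outside[OF \<phi>(1), of s x] that False \<open>x \<notin> Prime ` set xs\<close> by simp
    qed (use \<phi> in auto)
    ultimately show ?thesis
      by simp
  qed
qed simp

subsection \<open>Flows\<close>

lemma is_flow_restrict: "is_flow xs a b \<phi> \<Longrightarrow> a \<le> a' \<Longrightarrow> b' \<le> b \<Longrightarrow> is_flow xs a' b' \<phi>"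
  unfolding is_flow_def real_analytic_on_def by auto

lemma is_flow_shift:
  assumes "is_flow xs a b \<phi>" "a < c" "c < b"
  shows "is_flow xs (a - c) (b - c) (\<lambda>t. \<phi> (c + t))"
  unfolding is_flow_def
proof (intro conjI ballI allI impI)
  fix x assume x: "x \<in> set xs"
  have "real_analytic_on (\<lambda>t. \<phi> t x) {a<..<b}"
    using assms x by (simp add: is_flow_def)
  then show "real_analytic_on (\<lambda>t. \<phi> (c + t) x) {a - c<..<b - c}"
    unfolding real_analytic_on_def
  proof (intro ballI)
    fix t assume an: "\<forall>t\<in>{a<..<b}. \<exists>A. (\<lambda>h. \<phi> (t + h) x) has_fps_expansion A"
      and "t \<in> {a - c<..<b - c}"
    then have "c + t \<in> {a<..<b}"
      by auto
    with an show "\<exists>A. (\<lambda>h. \<phi> (c + (t + h)) x) has_fps_expansion A"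
      unfolding add.assoc[symmetric] by blast
  qed
  fix t assume "t \<in> {a - c<..<b - c}"
  then have "((\<lambda>s. \<phi> s x) has_real_derivative \<phi> (t + c) (Prime x)) (at (t + c))"
    using assms x by (intro is_flow_has_derivative[OF assms(1)]) auto
  then show "((\<lambda>s. \<phi> (c + s) x) has_real_derivative \<phi> (c + t) (Prime x)) (at t)"
    unfolding DERIV_shift by (simp only: add.commute)
next
  fix t z assume t: "t \<in> {a - c<..<b - c}" and z: "z \<notin> set xs \<union> set (primes xs)"
  have "\<phi> (c + t) z = \<phi> 0 z" "\<phi> c z = \<phi> 0 z"
    using t z assms by (auto intro!: is_flow_outside[OF assms(1)])
  then show "\<phi> (c + t) z = \<phi> (c + 0) z"
    by simp
qed

text \<open>Segments of a run are runs, so box premises, which speak of end states, apply at each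
  time of a flow.\<close>

lemma DAP_segment:
  assumes \<phi>: "is_flow xs (- \<epsilon>) (T + \<epsilon>) \<phi>" "\<epsilon> > 0" and st: "0 \<le> s" "s \<le> t" "t \<le> T"
    and A: "\<And>u. s \<le> u \<Longrightarrow> u \<le> t \<Longrightarrow> \<phi> u \<in> fsem fi qi A"
  shows "(\<phi> s, \<phi> t) \<in> psem fi qi (DAP xs A)"
proof (rule DAP_I)
  have "is_flow xs (- \<epsilon> - s) (T + \<epsilon> - s) (\<lambda>u. \<phi> (s + u))"
    using assms by (intro is_flow_shift) auto
  then show "is_flow xs (- \<epsilon>) (t - s + \<epsilon>) (\<lambda>u. \<phi> (s + u))"
    by (rule is_flow_restrict) (use st in auto)
qed (use assms in auto)

text \<open>
  If \<open>xs\<close> contains \<open>x\<close> together with \<open>x'\<close>, \<open>x''\<close>, etc., the prescribed initial values of these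
  variables are the first Taylor coefficients of the flow.
\<close>

lemma is_flow_exists: "\<exists>\<phi>. is_flow xs a b \<phi> \<and> \<phi> 0 = \<mu>"
proof -
  \<comment> \<open>The number of consecutive members of the chain \<open>z\<close>,
    \<open>z'\<close>, \<open>z''\<close>, ... in \<open>xs\<close>, finite because
    \<open>xs\<close> is. It is the formal degree of the polynomial \<open>\<phi> t z\<close> below;
    differentiating shortens the chain by one and produces the polynomial of
    \<open>z'\<close>.\<close>
  define len where "len = (\<lambda>z. LEAST n. (Prime ^^ n) z \<notin> set xs)"
  have len: "len z = Suc (len (Prime z))" if "z \<in> set xs" for z
  proof -
    obtain n where "(Prime ^^ n) z \<notin> set xs"
      using Prime_pow_leaves_finite by blast
    then have "len z = Suc (LEAST m. (Prime ^^ Suc m) z \<notin> set xs)"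
      unfolding len_def by (rule Least_Suc) (use that in simp)
    then show ?thesis
      unfolding len_def by (simp only: funpow_Suc_right o_apply)
  qed
  have len0: "len z = 0" if "z \<notin> set xs" for z
    unfolding len_def using that by (intro Least_eq_0) simp
  define \<phi> where "\<phi> = (\<lambda>t z. \<Sum>k\<le>len z. \<mu> ((Prime ^^ k) z) * t ^ k / fact k)"
  have "real_analytic_on (\<lambda>t. \<phi> t z) S" for z S
    unfolding real_analytic_on_iff_real_ext
  proof
    fix t0 assume "t0 \<in> S"
    have "real_ext (\<lambda>t. \<phi> t z) t0 1 (\<lambda>w. \<Sum>k\<le>len z. of_real (\<mu> ((Prime ^^ k) z)) * w ^ k / fact k)"
      unfolding real_ext_def \<phi>_def by (auto intro!: holomorphic_intros)
    then show "\<exists>\<delta> G. real_ext (\<lambda>t. \<phi> t z) t0 \<delta> G"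
      by blast
  qed
  moreover have "((\<lambda>s. \<phi> s z) has_real_derivative \<phi> t (Prime z)) (at t)" if "z \<in> set xs" for z t
  proof -
    have eq: "\<phi> s z = \<mu> z + (\<Sum>k\<le>len (Prime z). \<mu> ((Prime ^^ k) (Prime z)) * s ^ Suc k / fact (Suc k))" for s
      unfolding \<phi>_def len[OF that] by (subst sum.atMost_Suc_shift) (simp only: funpow_Suc_right o_apply, simp)
    have "((\<lambda>s. \<mu> ((Prime ^^ k) (Prime z)) * s ^ Suc k / fact (Suc k)) has_real_derivative
        \<mu> ((Prime ^^ k) (Prime z)) * t ^ k / fact k) (at t)" for k
    proof -
      have "((\<lambda>s. \<mu> ((Prime ^^ k) (Prime z)) * s ^ Suc k / fact (Suc k)) has_real_derivative
          \<mu> ((Prime ^^ k) (Prime z)) * (real (Suc k) * t ^ k) / fact (Suc k)) (at t)"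
        using DERIV_cdivide[OF DERIV_cmult[OF DERIV_pow[of "Suc k" t UNIV]],
            of "\<mu> ((Prime ^^ k) (Prime z))" "fact (Suc k)"]
        by (simp only: diff_Suc_Suc minus_nat.diff_0)
      moreover have "\<mu> ((Prime ^^ k) (Prime z)) * (real (Suc k) * t ^ k) / fact (Suc k) =
          \<mu> ((Prime ^^ k) (Prime z)) * t ^ k / fact k"
        by (simp add: field_simps del: of_nat_Suc)
      ultimately show ?thesis
        by (simp only:)
    qed
    then have "((\<lambda>s. \<mu> z + (\<Sum>k\<le>len (Prime z). \<mu> ((Prime ^^ k) (Prime z)) * s ^ Suc k / fact (Suc k)))
        has_real_derivative 0 + (\<Sum>k\<le>len (Prime z). \<mu> ((Prime ^^ k) (Prime z)) * t ^ k / fact k)) (at t)"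
      by (intro DERIV_add DERIV_const DERIV_sum) auto
    then show ?thesis
      unfolding eq by (simp add: \<phi>_def)
  qed
  moreover have "\<phi> t z = \<phi> 0 z" if "z \<notin> set xs" for t z
    using len0[OF that] by (simp add: \<phi>_def)
  moreover have "\<phi> 0 = \<mu>"
    by (rule ext) (simp add: \<phi>_def sum.atMost_shift)
  ultimately show ?thesis
    unfolding is_flow_def by (intro exI[of _ \<phi>]) (metis Un_iff)
qed


subsection \<open>Adding and removing variables of a flow\<close>

lemma new_tupleD:
  assumes "new_tuple ys xs"
  shows "distinct ys" "\<And>y. y \<in> set ys \<Longrightarrow> y \<notin> Prime ` set ys" "\<And>y. y \<in> set ys \<Longrightarrow> Prime y \<notin> set ys"
    "\<And>y. y \<in> set ys \<Longrightarrow> y \<notin> set xs" "\<And>y. y \<in> set ys \<Longrightarrow> y \<notin> Prime ` set xs"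
    "\<And>y. y \<in> set ys \<Longrightarrow> Prime y \<notin> set xs" "\<And>y. y \<in> set ys \<Longrightarrow> Prime y \<notin> Prime ` set xs"
  using assms by (auto simp: new_tuple_def no_free_def)

text \<open>Overwrites ghosts and their differentials in one go: with time-dependent values this
  adds ghosts to a flow, with constant values it removes them.\<close>

definition extend_state ::
  "'v var list \<Rightarrow> 'v state \<Rightarrow> ('v var \<Rightarrow> real) \<Rightarrow> ('v var \<Rightarrow> real) \<Rightarrow> 'v state" where
  "extend_state ys s v v' =
     (\<lambda>z. if z \<in> set ys then v z else case z of Base _ \<Rightarrow> s z | Prime y \<Rightarrow> if y \<in> set ys then v' y else s z)"

lemma extend_state_var: "y \<in> set ys \<Longrightarrow> extend_state ys s v v' y = v y"
  by (simp add: extend_state_def)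

lemma extend_state_Prime: "y \<in> set ys \<Longrightarrow> Prime y \<notin> set ys \<Longrightarrow> extend_state ys s v v' (Prime y) = v' y"
  by (simp add: extend_state_def)

lemma extend_state_other: "z \<notin> set ys \<Longrightarrow> z \<notin> Prime ` set ys \<Longrightarrow> extend_state ys s v v' z = s z"
  by (auto simp: extend_state_def split: var.split)

lemma is_flow_extend:
  assumes \<phi>: "is_flow xs a b \<phi>" and ys: "new_tuple ys xs"
    and Y: "\<And>y. y \<in> set ys \<Longrightarrow> real_analytic_on (\<lambda>t. Y t y) {a<..<b}"
      "\<And>y t. y \<in> set ys \<Longrightarrow> a < t \<Longrightarrow> t < b \<Longrightarrow> ((\<lambda>s. Y s y) has_real_derivative Y' t y) (at t)"
  shows "is_flow (xs @ ys) a b (\<lambda>t. extend_state ys (\<phi> t) (Y t) (Y' t))"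
  unfolding is_flow_def
proof (intro conjI ballI allI impI)
  note D = new_tupleD[OF ys]
  fix x assume x: "x \<in> set (xs @ ys)"
  show "real_analytic_on (\<lambda>t. extend_state ys (\<phi> t) (Y t) (Y' t) x) {a<..<b}"
  proof (cases "x \<in> set ys")
    case True
    then show ?thesis
      using Y by (simp add: extend_state_var)
  next
    case False
    then have "x \<in> set xs" "x \<notin> Prime ` set ys"
      using x D by auto
    then show ?thesis
      using \<phi> False by (simp add: extend_state_other is_flow_def)
  qed
  fix t assume t: "t \<in> {a<..<b}"
  show "((\<lambda>s. extend_state ys (\<phi> s) (Y s) (Y' s) x) has_real_derivative
      extend_state ys (\<phi> t) (Y t) (Y' t) (Prime x)) (at t)"
  proof (cases "x \<in> set ys")
    case True
    then show ?thesis
      using Y(2)[OF True] D t by (simp add: extend_state_var extend_state_Prime)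
  next
    case False
    then have "x \<in> set xs" "x \<notin> Prime ` set ys" "Prime x \<notin> set ys" "Prime x \<notin> Prime ` set ys"
      using x D(4-6)[of "Prime x"] D by auto
    then show ?thesis
      using is_flow_has_derivative[OF \<phi>, of t x] t False by (simp add: extend_state_other)
  qed
next
  fix t z assume "t \<in> {a<..<b}" "z \<notin> set (xs @ ys) \<union> set (primes (xs @ ys))"
  then have "\<phi> t z = \<phi> 0 z" "z \<notin> set ys" "z \<notin> Prime ` set ys"
    using is_flow_outside[OF \<phi>, of t z] by auto
  then show "extend_state ys (\<phi> t) (Y t) (Y' t) z = extend_state ys (\<phi> 0) (Y 0) (Y' 0) z"
    by (simp add: extend_state_other)
qed

lemma is_flow_project:
  assumes \<phi>: "is_flow (xs @ ys) a b \<phi>" and ys: "new_tuple ys xs"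
  shows "is_flow xs a b (\<lambda>t. extend_state ys (\<phi> t) v v')"
  unfolding is_flow_def
proof (intro conjI ballI allI impI)
  note D = new_tupleD[OF ys]
  fix x assume x: "x \<in> set xs"
  then have x': "x \<notin> set ys" "x \<notin> Prime ` set ys" "Prime x \<notin> set ys" "Prime x \<notin> Prime ` set ys"
    using D(4-6)[of "Prime x"] D by auto
  then show "real_analytic_on (\<lambda>t. extend_state ys (\<phi> t) v v' x) {a<..<b}"
    using \<phi> x by (simp add: extend_state_other is_flow_def)
  fix t assume "t \<in> {a<..<b}"
  then show "((\<lambda>s. extend_state ys (\<phi> s) v v' x) has_real_derivative
      extend_state ys (\<phi> t) v v' (Prime x)) (at t)"
    using is_flow_has_derivative[OF \<phi>, of t x] x x' by (simp add: extend_state_other)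
next
  fix t z assume t: "t \<in> {a<..<b}" and z: "z \<notin> set xs \<union> set (primes xs)"
  consider "z \<in> set ys \<union> Prime ` set ys" | "z \<notin> set (xs @ ys)" "z \<notin> Prime ` set (xs @ ys)"
    using z by auto
  then show "extend_state ys (\<phi> t) v v' z = extend_state ys (\<phi> 0) v v' z"
  proof cases
    case 1
    then show ?thesis
      by (auto simp: extend_state_def)
  next
    case 2
    then show ?thesis
      using is_flow_outside[OF \<phi>, of t z] t by (simp add: extend_state_other image_Un)
  qed
qed

lemma fsem_Foralls_primes:
  "\<mu> \<in> fsem fi qi (Foralls ys (Foralls (primes ys) A)) \<longleftrightarrow>
     (\<forall>\<nu>. (\<forall>z. z \<notin> set ys \<longrightarrow> z \<notin> Prime ` set ys \<longrightarrow> \<nu> z = \<mu> z) \<longrightarrow> \<nu> \<in> fsem fi qi A)"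
proof -
  have "Foralls ys (Foralls (primes ys) A) = Foralls (ys @ primes ys) A"
    by (simp add: Foralls_def)
  then show ?thesis
    by (simp only: fsem_Foralls) auto
qed

text \<open>A run with ghosts projects to a run from \<open>\<mu>\<close> by freezing the ghosts at
  their values in \<open>\<mu>\<close>; neither \<open>F\<close> nor \<open>P\<close> sees the
  difference. Serves DR and the easy direction of BDG.\<close>

lemma Box_DAP_extend:
  assumes ys: "new_tuple ys xs" "no_free ys (fvf P \<union> fvf F)"
    and P: "\<mu> \<in> fsem fi qi (Box (DAP xs F) P)"
    and \<nu>: "\<And>z. z \<notin> set ys \<Longrightarrow> z \<notin> Prime ` set ys \<Longrightarrow> \<nu> z = \<mu> z"
  shows "\<nu> \<in> fsem fi qi (Box (DAP (xs @ ys) (And F G)) P)"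
  unfolding fsem.simps
proof (intro CollectI allI impI)
  fix \<kappa> assume "(\<nu>, \<kappa>) \<in> psem fi qi (DAP (xs @ ys) (And F G))"
  then obtain T \<epsilon> \<phi> where \<phi>: "T \<ge> 0" "\<epsilon> > 0" "is_flow (xs @ ys) (- \<epsilon>) (T + \<epsilon>) \<phi>"
      "\<forall>t\<in>{0..T}. \<phi> t \<in> fsem fi qi (And F G)" "\<phi> 0 = \<nu>" "\<phi> T = \<kappa>"
    by (rule DAP_E)
  define \<psi> where "\<psi> = (\<lambda>t. extend_state ys (\<phi> t) \<mu> (\<lambda>y. \<mu> (Prime y)))"
  have agree: "\<psi> t z = \<phi> t z" if "z \<in> fvf P \<union> fvf F" for t z
  proof -
    have "z \<notin> set ys" "z \<notin> Prime ` set ys"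
      using ys(2) that by (auto simp: no_free_def)
    then show ?thesis
      by (simp add: \<psi>_def extend_state_other)
  qed
  have "(\<mu>, \<psi> T) \<in> psem fi qi (DAP xs F)"
  proof (rule DAP_I[OF \<phi>(1,2)])
    show "is_flow xs (- \<epsilon>) (T + \<epsilon>) \<psi>"
      unfolding \<psi>_def using \<phi>(3) ys(1) by (rule is_flow_project)
    show "\<psi> t \<in> fsem fi qi F" if "0 \<le> t" "t \<le> T" for t
    proof -
      have "\<phi> t \<in> fsem fi qi F"
        using \<phi>(4) that by simp
      then show ?thesis
        using fsem_coincidence[of F "\<psi> t" "\<phi> t"] agree by simp
    qed
    show "\<psi> 0 = \<mu>"
    proof
      fix z
      show "\<psi> 0 z = \<mu> z"
        using \<nu>[of z] \<phi>(5) by (auto simp: \<psi>_def extend_state_def split: var.split)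
    qed
  qed simp
  then have "\<psi> T \<in> fsem fi qi P"
    using P by simp
  then show "\<kappa> \<in> fsem fi qi P"
    using fsem_coincidence[of P "\<psi> T" \<kappa>] agree[of _ T] \<phi>(6) by simp
qed


subsection \<open>The axioms without switching and differential ghosts\<close>

lemma DW_sound: "valid fi qi (Box (DAP xs F) F)"
  unfolding valid_def fsem.simps by (auto elim!: DAP_E)

lemma C_sound: "valid fi qi (Iff (Box (DAP xs (And F G)) P) (Box (DAP xs (And G F)) P))"
  by (simp add: valid_def fsem_Iff Int_commute)

lemma DX_sound: "valid fi qi (Imp (Box (DAP xs F) P) (Box (Test F) P))"
  unfolding valid_def fsem_Imp
proof (intro allI impI)
  fix \<mu> assume P: "\<mu> \<in> fsem fi qi (Box (DAP xs F) P)"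
  have "\<mu> \<in> fsem fi qi P" if "\<mu> \<in> fsem fi qi F"
  proof -
    \<comment> \<open>A run of duration 0 still needs a flow on an open interval through the given
      state, whatever values the primed variables have there.\<close>
    obtain \<phi> where \<phi>: "is_flow xs (- 1) (0 + 1) \<phi>" "\<phi> 0 = \<mu>"
      using is_flow_exists by blast
    have "(\<mu>, \<mu>) \<in> psem fi qi (DAP xs F)"
      by (rule DAP_I[OF _ _ \<phi>(1)]) (use \<phi>(2) that in auto)
    then show ?thesis
      using P by simp
  qed
  then show "\<mu> \<in> fsem fi qi (Box (Test F) P)"
    by auto
qed

text \<open>For positive duration \<open>e\<close> vanishes on \<open>[0, T]\<close>, but nothing is
  known after \<open>T\<close>; so a nonzero derivative at \<open>T\<close> is refuted by comparison
  with earlier times. Duration 0 offers no second instant and is covered by the test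
  premise.\<close>

lemma DE_sound:
  assumes fi: "analytic_interp fi" and e: "set (primes xs) \<inter> fvt e = {}" "parameters zs xs (fvt e)"
  shows "valid fi qi
          (Imp (Constant zs)
            (Imp (Box (Test (Eq e (Const 0))) (Eq (Differential e) (Const 0)))
              (Box (DAP xs (Eq e (Const 0))) (Eq (Differential e) (Const 0)))))"
  unfolding valid_def fsem_Imp
proof (intro allI impI)
  fix \<mu> assume zs: "\<mu> \<in> fsem fi qi (Constant zs)"
    and test: "\<mu> \<in> fsem fi qi (Box (Test (Eq e (Const 0))) (Eq (Differential e) (Const 0)))"
  have "eval fi (Differential e) \<nu> = 0" if "(\<mu>, \<nu>) \<in> psem fi qi (DAP xs (Eq e (Const 0)))" for \<nu>
    using that
  proof (rule DAP_E)
    fix T \<epsilon> \<phi>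
    assume \<phi>: "T \<ge> 0" "\<epsilon> > 0" "is_flow xs (- \<epsilon>) (T + \<epsilon>) \<phi>"
      "\<forall>t\<in>{0..T}. \<phi> t \<in> fsem fi qi (Eq e (Const 0))" "\<phi> 0 = \<mu>" "\<phi> T = \<nu>"
    have 0: "eval fi e (\<phi> t) = 0" if "0 \<le> t" "t \<le> T" for t
      using \<phi>(4) that by (simp add: fsem_Eq)
    show "eval fi (Differential e) \<nu> = 0"
    proof (cases "T = 0")
      case True
      then show ?thesis
        using test \<phi>(5,6) 0[of 0] by (simp add: fsem_Eq del: eval.simps(6))
    next
      case False
      have D: "((\<lambda>s. eval fi e (\<phi> s)) has_real_derivative eval fi (Differential e) (\<phi> T)) (at T)"
        using \<phi>(1,2,5) zs e by (intro eval_flow_derivative[OF fi \<phi>(3)]) (auto simp: fsem_Constant)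
      show ?thesis
      proof (cases "eval fi (Differential e) (\<phi> T)" "0 :: real" rule: linorder_cases)
        case less
        then obtain d where "d > 0" "\<And>h. h > 0 \<Longrightarrow> h < d \<Longrightarrow> eval fi e (\<phi> T) < eval fi e (\<phi> (T - h))"
          using DERIV_neg_dec_left[OF D] by blast
        \<comment> \<open>The time \<open>T - min d T / 2\<close> is less than \<open>d\<close>
          before \<open>T\<close> and still nonnegative, so \<open>e\<close> vanishes there
          too.\<close>
        then show ?thesis
          using 0[of T] 0[of "T - min d T / 2"] False \<phi>(1) by (force dest!: meta_spec[of _ "min d T / 2"])
      next
        case greater
        then obtain d where "d > 0" "\<And>h. h > 0 \<Longrightarrow> h < d \<Longrightarrow> eval fi e (\<phi> (T - h)) < eval fi e (\<phi> T)"
          using DERIV_pos_inc_left[OF D] by blast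
        then show ?thesis
          using 0[of T] 0[of "T - min d T / 2"] False \<phi>(1) by (force dest!: meta_spec[of _ "min d T / 2"])
      qed (use \<phi>(6) in simp)
    qed
  qed
  then show "\<mu> \<in> fsem fi qi (Box (DAP xs (Eq e (Const 0))) (Eq (Differential e) (Const 0)))"
    by (simp add: fsem_Eq del: eval.simps(6) psem.simps)
qed

text \<open>Because the differential of a disjunction is a conjunction, each disjunct is preserved
  on its own, and whichever holds initially persists; the induction never has to follow a change of
  disjunct. The fixed set \<open>X\<close> lets subformulas inherit the condition on the
  parameters.\<close>

lemma flow_invariant:
  assumes fi: "analytic_interp fi" and \<phi>: "is_flow xs a b \<phi>" "a < 0" "T < b"
    and zs: "parameters zs xs X" "\<And>z. z \<in> set zs \<Longrightarrow> \<phi> 0 (Prime z) = 0"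
  shows "comparisons P \<Longrightarrow> set (primes xs) \<inter> fvf P = {} \<Longrightarrow> fvf P \<subseteq> X \<Longrightarrow>
    (\<And>t. 0 \<le> t \<Longrightarrow> t \<le> T \<Longrightarrow> \<phi> t \<in> fsem fi qi (fdiff P)) \<Longrightarrow> \<phi> 0 \<in> fsem fi qi P \<Longrightarrow>
    0 \<le> t \<Longrightarrow> t \<le> T \<Longrightarrow> \<phi> t \<in> fsem fi qi P"
proof (induction P rule: comparisons.induct)
  case (1 e g)
  have D: "((\<lambda>s. eval fi g (\<phi> s) - eval fi e (\<phi> s)) has_real_derivative
      eval fi (Differential g) (\<phi> s) - eval fi (Differential e) (\<phi> s)) (at s)" if "0 \<le> s" "s \<le> T" for s
    using that 1 \<phi>(2,3) zs by (intro DERIV_diff eval_flow_derivative[OF fi \<phi>(1)]) auto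
  have "eval fi g (\<phi> 0) - eval fi e (\<phi> 0) \<le> eval fi g (\<phi> t) - eval fi e (\<phi> t)"
  proof (rule DERIV_nonneg_imp_nondecreasing[OF \<open>0 \<le> t\<close>])
    fix s assume s: "0 \<le> s" "s \<le> t"
    then have "eval fi (Differential e) (\<phi> s) \<le> eval fi (Differential g) (\<phi> s)"
      using 1 by (simp del: eval.simps(6))
    then show "\<exists>y. ((\<lambda>s. eval fi g (\<phi> s) - eval fi e (\<phi> s)) has_real_derivative y) (at s) \<and> 0 \<le> y"
      using D[of s] s \<open>t \<le> T\<close> by (intro exI[of _ "eval fi (Differential g) (\<phi> s) - eval fi (Differential e) (\<phi> s)"]) auto
  qed
  then show ?case
    using 1 by simp
next
  case (2 e g)
  have D: "((\<lambda>s. eval fi e (\<phi> s) - eval fi g (\<phi> s)) has_real_derivative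
      eval fi (Differential e) (\<phi> s) - eval fi (Differential g) (\<phi> s)) (at s)" if "0 \<le> s" "s \<le> T" for s
    using that 2 \<phi>(2,3) zs by (intro DERIV_diff eval_flow_derivative[OF fi \<phi>(1)]) auto
  have "eval fi e (\<phi> 0) - eval fi g (\<phi> 0) \<le> eval fi e (\<phi> t) - eval fi g (\<phi> t)"
  proof (rule DERIV_nonneg_imp_nondecreasing[OF \<open>0 \<le> t\<close>])
    fix s assume s: "0 \<le> s" "s \<le> t"
    then have "\<not> eval fi (Differential e) (\<phi> s) \<le> eval fi (Differential g) (\<phi> s)"
      using 2 by (simp del: eval.simps(6))
    then show "\<exists>y. ((\<lambda>s. eval fi e (\<phi> s) - eval fi g (\<phi> s)) has_real_derivative y) (at s) \<and> 0 \<le> y"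
      using D[of s] s \<open>t \<le> T\<close> by (intro exI[of _ "eval fi (Differential e) (\<phi> s) - eval fi (Differential g) (\<phi> s)"]) auto
  qed
  then show ?case
    using 2 by simp
next
  case (3 A B)
  have "\<phi> t \<in> fsem fi qi A"
    by (rule 3(1)) (use 3 in auto)
  moreover have "\<phi> t \<in> fsem fi qi B"
    by (rule 3(2)) (use 3 in auto)
  ultimately show ?case
    by simp
next
  case (4 A B)
  have "\<phi> t \<in> fsem fi qi A" if "\<phi> 0 \<in> fsem fi qi A"
    by (rule 4(1)) (use 4 that in auto)
  moreover have "\<phi> t \<in> fsem fi qi B" if "\<phi> 0 \<in> fsem fi qi B"
    by (rule 4(2)) (use 4 that in auto)
  ultimately show ?case
    using 4(7) by auto
qed simp_all

lemma DI_sound: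
  assumes fi: "analytic_interp fi" and P: "comparisons P" "set (primes xs) \<inter> fvf P = {}" "parameters zs xs (fvf P)"
  shows "valid fi qi
          (Imp (Constant zs)
            (Imp (Imp F (Box (DAP xs F) (fdiff P)))
              (Imp (Box (Test F) P) (Box (DAP xs F) P))))"
  unfolding valid_def fsem_Imp
proof (intro allI impI)
  fix \<mu> assume zs: "\<mu> \<in> fsem fi qi (Constant zs)"
    and diff: "\<mu> \<in> fsem fi qi F \<longrightarrow> \<mu> \<in> fsem fi qi (Box (DAP xs F) (fdiff P))"
    and test: "\<mu> \<in> fsem fi qi (Box (Test F) P)"
  have "\<nu> \<in> fsem fi qi P" if "(\<mu>, \<nu>) \<in> psem fi qi (DAP xs F)" for \<nu>
    using that
  proof (rule DAP_E)
    fix T \<epsilon> \<phi>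
    assume \<phi>: "T \<ge> 0" "\<epsilon> > 0" "is_flow xs (- \<epsilon>) (T + \<epsilon>) \<phi>"
      "\<forall>t\<in>{0..T}. \<phi> t \<in> fsem fi qi F" "\<phi> 0 = \<mu>" "\<phi> T = \<nu>"
    have F: "\<mu> \<in> fsem fi qi F"
      using \<phi>(1,4,5) by force
    have diff': "\<phi> t \<in> fsem fi qi (fdiff P)" if "0 \<le> t" "t \<le> T" for t
    proof -
      have "(\<phi> 0, \<phi> t) \<in> psem fi qi (DAP xs F)"
        by (rule DAP_segment[OF \<phi>(3,2)]) (use \<phi>(4) that in auto)
      then show ?thesis
        using diff F \<phi>(5) by simp
    qed
    have init: "\<phi> 0 \<in> fsem fi qi P"
      using test F \<phi>(5) by simp
    have const: "\<phi> 0 (Prime z) = 0" if "z \<in> set zs" for z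
      using zs that \<phi>(5) by (simp add: fsem_Constant)
    have "\<phi> T \<in> fsem fi qi P"
      by (rule flow_invariant[OF fi \<phi>(3) _ _ P(3) const P(1,2) subset_refl diff' init])
        (use \<phi>(1,2) in auto)
    then show "\<nu> \<in> fsem fi qi P"
      using \<phi>(6) by simp
  qed
  then show "\<mu> \<in> fsem fi qi (Box (DAP xs F) P)"
    by (simp del: psem.simps)
qed

lemma DR_sound:
  assumes "new_tuple ys xs" "no_free ys (fvf P \<union> fvf F)"
  shows "valid fi qi
          (Imp (Box (DAP xs F) P)
            (Foralls ys (Foralls (primes ys) (Box (DAP (xs @ ys) (And F G)) P))))"
  unfolding valid_def fsem_Imp fsem_Foralls_primes using Box_DAP_extend[OF assms] by blast

lemma map_of_zip_notin: "v \<notin> set us \<Longrightarrow> map_of (zip us ws) v = None"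
  by (auto simp: map_of_eq_None_iff dest: set_zip_leftD)

text \<open>Each ghost follows the value of its term along the given flow, which is analytic in
  time; its differential is then forced to be the time derivative. With this choice \<open>G\<close>
  at the ghosts is \<open>G\<close> at the terms \<open>hs\<close>, so the added constraint holds by
  the premise at all times.\<close>

lemma AG_sound:
  assumes fi: "analytic_interp fi" and G: "fo_arith G" and ys: "new_tuple ys xs"
    and len: "distinct us" "length us = length ys" "length hs = length ys"
    and free: "no_free ys (fvf P \<union> fvf F \<union> (fvf G - set us) \<union> (\<Union>h\<in>set hs. fvt h))"
  shows "valid fi qi
          (Imp (Box (DAP xs F) (apply_args us G hs))
            (Imp
              (Foralls ys (Foralls (primes ys)
                (Box (DAP (xs @ ys) (And F (apply_args us G (map Var ys)))) P)))
              (Box (DAP xs F) P)))"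
  unfolding valid_def fsem_Imp
proof (intro allI impI)
  fix \<mu> assume Gh: "\<mu> \<in> fsem fi qi (Box (DAP xs F) (apply_args us G hs))"
    and P: "\<mu> \<in> fsem fi qi (Foralls ys (Foralls (primes ys)
        (Box (DAP (xs @ ys) (And F (apply_args us G (map Var ys)))) P)))"
  have "\<nu> \<in> fsem fi qi P" if "(\<mu>, \<nu>) \<in> psem fi qi (DAP xs F)" for \<nu>
    using that
  proof (rule DAP_E)
    fix T \<epsilon> \<phi>
    assume \<phi>: "T \<ge> 0" "\<epsilon> > 0" "is_flow xs (- \<epsilon>) (T + \<epsilon>) \<phi>"
      "\<forall>t\<in>{0..T}. \<phi> t \<in> fsem fi qi F" "\<phi> 0 = \<mu>" "\<phi> T = \<nu>"
    define Y where "Y = (\<lambda>t y. eval fi (the (map_of (zip ys hs) y)) (\<phi> t))"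
    have Y_nth: "Y t (ys ! i) = eval fi (hs ! i) (\<phi> t)" if "i < length ys" for t i
      using that len(3) new_tupleD(1)[OF ys] by (simp add: Y_def map_of_zip_nth)
    \<comment> \<open>The time derivative itself, not the differential of the term: parameters of
      \<open>hs\<close> may have nonzero differentials.\<close>
    define Y' where "Y' = (\<lambda>t y. deriv (\<lambda>s. Y s y) t)"
    define \<psi> where "\<psi> = (\<lambda>t. extend_state ys (\<phi> t) (Y t) (Y' t))"
    have Y_ext: "\<exists>\<delta> G. real_ext (\<lambda>s. Y s y) t \<delta> G" if "- \<epsilon> < t" "t < T + \<epsilon>" for t y
      unfolding Y_def by (rule eval_flow_real_ext[OF fi \<phi>(3) that])
    have \<psi>_flow: "is_flow (xs @ ys) (- \<epsilon>) (T + \<epsilon>) \<psi>"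
      unfolding \<psi>_def
    proof (rule is_flow_extend[OF \<phi>(3) ys])
      show "real_analytic_on (\<lambda>t. Y t y) {- \<epsilon><..<T + \<epsilon>}" for y
        unfolding real_analytic_on_iff_real_ext using Y_ext by simp
      show "((\<lambda>s. Y s y) has_real_derivative Y' t y) (at t)" if t: "- \<epsilon> < t" "t < T + \<epsilon>" for y t
      proof -
        obtain \<delta> G where G: "real_ext (\<lambda>s. Y s y) t \<delta> G"
          using Y_ext[OF t] by blast
        then have "\<bar>t - t\<bar> < \<delta>"
          by (simp add: real_ext_def)
        from real_ext_has_derivative(1)[OF G this] show ?thesis
          unfolding Y'_def DERIV_deriv_iff_has_field_derivative by (rule exI)
      qed
    qed
    have other: "\<psi> t z = \<phi> t z" if "z \<notin> set ys" "z \<notin> Prime ` set ys" for t z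
      using that by (simp add: \<psi>_def extend_state_other)
    have \<psi>F: "\<psi> t \<in> fsem fi qi F" if "0 \<le> t" "t \<le> T" for t
    proof -
      have "\<psi> t \<in> fsem fi qi F \<longleftrightarrow> \<phi> t \<in> fsem fi qi F"
        by (rule fsem_coincidence, rule other) (use free in \<open>auto simp: no_free_def\<close>)
      then show ?thesis
        using \<phi>(4) that by simp
    qed
    have \<psi>G: "\<psi> t \<in> fsem fi qi (apply_args us G (map Var ys))" if t: "0 \<le> t" "t \<le> T" for t
    proof -
      have "(\<phi> 0, \<phi> t) \<in> psem fi qi (DAP xs F)"
        by (rule DAP_segment[OF \<phi>(3,2)]) (use \<phi>(4) t in auto)
      then have "\<phi> t \<in> fsem fi qi (apply_args us G hs)"
        using Gh \<phi>(5) by simp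
      moreover have "\<phi> t \<in> fsem fi qi (apply_args us G hs) \<longleftrightarrow>
          \<psi> t \<in> fsem fi qi (apply_args us G (map Var ys))"
        unfolding fsem_apply_args[OF G]
      proof (rule fsem_coincidence)
        fix v assume v: "v \<in> fvf G"
        show "(case map_of (zip us hs) v of None \<Rightarrow> \<phi> t v | Some h \<Rightarrow> eval fi h (\<phi> t)) =
            (case map_of (zip us (map Var ys)) v of None \<Rightarrow> \<psi> t v | Some h \<Rightarrow> eval fi h (\<psi> t))"
        proof (cases "v \<in> set us")
          case True
          then obtain i where i: "i < length us" "v = us ! i"
            by (metis in_set_conv_nth)
          then have "map_of (zip us hs) v = Some (hs ! i)"
              "(case map_of (zip us (map Var ys)) v of None \<Rightarrow> \<psi> t v | Some h \<Rightarrow> eval fi h (\<psi> t)) =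
                \<psi> t (ys ! i)"
            using len by (simp_all add: map_of_zip_nth)
          moreover have "\<psi> t (ys ! i) = eval fi (hs ! i) (\<phi> t)"
            using i len by (simp add: \<psi>_def extend_state_var Y_nth)
          ultimately show ?thesis
            by simp
        next
          case False
          then have "v \<notin> set ys" "v \<notin> Prime ` set ys"
            using free v by (auto simp: no_free_def)
          with False show ?thesis
            using other[of v t] by (simp add: map_of_zip_notin)
        qed
      qed
      ultimately show ?thesis
        by simp
    qed
    \<comment> \<open>The quantified ghosts are instantiated by the initial values and initial
      derivatives of \<open>Y\<close>.\<close>
    have "\<psi> 0 \<in> fsem fi qi (Box (DAP (xs @ ys) (And F (apply_args us G (map Var ys)))) P)"
      using P other[of _ 0] \<phi>(5) unfolding fsem_Foralls_primes by blast
    moreover have "(\<psi> 0, \<psi> T) \<in> psem fi qi (DAP (xs @ ys) (And F (apply_args us G (map Var ys))))"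
      by (rule DAP_I[OF \<phi>(1,2) \<psi>_flow]) (use \<psi>F \<psi>G in auto)
    ultimately have "\<psi> T \<in> fsem fi qi P"
      by simp
    moreover have "\<psi> T \<in> fsem fi qi P \<longleftrightarrow> \<phi> T \<in> fsem fi qi P"
      by (rule fsem_coincidence, rule other) (use free in \<open>auto simp: no_free_def\<close>)
    ultimately show "\<nu> \<in> fsem fi qi P"
      using \<phi>(6) by simp
  qed
  then show "\<mu> \<in> fsem fi qi (Box (DAP xs F) P)"
    by (simp del: psem.simps)
qed

subsection \<open>Analytic ordinary differential equations\<close>

definition upd_on :: "'x set \<Rightarrow> ('x \<Rightarrow> 'a) \<Rightarrow> ('x \<Rightarrow> 'a) \<Rightarrow> 'x \<Rightarrow> 'a" where
  "upd_on Y s v = (\<lambda>x. if x \<in> Y then v x else s x)"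

text \<open>\<open>\<sigma>\<close> carries all other variables, among them those of a flow, which
  depend on time. Local complex extendability belongs to the notion because the ghost components of
  a flow have to be analytic.\<close>

definition solves_at ::
  "'x set \<Rightarrow> ('x \<Rightarrow> ('x \<Rightarrow> real) \<Rightarrow> real) \<Rightarrow> (real \<Rightarrow> 'x \<Rightarrow> real) \<Rightarrow> (real \<Rightarrow> 'x \<Rightarrow> real) \<Rightarrow> real \<Rightarrow> bool" where
  "solves_at Y g \<sigma> v t \<longleftrightarrow> (\<forall>y\<in>Y. (\<exists>\<delta> G. real_ext (\<lambda>s. v s y) t \<delta> G) \<and>
     ((\<lambda>s. v s y) has_real_derivative g y (upd_on Y (\<sigma> t) (v t))) (at t))"

lemma solves_at_cong:
  assumes "solves_at Y g \<sigma> v t" "d > 0" "\<And>s y. \<bar>s - t\<bar> < d \<Longrightarrow> y \<in> Y \<Longrightarrow> v s y = w s y"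
  shows "solves_at Y g \<sigma> w t"
  unfolding solves_at_def
proof (intro ballI conjI)
  fix y assume y: "y \<in> Y"
  then obtain \<delta> G where "real_ext (\<lambda>s. v s y) t \<delta> G"
    using assms(1) by (auto simp: solves_at_def)
  then show "\<exists>\<delta> G. real_ext (\<lambda>s. w s y) t \<delta> G"
    using real_ext_cong_near[OF _ assms(2), of "\<lambda>s. v s y" t \<delta> G "\<lambda>s. w s y"] assms(3) y by blast
  have "upd_on Y (\<sigma> t) (v t) = upd_on Y (\<sigma> t) (w t)"
    using assms(2,3) by (auto simp: upd_on_def)
  moreover have "((\<lambda>s. v s y) has_real_derivative g y (upd_on Y (\<sigma> t) (v t))) (at t)"
    using assms(1) y by (auto simp: solves_at_def)
  then have "((\<lambda>s. w s y) has_real_derivative g y (upd_on Y (\<sigma> t) (v t))) (at t)"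
  proof (rule has_field_derivative_transform_within_open)
    show "open {t - d<..<t + d}" "t \<in> {t - d<..<t + d}"
      using assms(2) by auto
    show "v s y = w s y" if "s \<in> {t - d<..<t + d}" for s
      by (rule assms(3)) (use that y in auto)
  qed
  ultimately show "((\<lambda>s. w s y) has_real_derivative g y (upd_on Y (\<sigma> t) (w t))) (at t)"
    by simp
qed

lemma cext_mono_bound: "cext f s r B E \<Longrightarrow> B \<le> B' \<Longrightarrow> cext f s r B' E"
  unfolding cext_def by (meson order_trans)

lemma cext_finite_family:
  assumes "finite Y" "\<And>y. y \<in> Y \<Longrightarrow> analytic_fun (g y)"
  shows "\<exists>r B E. r > 0 \<and> B \<ge> 0 \<and> (\<forall>y\<in>Y. cext (g y) s r B (E y))"
  using assms
proof (induction Y rule: finite_induct)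
  case empty
  then show ?case
    by (intro exI[of _ 1]) auto
next
  case (insert y Y)
  then obtain r B E where *: "r > 0" "B \<ge> 0" "\<forall>y\<in>Y. cext (g y) s r B (E y)"
    by auto
  have "analytic_fun (g y)"
    using insert.prems by simp
  then obtain r' B' E' where **: "cext (g y) s r' B' E'"
    by (rule analytic_funE)
  have "r' > 0"
    using cextD(1)[OF **] .
  define E2 where "E2 = E(y := E')"
  have "cext (g x) s (min r r') (max B B') (E2 x)" if "x \<in> insert y Y" for x
  proof (cases "x = y")
    case True
    then show ?thesis
      using cext_mono_bound[OF cext_mono[OF **]] \<open>r' > 0\<close> *(1) by (simp add: E2_def)
  next
    case False
    then show ?thesis
      using cext_mono_bound[OF cext_mono[OF *(3)[rule_format]]] \<open>r' > 0\<close> *(1) that by (simp add: E2_def)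
  qed
  then show ?case
    using *(1,2) \<open>r' > 0\<close> by (intro exI[of _ "min r r'"] exI[of _ "max B B'"] exI[of _ E2]) auto
qed

section \<open>Local uniqueness of solutions\<close>

lemma cext_Lipschitz_real:
  assumes E: "cext f s r B E" and u: "\<And>x. \<bar>u x - s x\<bar> < r/4" "\<And>x. \<bar>w x - s x\<bar> < r/4"
    and d: "\<And>x. \<bar>u x - w x\<bar> \<le> d" "d \<le> r / 2"
  shows "\<bar>f u - f w\<bar> \<le> 6 * B / r * d"
proof -
  have n: "cnear s (r/4) (\<lambda>x. of_real (u x))" "cnear s (r/4) (\<lambda>x. of_real (w x))"
    unfolding cnear_of_real using u by auto
  have "cmod (E (\<lambda>x. of_real (u x)) - E (\<lambda>x. of_real (w x))) \<le> 6 * B / r * d"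
  proof (rule cext_Lipschitz[OF E n _ d(2)])
    show "cmod (complex_of_real (u x) - complex_of_real (w x)) \<le> d" for x
      using d(1) by (metis norm_of_real of_real_diff)
  qed
  moreover have "r / 4 \<le> r"
    using cextD(1)[OF E] by simp
  then have "E (\<lambda>x. of_real (u x)) = of_real (f u)" "E (\<lambda>x. of_real (w x)) = of_real (f w)"
    using n cnear_mono by (blast intro: cextD(4)[OF E])+
  ultimately show ?thesis
    by (metis norm_of_real of_real_diff)
qed

lemma real_ext_isCont: "real_ext g t \<delta> G \<Longrightarrow> isCont g t"
  using real_ext_has_derivative(1)[of g t \<delta> G t] DERIV_isCont by (auto simp: real_ext_def)

lemma half_power_bound_imp_zero:
  assumes "\<And>n. \<bar>u\<bar> \<le> c * (1/2) ^ n"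
  shows "u = (0::real)"
proof -
  have "(\<lambda>n. c * (1/2) ^ n) \<longlonglongrightarrow> c * 0"
    by (intro tendsto_mult LIMSEQ_realpow_zero tendsto_const) auto
  then have "\<bar>u\<bar> \<le> c * 0"
    using assms by (intro LIMSEQ_le_const) auto
  then show ?thesis
    by simp
qed

text \<open>Picard contraction applied to the difference of two solutions: on an interval that is
  short relative to the Lipschitz constant the bound halves with every integration, so the
  difference is 0. The first bound \<open>r/2\<close> comes from both solutions being within
  \<open>r/4\<close> of the common initial value.\<close>

lemma solves_at_unique:
  assumes Y: "finite Y" "\<And>y. y \<in> Y \<Longrightarrow> analytic_fun (g y)"
    and \<sigma>: "curve_ext \<sigma> t0 \<delta> \<Sigma>" and ab: "a < t0" "t0 < b"
    and v: "\<And>t. a < t \<Longrightarrow> t < b \<Longrightarrow> solves_at Y g \<sigma> v t"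
    and w: "\<And>t. a < t \<Longrightarrow> t < b \<Longrightarrow> solves_at Y g \<sigma> w t"
    and init: "\<And>y. y \<in> Y \<Longrightarrow> v t0 y = w t0 y"
  shows "\<exists>d>0. \<forall>t. \<bar>t - t0\<bar> < d \<longrightarrow> (\<forall>y\<in>Y. v t y = w t y)"
proof -
  define s where "s = upd_on Y (\<sigma> t0) (v t0)"
  obtain r B E where r: "r > 0" "B \<ge> 0" and E': "\<forall>y\<in>Y. cext (g y) s r B (E y)"
    using cext_finite_family[of Y g s] Y by blast
  note E = E'[rule_format]
  have "r / 4 > 0"
    using r by simp
  then obtain d1 where d1: "d1 > 0" "d1 \<le> \<delta>" "\<And>z. z \<in> ball (of_real t0) d1 \<Longrightarrow> cnear (\<sigma> t0) (r/4) (\<Sigma> z)"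
    using curve_ext_near[OF \<sigma>] by blast
  have \<sigma>near: "\<bar>\<sigma> t x - \<sigma> t0 x\<bar> < r/4" if "\<bar>t - t0\<bar> < d1" for t x
  proof -
    have "\<Sigma> (of_real t) = (\<lambda>x. of_real (\<sigma> t x))"
      using \<sigma> that d1(2) by (auto simp: curve_ext_def real_ext_def)
    then show ?thesis
      using d1(3)[of "of_real t"] that unfolding of_real_in_ball by (simp add: cnear_of_real)
  qed
  have cont: "eventually (\<lambda>t. \<bar>u t y - u t0 y\<bar> < r/4) (nhds t0)" if u: "y \<in> Y" "solves_at Y g \<sigma> u t0" for y u
  proof -
    obtain \<delta> G where "real_ext (\<lambda>t. u t y) t0 \<delta> G"
      using u by (auto simp: solves_at_def)
    then have "isCont (\<lambda>t. u t y) t0"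
      by (rule real_ext_isCont)
    then have "((\<lambda>t. u t y) \<longlongrightarrow> u t0 y) (nhds t0)"
      unfolding isCont_def using tendsto_at_iff_tendsto_nhds[of "\<lambda>t. u t y" t0] by simp
    from tendstoD[OF this \<open>r / 4 > 0\<close>] show ?thesis
      by (simp only: dist_real_def)
  qed
  have "eventually (\<lambda>t. \<forall>y\<in>Y. \<bar>v t y - v t0 y\<bar> < r/4 \<and> \<bar>w t y - w t0 y\<bar> < r/4) (nhds t0)"
    using Y(1) cont v[OF ab] w[OF ab] by (auto intro!: eventually_ball_finite eventually_conj)
  then obtain d2 where d2: "d2 > 0"
    "\<And>t y. \<bar>t - t0\<bar> < d2 \<Longrightarrow> y \<in> Y \<Longrightarrow> \<bar>v t y - v t0 y\<bar> < r/4 \<and> \<bar>w t y - w t0 y\<bar> < r/4"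
    unfolding eventually_nhds_metric dist_real_def by blast
  define L where "L = 6 * B / r"
  have L: "L \<ge> 0"
    using r by (simp add: L_def)
  \<comment> \<open>The last entry gives the contraction factor \<open>L * d \<le> 1/2\<close>; the
    others keep \<open>\<sigma>\<close>, \<open>v\<close> and \<open>w\<close> within
    \<open>r/4\<close> of the base point and the time inside the interval of existence.\<close>
  define d where "d = Min {d1, d2, t0 - a, b - t0, 1 / (2 * L + 1)}"
  have d: "d > 0" "d \<le> d1" "d \<le> d2" "d \<le> t0 - a" "d \<le> b - t0" "d \<le> 1 / (2 * L + 1)"
    using d1 d2 ab L by (auto simp: d_def)
  have Ld: "L * d \<le> 1/2"
  proof -
    have "L * d \<le> L * (1 / (2 * L + 1))"
      using L d by (intro mult_left_mono) auto
    also have "\<dots> \<le> 1/2"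
      using L by (simp add: field_simps)
    finally show ?thesis .
  qed
  have near: "\<bar>upd_on Y (\<sigma> t) (u t) x - s x\<bar> < r/4" if "\<bar>t - t0\<bar> < d" "u = v \<or> u = w" for t x u
    using \<sigma>near[of t x] d2(2)[of t x] init[of x] that d by (auto simp: upd_on_def s_def)
  have bound: "\<bar>v t y - w t y\<bar> \<le> (r/2) * (1/2) ^ n" if "\<bar>t - t0\<bar> < d" "y \<in> Y" for n t y
    using that
  proof (induction n arbitrary: t y)
    case 0
    then have "\<bar>v t y - v t0 y\<bar> < r/4" "\<bar>w t y - w t0 y\<bar> < r/4" "v t0 y = w t0 y"
      using d2(2)[of t y] init[of y] d by auto
    then show ?case
      unfolding power_0 by linarith
  next
    case (Suc n)
    define I where "I = {t0 - d<..<t0 + d}"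
    have "norm ((v t y - w t y) - (v t0 y - w t0 y)) \<le> (L * ((r/2) * (1/2) ^ n)) * norm (t - t0)"
    proof (rule field_differentiable_bound[of I])
      fix x assume "x \<in> I"
      then have x: "\<bar>x - t0\<bar> < d"
        by (auto simp: I_def)
      then have "a < x" "x < b"
        using d by auto
      then show "((\<lambda>t. v t y - w t y) has_real_derivative
          g y (upd_on Y (\<sigma> x) (v x)) - g y (upd_on Y (\<sigma> x) (w x))) (at x within I)"
        using v[of x] w[of x] Suc.prems(2) unfolding solves_at_def
        by (intro has_field_derivative_at_within[OF DERIV_diff]) auto
      have "\<bar>g y (upd_on Y (\<sigma> x) (v x)) - g y (upd_on Y (\<sigma> x) (w x))\<bar> \<le> 6 * B / r * ((r/2) * (1/2) ^ n)"
      proof (rule cext_Lipschitz_real[OF E[OF Suc.prems(2)]])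
        show "\<bar>upd_on Y (\<sigma> x) (v x) z - s z\<bar> < r/4" "\<bar>upd_on Y (\<sigma> x) (w x) z - s z\<bar> < r/4" for z
          using near[OF x] by auto
        show "\<bar>upd_on Y (\<sigma> x) (v x) z - upd_on Y (\<sigma> x) (w x) z\<bar> \<le> (r/2) * (1/2) ^ n" for z
          using Suc.IH[OF x, of z] r by (auto simp: upd_on_def)
        show "(r/2) * (1/2) ^ n \<le> r/2"
          using r by (simp add: power_le_one)
      qed
      then show "norm (g y (upd_on Y (\<sigma> x) (v x)) - g y (upd_on Y (\<sigma> x) (w x))) \<le> L * ((r/2) * (1/2) ^ n)"
        by (simp add: L_def)
    qed (use Suc.prems d(1) in \<open>auto simp: I_def\<close>)
    then have "\<bar>v t y - w t y\<bar> \<le> (L * ((r/2) * (1/2) ^ n)) * \<bar>t - t0\<bar>"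
      using init[OF Suc.prems(2)] by simp
    also have "\<dots> \<le> (L * ((r/2) * (1/2) ^ n)) * d"
      using Suc.prems L r by (intro mult_left_mono) auto
    also have "\<dots> = (L * d) * ((r/2) * (1/2) ^ n)"
      by (simp add: algebra_simps)
    also have "\<dots> \<le> 1/2 * ((r/2) * (1/2) ^ n)"
      using Ld r by (intro mult_right_mono) auto
    finally show ?case
      by (simp add: algebra_simps)
  qed
  have "v t y = w t y" if "\<bar>t - t0\<bar> < d" "y \<in> Y" for t y
    using half_power_bound_imp_zero[of "v t y - w t y" "r/2"] bound[OF that] by simp
  with d(1) show ?thesis
    by blast
qed

text \<open>The radius \<open>d\<close> serves all initial times near \<open>\<tau>\<close> and all
  initial values near \<open>p\<close>. This uniformity lets a solution be restarted shortly before
  a limit time and carried past it. The iteration runs in a complex disc because uniform limits of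
  holomorphic functions are holomorphic, so analyticity of the solution comes with its
  construction.\<close>

lemma solves_at_local:
  assumes Y: "finite Y" "\<And>y. y \<in> Y \<Longrightarrow> analytic_fun (g y)" and \<sigma>: "curve_ext \<sigma> \<tau> \<delta> \<Sigma>"
  shows "\<exists>d>0. \<forall>t0 v0. \<bar>t0 - \<tau>\<bar> < d \<longrightarrow> (\<forall>y\<in>Y. \<bar>v0 y - p y\<bar> < d) \<longrightarrow>
           (\<exists>v. (\<forall>t. \<bar>t - t0\<bar> < d \<longrightarrow> solves_at Y g \<sigma> v t) \<and> (\<forall>y\<in>Y. v t0 y = v0 y))"
proof -
  define s where "s = upd_on Y (\<sigma> \<tau>) p"
  obtain r B E where r: "r > 0" "B \<ge> 0" and E': "\<forall>y\<in>Y. cext (g y) s r B (E y)"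
    using cext_finite_family[of Y g s] Y by blast
  note E = E'[rule_format]
  have "r / 4 > 0"
    using r by simp
  then obtain d1 where d1: "d1 > 0" "d1 \<le> \<delta>" "\<And>z. z \<in> ball (of_real \<tau>) d1 \<Longrightarrow> cnear (\<sigma> \<tau>) (r/4) (\<Sigma> z)"
    using curve_ext_near[OF \<sigma>] by blast
  define L where "L = 6 * B / r"
  have L: "L \<ge> 0"
    using r by (simp add: L_def)
  \<comment> \<open>The disc of radius \<open>d\<close> about \<open>t0\<close> lies in the disc of
    radius \<open>2 * d\<close> about \<open>\<tau>\<close>, hence in that of radius
    \<open>d1\<close>. Initial values are off by at most \<open>r/16\<close>, and
    \<open>B * d \<le> r/16\<close> bounds the drift of an iterate, so arguments stay within
    \<open>r/4\<close> of \<open>s\<close>. The last entry gives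
    \<open>L * d \<le> 1/2\<close>.\<close>
  define d where "d = Min {d1 / 2, r / 16, r / (16 * B + 1) / 16, 1 / (2 * L + 1)}"
  have d_le: "d \<le> x" if "x \<in> {d1 / 2, r / 16, r / (16 * B + 1) / 16, 1 / (2 * L + 1)}" for x
    unfolding d_def using that by (intro Min_le) auto
  have "d > 0"
    using d1 r L by (auto simp: d_def)
  then have d: "d > 0" "2 * d \<le> d1" "d \<le> r / 16" "d \<le> r / (16 * B + 1) / 16" "d \<le> 1 / (2 * L + 1)"
    using d_le[of "d1 / 2"] d_le[of "r / 16"] d_le[of "r / (16 * B + 1) / 16"] d_le[of "1 / (2 * L + 1)"]
    by auto
  have Ld: "L * d \<le> 1/2"
  proof -
    have "L * d \<le> L * (1 / (2 * L + 1))"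
      using L d by (intro mult_left_mono) auto
    also have "\<dots> \<le> 1/2"
      using L by (simp add: field_simps)
    finally show ?thesis .
  qed
  have Bd: "B * d \<le> r / 16"
  proof -
    have "B * d \<le> B * (r / (16 * B + 1) / 16)"
      using r d by (intro mult_left_mono) auto
    also have "\<dots> = (B / (16 * B + 1)) * (r / 16)"
      by simp
    also have "\<dots> \<le> 1 * (r / 16)"
      using r by (intro mult_right_mono) auto
    finally show ?thesis
      by simp
  qed
  have "\<exists>v. (\<forall>t. \<bar>t - t0\<bar> < d \<longrightarrow> solves_at Y g \<sigma> v t) \<and> (\<forall>y\<in>Y. v t0 y = v0 y)"
    if t0: "\<bar>t0 - \<tau>\<bar> < d" and v0: "\<And>y. y \<in> Y \<Longrightarrow> \<bar>v0 y - p y\<bar> < d" for t0 v0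
  proof -
    define D where "D = ball (complex_of_real t0) d"
    have D: "convex D" "open D" "of_real t0 \<in> D"
      using d by (auto simp: D_def)
    have D_sub: "D \<subseteq> ball (of_real \<tau>) d1"
    proof
      fix z assume "z \<in> D"
      then have "dist (of_real \<tau>) z < 2 * d"
        using dist_triangle[of "of_real \<tau>" z "complex_of_real t0"] t0
        by (simp add: D_def dist_real_def abs_minus_commute)
      then show "z \<in> ball (of_real \<tau>) d1"
        using d(2) by simp
    qed
    have D_dist: "cmod (z - of_real t0) < d" if "z \<in> D" for z
      using that by (simp add: D_def dist_norm norm_minus_commute)
    have D_real: "of_real t \<in> D \<longleftrightarrow> \<bar>t - t0\<bar> < d" for t
      unfolding D_def by (rule of_real_in_ball)
    have \<Sigma>near: "cnear (\<sigma> \<tau>) (r/4) (\<Sigma> z)" if "z \<in> D" for z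
      using d1(3) D_sub that by blast
    have \<Sigma>hol: "(\<lambda>z. \<Sigma> z x) holomorphic_on D" for x
    proof -
      have "(\<lambda>z. \<Sigma> z x) holomorphic_on ball (of_real \<tau>) \<delta>"
        using \<sigma> by (simp add: curve_ext_def real_ext_def)
      moreover have "ball (complex_of_real \<tau>) d1 \<subseteq> ball (of_real \<tau>) \<delta>"
        using d1(2) by (rule subset_ball)
      ultimately show ?thesis
        using D_sub by (blast intro: holomorphic_on_subset)
    qed
    have \<Sigma>real: "\<Sigma> (of_real t) = (\<lambda>x. of_real (\<sigma> t x))" if "\<bar>t - t0\<bar> < d" for t
    proof -
      have "\<bar>t - \<tau>\<bar> < \<delta>"
        using that t0 d(2) d1(2) by linarith
      then show ?thesis
        using \<sigma> by (auto simp: curve_ext_def real_ext_def)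
    qed
    \<comment> \<open>Invariant of the iteration. Vanishing imaginary parts at real times are
      included because \<open>E\<close> is tied to \<open>g\<close> at real arguments only.\<close>
    define good where "good = (\<lambda>W. \<forall>y\<in>Y. (\<lambda>z. W z y) holomorphic_on D \<and>
       (\<forall>z\<in>D. cmod (W z y - of_real (v0 y)) \<le> r/16) \<and> (\<forall>t. \<bar>t - t0\<bar> < d \<longrightarrow> Im (W (of_real t) y) = 0))"
    define f where "f = (\<lambda>W y z. E y (upd_on Y (\<Sigma> z) (W z)))"
    have near: "cnear s (r/4) (upd_on Y (\<Sigma> z) (W z))"
      if "\<And>y. y \<in> Y \<Longrightarrow> cmod (W z y - of_real (v0 y)) \<le> r/16" "z \<in> D" for W z
      unfolding cnear_def
    proof
      fix x
      show "cmod (upd_on Y (\<Sigma> z) (W z) x - of_real (s x)) < r / 4"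
      proof (cases "x \<in> Y")
        case True
        have "cmod (W z x - of_real (p x)) \<le> cmod (W z x - of_real (v0 x)) + cmod (of_real (v0 x) - of_real (p x))"
          using norm_triangle_ineq[of "W z x - of_real (v0 x)" "of_real (v0 x) - of_real (p x)"] by simp
        also have "cmod (of_real (v0 x) - of_real (p x)) = \<bar>v0 x - p x\<bar>"
          by (metis norm_of_real of_real_diff)
        finally show ?thesis
          using that(1)[OF True] v0[OF True] d(3) r True by (simp add: upd_on_def s_def)
      next
        case False
        then show ?thesis
          using \<Sigma>near[OF that(2)] by (simp add: upd_on_def s_def cnear_def)
      qed
    qed
    have good_near: "cnear s (r/4) (upd_on Y (\<Sigma> z) (W z))" if "good W" "z \<in> D" for W z
      by (rule near) (use that in \<open>auto simp: good_def\<close>)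
    have r4: "r / 4 \<le> r"
      using r by simp
    have f_hol: "f W y holomorphic_on D" if "good W" "y \<in> Y" for W y
      unfolding f_def
    proof (rule cextD(2)[OF E[OF that(2)] D(2)])
      show "cnear s r (upd_on Y (\<Sigma> z) (W z))" if "z \<in> D" for z
        using cnear_mono[OF good_near[OF \<open>good W\<close> that] r4] .
      show "(\<lambda>z. upd_on Y (\<Sigma> z) (W z) x) holomorphic_on D" for x
        using that(1) \<Sigma>hol by (cases "x \<in> Y") (auto simp: upd_on_def good_def)
    qed
    have f_bound: "cmod (f W y z) \<le> B" if "good W" "y \<in> Y" "z \<in> D" for W y z
      unfolding f_def using cextD(3)[OF E[OF that(2)] cnear_mono[OF good_near[OF that(1,3)] r4]] .
    have f_real: "f W y (of_real t) = of_real (g y (upd_on Y (\<sigma> t) (\<lambda>x. Re (W (of_real t) x))))"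
      if "\<And>z y. z \<in> D \<Longrightarrow> y \<in> Y \<Longrightarrow> cmod (W z y - of_real (v0 y)) \<le> r/16"
        "\<And>y. y \<in> Y \<Longrightarrow> Im (W (of_real t) y) = 0" "y \<in> Y" "\<bar>t - t0\<bar> < d" for W y t
    proof -
      have eq: "upd_on Y (\<Sigma> (of_real t)) (W (of_real t)) =
          (\<lambda>x. of_real (upd_on Y (\<sigma> t) (\<lambda>x. Re (W (of_real t) x)) x))"
        using \<Sigma>real[OF that(4)] that(2) by (auto simp: upd_on_def fun_eq_iff complex_eq_iff)
      have "cnear s r (upd_on Y (\<Sigma> (of_real t)) (W (of_real t)))"
        using cnear_mono[OF near r4, of W "of_real t"] that(1,4) D_real by blast
      then show ?thesis
        unfolding f_def eq by (rule cextD(4)[OF E[OF that(3)]])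
    qed
    \<comment> \<open>An antiderivative normalised to vanish at \<open>t0\<close>, in the role of
      the complex integral from \<open>t0\<close>; for holomorphic \<open>h\<close> it exists
      because the disc is convex.\<close>
    define prim where "prim = (\<lambda>h z. let F = (SOME F. \<forall>z\<in>D. (F has_field_derivative h z) (at z)) in F z - F (of_real t0) :: complex)"
    have prim: "(prim h has_field_derivative h z) (at z)" if h: "h holomorphic_on D" "z \<in> D" for h z
    proof -
      obtain F where "\<forall>z\<in>D. (F has_field_derivative h z) (at z within D)"
        by (rule holomorphic_convex_primitive'[OF D(1,2) h(1)]) blast
      then have "\<forall>z\<in>D. (F has_field_derivative h z) (at z)"
        using at_within_open[OF _ D(2)] by metis
      then have "\<forall>z\<in>D. ((SOME F. \<forall>z\<in>D. (F has_field_derivative h z) (at z)) has_field_derivative h z) (at z)"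
        by (rule someI[of "\<lambda>F. \<forall>z\<in>D. (F has_field_derivative h z) (at z)"])
      then show ?thesis
        unfolding prim_def Let_def using h(2) by (auto intro!: derivative_eq_intros)
    qed
    have prim0: "prim h (of_real t0) = 0" for h
      by (simp add: prim_def)
    define picard where "picard = (\<lambda>W z y. of_real (v0 y) + prim (f W y) z)"
    have picard_deriv: "((\<lambda>z. picard W z y) has_field_derivative f W y z) (at z)" if "good W" "y \<in> Y" "z \<in> D" for W y z
      unfolding picard_def using prim[OF f_hol[OF that(1,2)] that(3)] by (auto intro!: derivative_eq_intros)
    have picard_init: "picard W (of_real t0) y = of_real (v0 y)" for W y
      by (simp add: picard_def prim0)
    have picard_good: "good (picard W)" if W: "good W" for W
      unfolding good_def
    proof (intro ballI conjI allI impI)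
      fix y assume y: "y \<in> Y"
      show "(\<lambda>z. picard W z y) holomorphic_on D"
        using picard_deriv[OF W y] D(2) by (auto simp: holomorphic_on_open)
      show "cmod (picard W z y - of_real (v0 y)) \<le> r/16" if z: "z \<in> D" for z
      proof -
        have "cmod (picard W z y - picard W (of_real t0) y) \<le> B * cmod (z - of_real t0)"
          by (rule field_differentiable_bound[OF D(1)])
            (use picard_deriv[OF W y] f_bound[OF W y] z D(3) in \<open>auto intro: has_field_derivative_at_within\<close>)
        also have "\<dots> \<le> B * d"
          using r(2) D_dist[OF z] by (intro mult_left_mono) auto
        finally show ?thesis
          using Bd picard_init by simp
      qed
      fix t assume t: "\<bar>t - t0\<bar> < d"
      \<comment> \<open>Along the real axis the imaginary part of an iterate has derivative 0, and
        it vanishes at \<open>t0\<close>.\<close>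
      define I where "I = {t0 - d<..<t0 + d}"
      have "\<exists>c. \<forall>x\<in>I. Im (picard W (of_real x) y) = c"
      proof (rule has_field_derivative_zero_constant)
        show "((\<lambda>x. Im (picard W (of_real x) y)) has_real_derivative 0) (at x within I)" if "x \<in> I" for x
        proof -
          have x: "\<bar>x - t0\<bar> < d"
            using that by (auto simp: I_def)
          have "((\<lambda>z. picard W z y) has_field_derivative f W y (of_real x)) (at (of_real x))"
            using picard_deriv[OF W y] x D_real by blast
          then have "((\<lambda>x. Im (picard W (of_real x) y)) has_vector_derivative Im (f W y (of_real x))) (at x)"
            using has_vector_derivative_real_field
            by (intro bounded_linear.has_vector_derivative[OF bounded_linear_Im]) fastforce
          moreover have "Im (f W y (of_real x)) = 0"
            using f_real[of W x y] W x y by (auto simp: good_def)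
          ultimately show ?thesis
            by (simp add: has_real_derivative_iff_has_vector_derivative has_vector_derivative_at_within)
        qed
      qed (auto simp: I_def)
      then obtain c where c: "\<And>x. x \<in> I \<Longrightarrow> Im (picard W (of_real x) y) = c"
        by blast
      moreover have "t0 \<in> I" "t \<in> I"
        using d(1) t by (auto simp: I_def)
      ultimately show "Im (picard W (of_real t) y) = 0"
        using picard_init[of W y] by (metis Im_complex_of_real)
    qed
    define W where "W = (\<lambda>n. (picard ^^ n) (\<lambda>z y. of_real (v0 y)))"
    have W_Suc: "W (Suc n) = picard (W n)" for n
      by (simp add: W_def)
    have W_good: "good (W n)" for n
    proof (induction n)
      case 0
      show ?case
        using r by (auto simp: W_def good_def)
    qed (simp add: W_Suc picard_good)
    \<comment> \<open>Each round multiplies the difference of consecutive iterates by at most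
      \<open>L * d \<le> 1/2\<close>. The first difference is at most \<open>r/16\<close> because
      \<open>W (Suc 0)\<close> satisfies the invariant and \<open>W 0\<close> is the constant
      initial value.\<close>
    have step: "cmod (W (Suc n) z y - W n z y) \<le> (r/16) * (1/2) ^ n" if "z \<in> D" "y \<in> Y" for n z y
      using that
    proof (induction n arbitrary: z y)
      case 0
      have "good (W (Suc 0))"
        by (rule W_good)
      then show ?case
        using 0 by (simp add: good_def W_def)
    next
      case (Suc n)
      have "cmod ((picard (W (Suc n)) z y - picard (W n) z y) -
          (picard (W (Suc n)) (of_real t0) y - picard (W n) (of_real t0) y)) \<le>
          (L * ((r/16) * (1/2) ^ n)) * cmod (z - of_real t0)"
      proof (rule field_differentiable_bound[OF D(1)])
        fix w assume w: "w \<in> D"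
        show "((\<lambda>z. picard (W (Suc n)) z y - picard (W n) z y) has_field_derivative
            f (W (Suc n)) y w - f (W n) y w) (at w within D)"
          using picard_deriv[OF W_good Suc.prems(2) w]
          by (intro has_field_derivative_at_within[OF DERIV_diff])
        have "cmod (f (W (Suc n)) y w - f (W n) y w) \<le> 6 * B / r * ((r/16) * (1/2) ^ n)"
          unfolding f_def
        proof (rule cext_Lipschitz[OF E[OF Suc.prems(2)] good_near[OF W_good w] good_near[OF W_good w]])
          show "cmod (upd_on Y (\<Sigma> w) (W (Suc n) w) x - upd_on Y (\<Sigma> w) (W n w) x) \<le> (r/16) * (1/2) ^ n" for x
            using Suc.IH[OF w, of x] r by (auto simp: upd_on_def)
          have "(r/16) * (1/2) ^ n \<le> (r/16) * 1"
            using r by (intro mult_left_mono power_le_one) auto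
          then show "(r/16) * (1/2) ^ n \<le> r / 2"
            using r by simp
        qed
        then show "cmod (f (W (Suc n)) y w - f (W n) y w) \<le> L * ((r/16) * (1/2) ^ n)"
          by (simp add: L_def)
      qed (use Suc.prems D(3) in auto)
      then have "cmod (W (Suc (Suc n)) z y - W (Suc n) z y) \<le> (L * ((r/16) * (1/2) ^ n)) * cmod (z - of_real t0)"
        by (simp add: picard_init W_Suc)
      also have "\<dots> \<le> (L * ((r/16) * (1/2) ^ n)) * d"
        using L r D_dist[OF Suc.prems(1)] by (intro mult_left_mono) auto
      also have "\<dots> = (L * d) * ((r/16) * (1/2) ^ n)"
        by (simp add: algebra_simps)
      also have "\<dots> \<le> 1/2 * ((r/16) * (1/2) ^ n)"
        using Ld r by (intro mult_right_mono) auto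
      finally show ?case
        by (simp add: algebra_simps)
    qed
    \<comment> \<open>The limit is written as a telescoping series so that the Weierstrass test
      gives uniform convergence on the whole disc.\<close>
    define V where "V = (\<lambda>z y. of_real (v0 y) + (\<Sum>n. W (Suc n) z y - W n z y))"
    have lim: "uniform_limit D (\<lambda>n z. W n z y) (\<lambda>z. V z y) sequentially" if "y \<in> Y" for y
    proof -
      have "uniform_limit D (\<lambda>n z. \<Sum>i<n. W (Suc i) z y - W i z y) (\<lambda>z. \<Sum>n. W (Suc n) z y - W n z y) sequentially"
        using step that
        by (intro Weierstrass_m_test[where M = "\<lambda>n. (r/16) * (1/2) ^ n"]) (auto intro!: summable_mult summable_geometric)
      then have "uniform_limit D (\<lambda>n z. of_real (v0 y) + (\<Sum>i<n. W (Suc i) z y - W i z y)) (\<lambda>z. V z y) sequentially"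
        unfolding V_def by (intro uniform_limit_add uniform_limit_const)
      moreover have "of_real (v0 y) + (\<Sum>i<n. W (Suc i) z y - W i z y) = W n z y" for n z
        by (subst sum_lessThan_telescope) (simp add: W_def)
      ultimately show ?thesis
        by simp
    qed
    have V_lim: "(\<lambda>n. W n z y) \<longlonglongrightarrow> V z y" if "z \<in> D" "y \<in> Y" for z y
      using tendsto_uniform_limitI[OF lim[OF that(2)] that(1)] .
    have V_bound: "cmod (V z y - of_real (v0 y)) \<le> r/16" if "z \<in> D" "y \<in> Y" for z y
    proof (rule Lim_bounded)
      show "(\<lambda>n. cmod (W n z y - of_real (v0 y))) \<longlonglongrightarrow> cmod (V z y - of_real (v0 y))"
        using V_lim[OF that] by (intro tendsto_intros)
      show "\<forall>n\<ge>0. cmod (W n z y - of_real (v0 y)) \<le> r/16"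
        using W_good that by (auto simp: good_def)
    qed
    have V_real: "Im (V (of_real t) y) = 0" if "\<bar>t - t0\<bar> < d" "y \<in> Y" for t y
    proof (rule LIMSEQ_unique)
      show "(\<lambda>n. Im (W n (of_real t) y)) \<longlonglongrightarrow> Im (V (of_real t) y)"
        using V_lim[of "of_real t" y] that D_real by (intro tendsto_intros) auto
      have "Im (W n (of_real t) y) = 0" for n
        using W_good that by (auto simp: good_def)
      then show "(\<lambda>n. Im (W n (of_real t) y)) \<longlonglongrightarrow> 0"
        by simp
    qed
    \<comment> \<open>The derivatives of the iterates converge in two ways: to the derivative of the
      uniform limit, and to \<open>f V\<close> by the Lipschitz bound. Uniqueness of limits gives
      the differential equation.\<close>
    have V_deriv: "((\<lambda>z. V z y) has_field_derivative f V y z) (at z)" if y: "y \<in> Y" and z: "z \<in> D" for y z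
    proof -
      have "\<exists>g'. \<forall>x\<in>D. ((\<lambda>z. V z y) has_field_derivative g' x) (at x) \<and> (\<lambda>n. f (W n) y x) \<longlonglongrightarrow> g' x"
      proof (rule has_complex_derivative_uniform_sequence[OF D(2)])
        show "((\<lambda>z. W (Suc n) z y) has_field_derivative f (W n) y x) (at x)" if "x \<in> D" for n x
          unfolding W_Suc by (rule picard_deriv[OF W_good y that])
        show "\<exists>e>0. cball x e \<subseteq> D \<and> uniform_limit (cball x e) (\<lambda>n z. W (Suc n) z y) (\<lambda>z. V z y) sequentially"
          if x: "x \<in> D" for x
        proof -
          obtain e where "e > 0" "cball x e \<subseteq> D"
            using D(2) x open_contains_cball by blast
          moreover have "uniform_limit D (\<lambda>n z. W (Suc n) z y) (\<lambda>z. V z y) sequentially"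
            by (rule filterlim_compose[OF lim[OF y] filterlim_Suc])
          ultimately show ?thesis
            using uniform_limit_on_subset by blast
        qed
      qed
      then obtain g' where g': "((\<lambda>z. V z y) has_field_derivative g') (at z)" "(\<lambda>n. f (W n) y z) \<longlonglongrightarrow> g'"
        using z by blast
      moreover have "(\<lambda>n. f (W n) y z) \<longlonglongrightarrow> f V y z"
      proof (rule tendstoI)
        fix e :: real assume e: "e > 0"
        define \<eta> where "\<eta> = min (r/2) (e / (2 * L + 1) / 2)"
        have \<eta>: "\<eta> > 0" "\<eta> \<le> r/2" "\<eta> \<le> e / (2 * L + 1) / 2"
          using min.cobounded1[of "r/2" "e / (2 * L + 1) / 2"] min.cobounded2[of "r/2" "e / (2 * L + 1) / 2"]
          unfolding \<eta>_def[symmetric] using e r L by (auto simp: \<eta>_def)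
        have "L * \<eta> \<le> L * (e / (2 * L + 1) / 2)"
          using L \<eta>(3) by (intro mult_left_mono)
        also have "\<dots> < e"
          using L e by (simp add: field_simps add_pos_nonneg)
        finally have L\<eta>: "L * \<eta> < e" .
        have "eventually (\<lambda>n. \<forall>x\<in>Y. cmod (W n z x - V z x) < \<eta>) sequentially"
          using Y(1) tendstoD[OF V_lim[OF z] \<eta>(1)] by (intro eventually_ball_finite) (auto simp: dist_norm)
        then show "eventually (\<lambda>n. dist (f (W n) y z) (f V y z) < e) sequentially"
        proof eventually_elim
          case (elim n)
          have "cmod (f (W n) y z - f V y z) \<le> 6 * B / r * \<eta>"
            unfolding f_def
          proof (rule cext_Lipschitz[OF E[OF y] good_near[OF W_good z] near[of V z, OF V_bound[OF z] z] _ \<eta>(2)])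
            show "cmod (upd_on Y (\<Sigma> z) (W n z) x - upd_on Y (\<Sigma> z) (V z) x) \<le> \<eta>" for x
              using elim \<eta>(1) by (auto simp: upd_on_def intro: less_imp_le)
          qed
          then show ?case
            using L\<eta> by (simp add: dist_norm L_def)
        qed
      qed
      ultimately show ?thesis
        using LIMSEQ_unique by blast
    qed
    define v where "v = (\<lambda>t y. Re (V (of_real t) y))"
    have v_ext: "real_ext (\<lambda>t. v t y) t0 d (\<lambda>z. V z y)" if y: "y \<in> Y" for y
      unfolding real_ext_def
    proof (intro conjI allI impI)
      show "(\<lambda>z. V z y) holomorphic_on ball (of_real t0) d"
        unfolding D_def[symmetric] holomorphic_on_open[OF D(2)] using V_deriv[OF y] by blast
      show "V (of_real t) y = of_real (v t y)" if "\<bar>t - t0\<bar> < d" for t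
        using V_real[OF that y] by (simp add: v_def complex_eq_iff)
    qed (rule d(1))
    have "solves_at Y g \<sigma> v t" if t: "\<bar>t - t0\<bar> < d" for t
      unfolding solves_at_def
    proof (intro ballI conjI)
      fix y assume y: "y \<in> Y"
      have "real_ext (\<lambda>t. v t y) t (d - \<bar>t - t0\<bar>) (\<lambda>z. V z y)"
        unfolding real_ext_def
      proof (intro conjI allI impI)
        have "ball (complex_of_real t) (d - \<bar>t - t0\<bar>) \<subseteq> ball (of_real t0) d"
          by (simp add: ball_subset_ball_iff dist_real_def)
        then show "(\<lambda>z. V z y) holomorphic_on ball (of_real t) (d - \<bar>t - t0\<bar>)"
          using v_ext[OF y] by (auto simp: real_ext_def intro: holomorphic_on_subset)
        show "V (of_real x) y = of_real (v x y)" if "\<bar>x - t\<bar> < d - \<bar>t - t0\<bar>" for x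
        proof -
          have "\<bar>x - t0\<bar> < d"
            using that by linarith
          then show ?thesis
            using v_ext[OF y] by (simp add: real_ext_def)
        qed
      qed (use t in simp)
      then show "\<exists>\<delta> G. real_ext (\<lambda>s. v s y) t \<delta> G"
        by blast
      have "deriv (\<lambda>z. V z y) (of_real t) = f V y (of_real t)"
        using V_deriv[OF y] t D_real DERIV_imp_deriv by blast
      also have "\<dots> = of_real (g y (upd_on Y (\<sigma> t) (v t)))"
        unfolding v_def by (rule f_real[of V t y, OF V_bound V_real[OF t] y t])
      finally show "((\<lambda>s. v s y) has_real_derivative g y (upd_on Y (\<sigma> t) (v t))) (at t)"
        using real_ext_has_derivative(1)[OF v_ext[OF y] t] by simp
    qed
    moreover have "v t0 y = v0 y" if "y \<in> Y" for y
    proof -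
      have "W n (of_real t0) y = of_real (v0 y)" for n
        by (cases n) (simp_all add: W_def picard_init)
      then have "(\<lambda>n. W n (of_real t0) y) \<longlonglongrightarrow> of_real (v0 y)"
        by simp
      then have "V (of_real t0) y = of_real (v0 y)"
        using V_lim[OF D(3) that] LIMSEQ_unique by blast
      then show ?thesis
        by (simp add: v_def)
    qed
    ultimately show ?thesis
      by (intro exI[of _ v]) auto
  qed
  with d(1) show ?thesis
    by (intro exI[of _ d]) auto
qed

section \<open>Continuation of solutions to the final time\<close>

lemma bounded_family_subsequence:
  fixes f :: "nat \<Rightarrow> 'x \<Rightarrow> real"
  assumes "finite Y" "\<And>n y. y \<in> Y \<Longrightarrow> \<bar>f n y\<bar> \<le> M"
  shows "\<exists>l r. strict_mono r \<and> (\<forall>y\<in>Y. (\<lambda>n. f (r n) y) \<longlonglongrightarrow> l y)"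
  using assms
proof (induction Y rule: finite_induct)
  case empty
  then show ?case
    using strict_mono_id by auto
next
  case (insert y Y)
  then obtain l r where r: "strict_mono r" "\<forall>y\<in>Y. (\<lambda>n. f (r n) y) \<longlonglongrightarrow> l y"
    by auto
  have "bounded (range (\<lambda>n. f (r n) y))"
    using insert.prems by (auto simp: bounded_iff)
  then obtain l' r' where r': "strict_mono r'" "((\<lambda>n. f (r n) y) \<circ> r') \<longlonglongrightarrow> l'"
    using bounded_imp_convergent_subsequence by blast
  have "(\<lambda>n. f ((r \<circ> r') n) x) \<longlonglongrightarrow> (l(y := l')) x" if "x \<in> insert y Y" for x
  proof (cases "x = y")
    case True
    then show ?thesis
      using r'(2) by (simp add: o_def)
  next
    case False
    then have "(\<lambda>n. f (r n) x) \<longlonglongrightarrow> l x"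
      using r(2) that by auto
    then show ?thesis
      using LIMSEQ_subseq_LIMSEQ[OF _ r'(1)] False by (auto simp: o_def)
  qed
  moreover have "strict_mono (r \<circ> r')"
    using r(1) r'(1) by (rule strict_mono_o)
  ultimately show ?case
    by blast
qed

text \<open>At the seam, matching values and derivatives alone would not make the glued function
  analytic. Uniqueness shows that \<open>v\<close> and \<open>w\<close> coincide around
  \<open>c\<close>, so near \<open>c\<close> the glued function is simply \<open>v\<close>.\<close>

lemma solves_at_glue:
  assumes Y: "finite Y" "\<And>y. y \<in> Y \<Longrightarrow> analytic_fun (g y)"
    and \<sigma>: "curve_ext \<sigma> c \<delta> \<Sigma>" and cc: "a < c" "a' < c" "c < b" "c < b'"
    and v: "\<And>t. a < t \<Longrightarrow> t < b \<Longrightarrow> solves_at Y g \<sigma> v t"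
    and w: "\<And>t. a' < t \<Longrightarrow> t < b' \<Longrightarrow> solves_at Y g \<sigma> w t"
    and eq: "\<And>y. y \<in> Y \<Longrightarrow> v c y = w c y"
  assumes t: "a < t" "t < b'"
  shows "solves_at Y g \<sigma> (\<lambda>s. if s \<le> c then v s else w s) t"
proof (cases t c rule: linorder_cases)
  case less
  show ?thesis
    by (rule solves_at_cong[OF v[of t], of "c - t"]) (use less t cc in auto)
next
  case greater
  show ?thesis
    by (rule solves_at_cong[OF w[of t], of "t - c"]) (use greater t cc in auto)
next
  case equal
  have v': "solves_at Y g \<sigma> v s" if "max a a' < s" "s < min b b'" for s
    using v that by simp
  have w': "solves_at Y g \<sigma> w s" if "max a a' < s" "s < min b b'" for s
    using w that by simp
  have "\<exists>d>0. \<forall>s. \<bar>s - c\<bar> < d \<longrightarrow> (\<forall>y\<in>Y. v s y = w s y)"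
    by (rule solves_at_unique[of Y g \<sigma> c \<delta> \<Sigma> "max a a'" "min b b'" v w, OF Y \<sigma> _ _ v' w' eq]) (use cc in auto)
  then obtain d where d: "d > 0" "\<And>s y. \<bar>s - c\<bar> < d \<Longrightarrow> y \<in> Y \<Longrightarrow> v s y = w s y"
    by blast
  show ?thesis
    by (rule solves_at_cong[OF v[of t] d(1)]) (use equal t cc d(2) in auto)
qed

text \<open>The bound concerns the value at the end time \<open>\<tau>\<close> of any solution
  reaching \<open>\<tau>\<close>, which is what box premises give. Solutions reaching times close to
  the supremum need not be related to each other: a convergent subsequence of their end values
  suffices, because local existence near the limit is uniform and carries one of them
  further.\<close>

lemma solves_at_global:
  assumes Y: "finite Y" "\<And>y. y \<in> Y \<Longrightarrow> analytic_fun (g y)" and T: "T \<ge> 0"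
    and \<sigma>: "\<And>t. 0 \<le> t \<Longrightarrow> t \<le> T \<Longrightarrow> \<exists>\<delta> \<Sigma>. curve_ext \<sigma> t \<delta> \<Sigma>"
    and bound: "\<And>\<tau> \<eta> v y. 0 \<le> \<tau> \<Longrightarrow> \<tau> \<le> T \<Longrightarrow> \<eta> > 0 \<Longrightarrow>
      (\<And>t. - \<eta> < t \<Longrightarrow> t < \<tau> + \<eta> \<Longrightarrow> solves_at Y g \<sigma> v t) \<Longrightarrow> (\<And>y. y \<in> Y \<Longrightarrow> v 0 y = v0 y) \<Longrightarrow>
      y \<in> Y \<Longrightarrow> \<bar>v \<tau> y\<bar> \<le> M"
  shows "\<exists>\<eta> v. \<eta> > 0 \<and> (\<forall>t. - \<eta> < t \<longrightarrow> t < T + \<eta> \<longrightarrow> solves_at Y g \<sigma> v t) \<and> (\<forall>y\<in>Y. v 0 y = v0 y)"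
proof -
  define sol where "sol = (\<lambda>\<tau> \<eta> v. \<eta> > 0 \<and> (\<forall>t. - \<eta> < t \<longrightarrow> t < \<tau> + \<eta> \<longrightarrow> solves_at Y g \<sigma> v t) \<and>
      (\<forall>y\<in>Y. v 0 y = v0 y))"
  define A where "A = {\<tau>. 0 \<le> \<tau> \<and> \<tau> \<le> T \<and> (\<exists>\<eta> v. sol \<tau> \<eta> v)}"
  have "0 \<in> A"
  proof -
    obtain \<delta> \<Sigma> where "curve_ext \<sigma> 0 \<delta> \<Sigma>"
      using \<sigma>[of 0] T by auto
    from solves_at_local[of Y g, OF Y this, where p = v0] obtain d where d: "d > 0"
      "\<And>t0 w. \<bar>t0 - 0\<bar> < d \<Longrightarrow> (\<forall>y\<in>Y. \<bar>w y - v0 y\<bar> < d) \<Longrightarrow>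
           (\<exists>v. (\<forall>t. \<bar>t - t0\<bar> < d \<longrightarrow> solves_at Y g \<sigma> v t) \<and> (\<forall>y\<in>Y. v t0 y = w y))"
      by blast
    obtain v where v: "\<forall>t. \<bar>t - 0\<bar> < d \<longrightarrow> solves_at Y g \<sigma> v t" "\<forall>y\<in>Y. v 0 y = v0 y"
      using d(2)[of 0 v0] d(1) by auto
    then have "sol 0 d v"
      unfolding sol_def using d(1) by auto
    then show ?thesis
      using T by (auto simp: A_def)
  qed
  define S where "S = Sup A"
  have A_bdd: "bdd_above A" "A \<noteq> {}"
    using \<open>0 \<in> A\<close> by (auto simp: A_def bdd_above_def)
  have S: "0 \<le> S" "S \<le> T"
    unfolding S_def using A_bdd \<open>0 \<in> A\<close> by (auto simp: A_def intro!: cSup_upper cSup_least)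
  have "\<exists>\<tau>\<in>A. S - 1 / real (Suc n) < \<tau>" for n
    using less_cSupD[OF A_bdd(2), of "S - 1 / real (Suc n)"] by (auto simp: S_def)
  then obtain \<tau> where \<tau>: "\<And>n. \<tau> n \<in> A" "\<And>n. S - 1 / real (Suc n) < \<tau> n"
    by metis
  then obtain \<eta> v where sol: "\<And>n. sol (\<tau> n) (\<eta> n) (v n)"
    unfolding A_def by simp metis
  have \<tau>S: "\<tau> n \<le> S" "0 \<le> \<tau> n" "\<tau> n \<le> T" for n
    using \<tau>(1)[of n] A_bdd by (auto simp: S_def A_def intro!: cSup_upper)
  have \<tau>_lim: "\<tau> \<longlonglongrightarrow> S"
  proof (rule tendsto_sandwich[of "\<lambda>n. S - 1 / real (Suc n)" _ _ "\<lambda>_. S"])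
    have "(\<lambda>n. S - 1 / real (Suc n)) \<longlonglongrightarrow> S - 0"
      using LIMSEQ_inverse_real_of_nat by (intro tendsto_diff tendsto_const) (simp add: inverse_eq_divide)
    then show "(\<lambda>n. S - 1 / real (Suc n)) \<longlonglongrightarrow> S"
      by simp
  qed (use \<tau>(2) \<tau>S(1) in \<open>auto intro!: always_eventually less_imp_le\<close>)
  have vM: "\<bar>v n (\<tau> n) y\<bar> \<le> M" if "y \<in> Y" for n y
    by (rule bound[OF \<tau>S(2,3)[of n], of "\<eta> n" "v n" y]) (use sol[of n] that in \<open>auto simp: sol_def\<close>)
  obtain l r where r: "strict_mono r" "\<forall>y\<in>Y. (\<lambda>n. v (r n) (\<tau> (r n)) y) \<longlonglongrightarrow> l y"
    using bounded_family_subsequence[of Y "\<lambda>n. v n (\<tau> n)" M] Y(1) vM by blast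
  obtain \<delta> \<Sigma> where "curve_ext \<sigma> S \<delta> \<Sigma>"
    using \<sigma>[OF S] by blast
  from solves_at_local[of Y g, OF Y this, where p = l] obtain d where d: "d > 0"
    "\<And>t0 w. \<bar>t0 - S\<bar> < d \<Longrightarrow> (\<forall>y\<in>Y. \<bar>w y - l y\<bar> < d) \<Longrightarrow>
         (\<exists>v. (\<forall>t. \<bar>t - t0\<bar> < d \<longrightarrow> solves_at Y g \<sigma> v t) \<and> (\<forall>y\<in>Y. v t0 y = w y))"
    by blast
  have "eventually (\<lambda>n. \<bar>\<tau> (r n) - S\<bar> < d / 2) sequentially"
    using LIMSEQ_subseq_LIMSEQ[OF \<tau>_lim r(1)] d(1) by (auto dest!: tendstoD[of _ _ _ "d / 2"] simp: dist_real_def)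
  moreover have "eventually (\<lambda>n. \<forall>y\<in>Y. \<bar>v (r n) (\<tau> (r n)) y - l y\<bar> < d) sequentially"
    using Y(1) r(2) d(1) by (intro eventually_ball_finite) (auto dest!: tendstoD[of _ _ _ d] simp: dist_real_def)
  ultimately have "eventually (\<lambda>n. \<bar>\<tau> (r n) - S\<bar> < d / 2 \<and> (\<forall>y\<in>Y. \<bar>v (r n) (\<tau> (r n)) y - l y\<bar> < d)) sequentially"
    by (rule eventually_conj)
  then obtain m where m: "\<bar>\<tau> (r m) - S\<bar> < d / 2" "\<forall>y\<in>Y. \<bar>v (r m) (\<tau> (r m)) y - l y\<bar> < d"
    by (auto simp: eventually_sequentially)
  define c where "c = \<tau> (r m)"
  have c: "0 \<le> c" "c \<le> T" "S - d / 2 < c" "\<bar>c - S\<bar> < d"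
    using m(1) \<tau>S[of "r m"] d(1) by (auto simp: c_def)
  obtain w where w: "\<And>t. \<bar>t - c\<bar> < d \<Longrightarrow> solves_at Y g \<sigma> w t" "\<And>y. y \<in> Y \<Longrightarrow> w c y = v (r m) c y"
    using d(2)[of c "v (r m) (\<tau> (r m))"] c(4) m(2) by (auto simp: c_def)
  have sol_m: "\<eta> (r m) > 0" "\<And>t. - \<eta> (r m) < t \<Longrightarrow> t < c + \<eta> (r m) \<Longrightarrow> solves_at Y g \<sigma> (v (r m)) t"
    "\<And>y. y \<in> Y \<Longrightarrow> v (r m) 0 y = v0 y"
    using sol[of "r m"] by (auto simp: sol_def c_def)
  obtain \<delta>' \<Sigma>' where \<Sigma>': "curve_ext \<sigma> c \<delta>' \<Sigma>'"
    using \<sigma>[OF c(1,2)] by blast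
  define u where "u = (\<lambda>s. if s \<le> c then v (r m) s else w s)"
  have u: "solves_at Y g \<sigma> u t" if "- \<eta> (r m) < t" "t < c + d" for t
    unfolding u_def
  proof (rule solves_at_glue[of Y g, OF Y \<Sigma>'])
    show "solves_at Y g \<sigma> (v (r m)) t" if "- \<eta> (r m) < t" "t < c + \<eta> (r m)" for t
      using that by (rule sol_m(2))
    show "solves_at Y g \<sigma> w t" if "c - d < t" "t < c + d" for t
      by (rule w(1)) (use that in auto)
  qed (use that w(2) sol_m(1) c(1) d(1) in auto)
  have u0: "\<forall>y\<in>Y. u 0 y = v0 y"
    using c(1) sol_m(3) by (simp add: u_def)
  \<comment> \<open>The extended solution exists up to \<open>c + d\<close>, which exceeds
    \<open>S + d / 2\<close>; the margin \<open>\<eta>' \<le> d / 4\<close> is reserved for the open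
    interval around the run. If \<open>\<tau>'\<close> were less than \<open>T\<close>, it would
    exceed \<open>S\<close>.\<close>
  define \<tau>' where "\<tau>' = min T (S + d / 4)"
  define \<eta>' where "\<eta>' = min (\<eta> (r m)) (d / 4)"
  have "sol \<tau>' \<eta>' u"
    unfolding sol_def
  proof (intro conjI allI impI)
    show "\<eta>' > 0"
      using sol_m(1) d(1) by (simp add: \<eta>'_def)
    show "solves_at Y g \<sigma> u t" if "- \<eta>' < t" "t < \<tau>' + \<eta>'" for t
    proof (rule u)
      show "- \<eta> (r m) < t"
        using that(1) by (simp add: \<eta>'_def)
      have "\<tau>' \<le> S + d / 4" "\<eta>' \<le> d / 4"
        unfolding \<tau>'_def \<eta>'_def by (rule min.cobounded2)+
      then show "t < c + d"
        using that(2) c(3) by linarith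
    qed
  qed (rule u0)
  moreover have "0 \<le> \<tau>'" "\<tau>' \<le> T"
    using S T d(1) by (auto simp: \<tau>'_def)
  ultimately have "\<tau>' \<in> A"
    by (auto simp: A_def)
  then have "\<tau>' \<le> S"
    unfolding S_def using A_bdd(1) by (rule cSup_upper)
  then have "\<tau>' = T"
    using d(1) by (auto simp: \<tau>'_def min_def split: if_splits)
  with \<open>sol \<tau>' \<eta>' u\<close> show ?thesis
    unfolding sol_def by blast
qed

text \<open>From \<open>2 * \<bar>a\<bar> \<le> a^2 + 1\<close>, which avoids square roots.\<close>

lemma sqnorm_bound:
  fixes v :: "'x \<Rightarrow> real"
  assumes "(\<Sum>y\<leftarrow>ys. (v y)\<^sup>2) \<le> M" "y \<in> set ys"
  shows "\<bar>v y\<bar> \<le> M + 1"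
proof -
  have "(v y)\<^sup>2 \<le> (\<Sum>y\<leftarrow>ys. (v y)\<^sup>2)"
    using assms(2)
  proof (induction ys)
    case (Cons a ys)
    have "0 \<le> (\<Sum>y\<leftarrow>ys. (v y)\<^sup>2)"
      by (rule sum_list_nonneg) auto
    with Cons show ?case
      by (cases "y = a") (auto intro: add_increasing)
  qed simp
  then have "(v y)\<^sup>2 \<le> M"
    using assms(1) by simp
  moreover have "2 * \<bar>v y\<bar> \<le> (v y)\<^sup>2 + 1"
    using sum_squares_bound[of "\<bar>v y\<bar>" 1] by simp
  moreover have "0 \<le> (v y)\<^sup>2"
    by simp
  ultimately show ?thesis
    by linarith
qed

text \<open>Only the passage from the extended system back to \<open>xs\<close> needs a solution of
  the ghost equation. Since \<open>h\<close> does not mention the ghosts, it is a continuous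
  function of time on \<open>[0, T]\<close>, bounded by some \<open>M\<close> that does not depend
  on the solution; the box premise applied to partial runs then bounds the ghosts.\<close>

lemma BDG_sound:
  fixes fi :: "'f \<Rightarrow> real list \<Rightarrow> real" and qi :: "'p \<Rightarrow> real list \<Rightarrow> bool"
    and F P :: "('v, 'f, 'p) fml"
  assumes fi: "analytic_interp fi" and ys: "new_tuple ys xs" and len: "length gs = length ys"
    and gs: "\<forall>g\<in>set gs. set (primes ys) \<inter> fvt g = {}" and free: "no_free ys (fvf P \<union> fvf F \<union> fvt h)"
  shows "valid fi qi
          (Imp (Eqs (map Var (primes ys)) gs)
            (Imp (Box (DAP (xs @ ys) (And F (Eqs (map Var (primes ys)) gs))) (Leq (sqnorm ys) h))
              (Iff
                (Box (DAP xs F) P)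
                (Box (DAP (xs @ ys) (And F (Eqs (map Var (primes ys)) gs))) P))))"
  unfolding valid_def fsem_Imp fsem_Iff
proof (intro allI impI iffI)
  let ?ode = "Eqs (map Var (primes ys)) gs :: ('v, 'f, 'p) fml"
  fix \<mu> assume init: "\<mu> \<in> fsem fi qi ?ode"
    and bnd: "\<mu> \<in> fsem fi qi (Box (DAP (xs @ ys) (And F ?ode)) (Leq (sqnorm ys) h))"
  have freePF: "no_free ys (fvf P \<union> fvf F)"
    using free by (auto simp: no_free_def)
  {
    assume "\<mu> \<in> fsem fi qi (Box (DAP xs F) P)"
    then show "\<mu> \<in> fsem fi qi (Box (DAP (xs @ ys) (And F ?ode)) P)"
      by (rule Box_DAP_extend[OF ys freePF]) simp
  }
  assume P: "\<mu> \<in> fsem fi qi (Box (DAP (xs @ ys) (And F ?ode)) P)"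
  note Dy = new_tupleD[OF ys]
  define g where "g = (\<lambda>y. eval fi (the (map_of (zip ys gs) y)))"
  have g_nth: "g (ys ! i) = eval fi (gs ! i)" if "i < length ys" for i
    using that len Dy(1) by (simp add: g_def map_of_zip_nth)
  have ode: "s \<in> fsem fi qi ?ode \<longleftrightarrow> (\<forall>y\<in>set ys. s (Prime y) = g y s)" for s
    using len g_nth by (simp add: fsem_Eqs_nth all_set_conv_all_nth)
  have g_agree: "g y s = g y s'" if y: "y \<in> set ys" and s: "\<And>z. z \<notin> Prime ` set ys \<Longrightarrow> s z = s' z" for y s s'
  proof -
    obtain i where i: "i < length ys" "y = ys ! i"
      using y by (metis in_set_conv_nth)
    have "eval fi (gs ! i) s = eval fi (gs ! i) s'"
      by (rule eval_coincidence, rule s) (use gs i len in \<open>auto simp: disjoint_iff\<close>)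
    then show ?thesis
      using i g_nth by simp
  qed
  have g_an: "analytic_fun (g y)" for y
    unfolding g_def by (rule analytic_fun_eval[OF fi])
  have "\<nu> \<in> fsem fi qi P" if "(\<mu>, \<nu>) \<in> psem fi qi (DAP xs F)" for \<nu>
    using that
  proof (rule DAP_E)
    fix T \<epsilon> \<phi>
    assume \<phi>: "T \<ge> 0" "\<epsilon> > 0" "is_flow xs (- \<epsilon>) (T + \<epsilon>) \<phi>"
      "\<forall>t\<in>{0..T}. \<phi> t \<in> fsem fi qi F" "\<phi> 0 = \<mu>" "\<phi> T = \<nu>"
    have \<phi>_ext: "\<exists>\<delta> \<Phi>. curve_ext \<phi> t \<delta> \<Phi>" if "0 \<le> t" "t \<le> T" for t
      by (rule is_flow_curve_ext[OF \<phi>(3)]) (use that \<phi>(2) in auto)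
    \<comment> \<open>\<open>upd_on\<close> leaves the ghost differentials of \<open>\<phi>\<close>
      in place, while \<open>\<psi>\<close> overwrites them. As no term of \<open>gs\<close>
      mentions a ghost differential, both states give the same right-hand side.\<close>
    define \<psi> where "\<psi> = (\<lambda>v t. extend_state ys (\<phi> t) (v t) (\<lambda>y. g y (upd_on (set ys) (\<phi> t) (v t))))"
    have other: "\<psi> v t z = \<phi> t z" if "z \<notin> set ys" "z \<notin> Prime ` set ys" for v t z
      using that by (simp add: \<psi>_def extend_state_other)
    \<comment> \<open>Stated for every \<open>\<tau> \<le> T\<close>, so that it feeds the a priori
      bound before a solution up to \<open>T\<close> is available.\<close>
    have run: "(\<mu>, \<psi> v \<tau>) \<in> psem fi qi (DAP (xs @ ys) (And F ?ode))"
      if \<tau>: "0 \<le> \<tau>" "\<tau> \<le> T" and \<eta>: "\<eta> > 0"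
        and sol: "\<And>t. - \<eta> < t \<Longrightarrow> t < \<tau> + \<eta> \<Longrightarrow> solves_at (set ys) g \<phi> v t"
        and v0: "\<And>y. y \<in> set ys \<Longrightarrow> v 0 y = \<mu> y" for \<tau> \<eta> v
    proof (rule DAP_I[OF \<tau>(1)])
      show "min \<epsilon> \<eta> > 0"
        using \<phi>(2) \<eta> by simp
      show "is_flow (xs @ ys) (- min \<epsilon> \<eta>) (\<tau> + min \<epsilon> \<eta>) (\<psi> v)"
        unfolding \<psi>_def
      proof (rule is_flow_extend[OF _ ys])
        show "is_flow xs (- min \<epsilon> \<eta>) (\<tau> + min \<epsilon> \<eta>) \<phi>"
          by (rule is_flow_restrict[OF \<phi>(3)]) (use \<tau> in auto)
        show "real_analytic_on (\<lambda>t. v t y) {- min \<epsilon> \<eta><..<\<tau> + min \<epsilon> \<eta>}" if "y \<in> set ys" for y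
          unfolding real_analytic_on_iff_real_ext using sol that by (auto simp: solves_at_def)
        show "((\<lambda>s. v s y) has_real_derivative g y (upd_on (set ys) (\<phi> t) (v t))) (at t)"
          if "y \<in> set ys" "- min \<epsilon> \<eta> < t" "t < \<tau> + min \<epsilon> \<eta>" for y t
          using sol[of t] that by (auto simp: solves_at_def)
      qed
      show "\<psi> v t \<in> fsem fi qi (And F ?ode)" if "0 \<le> t" "t \<le> \<tau>" for t
      proof -
        have "\<psi> v t \<in> fsem fi qi F \<longleftrightarrow> \<phi> t \<in> fsem fi qi F"
          by (rule fsem_coincidence, rule other) (use free in \<open>auto simp: no_free_def\<close>)
        moreover have "\<psi> v t (Prime y) = g y (\<psi> v t)" if "y \<in> set ys" for y
        proof -
          have "g y (upd_on (set ys) (\<phi> t) (v t)) = g y (\<psi> v t)"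
            by (rule g_agree[OF that]) (auto simp: \<psi>_def upd_on_def extend_state_var extend_state_other)
          then show ?thesis
            using that Dy(3) by (simp add: \<psi>_def extend_state_Prime)
        qed
        then have "\<psi> v t \<in> fsem fi qi ?ode"
          unfolding ode by blast
        moreover have "\<phi> t \<in> fsem fi qi F"
          using \<phi>(4) that \<tau>(2) by simp
        ultimately show ?thesis
          unfolding fsem.simps(3) by blast
      qed
      \<comment> \<open>Here the ghost equation in the initial state enters: it makes the
        differentials prescribed by \<open>g\<close> agree with those of
        \<open>\<mu>\<close>.\<close>
      show "\<psi> v 0 = \<mu>"
      proof
        fix z
        have "upd_on (set ys) \<mu> (v 0) = \<mu>"
          using v0 by (auto simp: upd_on_def)
        moreover have "\<mu> (Prime y) = g y \<mu>" if "y \<in> set ys" for y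
          using init that unfolding ode by blast
        ultimately show "\<psi> v 0 z = \<mu> z"
          using v0 \<phi>(5) by (auto simp: \<psi>_def extend_state_def split: var.split)
      qed
    qed simp
    have "continuous_on {0..T} (\<lambda>t. eval fi h (\<phi> t))"
    proof (rule continuous_at_imp_continuous_on, rule ballI)
      fix t assume t: "t \<in> {0..T}"
      then obtain \<delta> G where "real_ext (\<lambda>t. eval fi h (\<phi> t)) t \<delta> G"
        using eval_flow_real_ext[OF fi \<phi>(3), of t h] \<phi>(2) by auto
      then show "isCont (\<lambda>t. eval fi h (\<phi> t)) t"
        by (rule real_ext_isCont)
    qed
    then obtain M where M: "\<And>t. t \<in> {0..T} \<Longrightarrow> eval fi h (\<phi> t) \<le> M"
      using \<phi>(1) continuous_attains_sup[of "{0..T}"] by (metis atLeastatMost_empty_iff2 compact_Icc leD)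
    have "\<exists>\<eta> v. \<eta> > 0 \<and> (\<forall>t. - \<eta> < t \<longrightarrow> t < T + \<eta> \<longrightarrow> solves_at (set ys) g \<phi> v t) \<and> (\<forall>y\<in>set ys. v 0 y = \<mu> y)"
    proof (rule solves_at_global[where M = "M + 1"])
      fix \<tau> \<eta> v y
      assume \<tau>: "0 \<le> \<tau>" "\<tau> \<le> T" "\<eta> > 0"
        "\<And>t. - \<eta> < t \<Longrightarrow> t < \<tau> + \<eta> \<Longrightarrow> solves_at (set ys) g \<phi> v t" "\<And>y. y \<in> set ys \<Longrightarrow> v 0 y = \<mu> y"
        and y: "y \<in> set ys"
      have "\<psi> v \<tau> \<in> fsem fi qi (Leq (sqnorm ys) h)"
        using bnd run[OF \<tau>] by simp
      then have "(\<Sum>y\<leftarrow>ys. (\<psi> v \<tau> y)\<^sup>2) \<le> eval fi h (\<psi> v \<tau>)"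
        by (simp add: eval_sqnorm)
      also have "eval fi h (\<psi> v \<tau>) = eval fi h (\<phi> \<tau>)"
        by (rule eval_coincidence, rule other) (use free in \<open>auto simp: no_free_def\<close>)
      also have "\<dots> \<le> M"
        using M \<tau> by simp
      finally have "\<bar>\<psi> v \<tau> y\<bar> \<le> M + 1"
        using y by (rule sqnorm_bound)
      then show "\<bar>v \<tau> y\<bar> \<le> M + 1"
        using y by (simp add: \<psi>_def extend_state_var)
    qed (use g_an \<phi>(1) \<phi>_ext in auto)
    then obtain \<eta> v where v: "\<eta> > 0" "\<And>t. - \<eta> < t \<Longrightarrow> t < T + \<eta> \<Longrightarrow> solves_at (set ys) g \<phi> v t"
        "\<And>y. y \<in> set ys \<Longrightarrow> v 0 y = \<mu> y"
      by blast
    have "\<psi> v T \<in> fsem fi qi P"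
      using P run[OF \<phi>(1) order_refl v] by simp
    moreover have "\<psi> v T \<in> fsem fi qi P \<longleftrightarrow> \<phi> T \<in> fsem fi qi P"
      by (rule fsem_coincidence, rule other) (use free in \<open>auto simp: no_free_def\<close>)
    ultimately show "\<nu> \<in> fsem fi qi P"
      using \<phi>(6) by simp
  qed
  then show "\<mu> \<in> fsem fi qi (Box (DAP xs F) P)"
    by (simp del: psem.simps)
qed

subsection \<open>Order isomorphisms of the line matching the signs of polynomials\<close>

lemma poly_sgn_const:
  fixes p :: "real poly"
  assumes "\<And>y. min a b \<le> y \<Longrightarrow> y \<le> max a b \<Longrightarrow> poly p y \<noteq> 0"
  shows "sgn (poly p a) = sgn (poly p b)"
proof (rule ccontr)
  assume ne: "sgn (poly p a) \<noteq> sgn (poly p b)"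
  have nz: "poly p a \<noteq> 0" "poly p b \<noteq> 0"
    using assms by auto
  have *: False if "c < d" "poly p c \<noteq> 0" "poly p d \<noteq> 0" "sgn (poly p c) \<noteq> sgn (poly p d)"
    "\<And>y. c < y \<Longrightarrow> y < d \<Longrightarrow> poly p y \<noteq> 0" for c d
    using that poly_IVT_pos[of c d p] poly_IVT_neg[of c d p] by (auto simp: sgn_if split: if_splits)
  show False
  proof (cases a b rule: linorder_cases)
    case less
    then show ?thesis
      using *[of a b] nz ne assms by simp
  next
    case greater
    then show ?thesis
      using *[of b a] nz ne[symmetric] assms by simp
  qed (use ne in auto)
qed

lemma poly_diff_sgn:
  fixes p :: "real poly"
  assumes "a < b" "\<And>y. a < y \<Longrightarrow> y < b \<Longrightarrow> poly (pderiv p) y \<noteq> 0" "a < c" "c < b"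
  shows "sgn (poly p b - poly p a) = sgn (poly (pderiv p) c)"
proof -
  obtain x where x: "a < x" "x < b" "poly p b - poly p a = (b - a) * poly (pderiv p) x"
    using poly_MVT[OF assms(1)] by blast
  have "sgn (poly (pderiv p) x) = sgn (poly (pderiv p) c)"
    by (rule poly_sgn_const) (use x assms in auto)
  then show ?thesis
    using x assms(1) by (simp add: sgn_mult)
qed

lemma poly_roots_eq:
  fixes p :: "real poly"
  assumes "poly p a = 0" "poly p b = 0" "\<And>y. min a b < y \<Longrightarrow> y < max a b \<Longrightarrow> poly (pderiv p) y \<noteq> 0"
  shows "a = b"
proof (rule ccontr)
  assume "a \<noteq> b"
  then have "min a b < max a b"
    by auto
  then obtain x where "min a b < x" "x < max a b"
    "poly p (max a b) - poly p (min a b) = (max a b - min a b) * poly (pderiv p) x"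
    using poly_MVT by blast
  then show False
    using assms by (auto simp: min_def max_def split: if_splits)
qed

text \<open>Left of \<open>x\<close> the polynomial has neither roots nor critical points, and it is
  unbounded, so it moves away from 0 as the argument decreases.\<close>

lemma poly_sgn_at_bot:
  fixes p :: "real poly"
  assumes "degree p > 0" "\<And>y. y \<le> x \<Longrightarrow> poly p y \<noteq> 0" "\<And>y. y \<le> x \<Longrightarrow> poly (pderiv p) y \<noteq> 0"
  shows "sgn (poly p x) = - sgn (poly (pderiv p) x)"
proof -
  have "filterlim (poly p) at_infinity at_bot"
    using filterlim_poly_at_infinity[OF assms(1)] by (rule filterlim_mono[OF _ order_refl at_bot_le_at_infinity])
  then have "eventually (\<lambda>y. \<bar>poly p x\<bar> + 1 \<le> norm (poly p y)) at_bot"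
    unfolding filterlim_at_infinity[OF order_refl] by (auto dest!: spec[of _ "\<bar>poly p x\<bar> + 1"])
  then obtain N where N: "\<And>y. y \<le> N \<Longrightarrow> \<bar>poly p x\<bar> + 1 \<le> \<bar>poly p y\<bar>"
    by (auto simp: eventually_at_bot_linorder)
  define y where "y = min N (x - 2)"
  have y: "y \<le> N" "y < x - 1" "y < x"
    by (auto simp: y_def)
  have 1: "sgn (poly p y) = sgn (poly p x)"
    by (rule poly_sgn_const) (use assms y in auto)
  have 2: "sgn (poly p x - poly p y) = sgn (poly (pderiv p) (x - 1))"
    by (rule poly_diff_sgn) (use assms y in auto)
  have 3: "sgn (poly (pderiv p) (x - 1)) = sgn (poly (pderiv p) x)"
    by (rule poly_sgn_const) (use assms in auto)
  show ?thesis
    using 1 2 3 N[OF y(1)] assms(2)[of x] by (auto simp: sgn_if split: if_splits)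
qed

lemma poly_sgn_at_top:
  fixes p :: "real poly"
  assumes "degree p > 0" "\<And>y. x \<le> y \<Longrightarrow> poly p y \<noteq> 0" "\<And>y. x \<le> y \<Longrightarrow> poly (pderiv p) y \<noteq> 0"
  shows "sgn (poly p x) = sgn (poly (pderiv p) x)"
proof -
  have "filterlim (poly p) at_infinity at_top"
    using filterlim_poly_at_infinity[OF assms(1)] by (rule filterlim_mono[OF _ order_refl at_top_le_at_infinity])
  then have "eventually (\<lambda>y. \<bar>poly p x\<bar> + 1 \<le> norm (poly p y)) at_top"
    unfolding filterlim_at_infinity[OF order_refl] by (auto dest!: spec[of _ "\<bar>poly p x\<bar> + 1"])
  then obtain N where N: "\<And>y. N \<le> y \<Longrightarrow> \<bar>poly p x\<bar> + 1 \<le> \<bar>poly p y\<bar>"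
    by (auto simp: eventually_at_top_linorder)
  define y where "y = max N (x + 2)"
  have y: "N \<le> y" "x + 1 < y" "x < y"
    by (auto simp: y_def)
  have 1: "sgn (poly p x) = sgn (poly p y)"
    by (rule poly_sgn_const) (use assms y in auto)
  have 2: "sgn (poly p y - poly p x) = sgn (poly (pderiv p) (x + 1))"
    by (rule poly_diff_sgn) (use assms y in auto)
  have 3: "sgn (poly (pderiv p) x) = sgn (poly (pderiv p) (x + 1))"
    by (rule poly_sgn_const) (use assms in auto)
  show ?thesis
    using 1 2 3 N[OF y(1)] assms(2)[of x] by (auto simp: sgn_if split: if_splits)
qed

section \<open>Order isomorphisms of the real line\<close>

definition oiso :: "(real \<Rightarrow> real) \<Rightarrow> bool" where
  "oiso h \<longleftrightarrow> strict_mono h \<and> surj h"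

lemma oisoD:
  assumes "oiso h"
  shows "h x < h y \<longleftrightarrow> x < y" "h x \<le> h y \<longleftrightarrow> x \<le> y" "h x = h y \<longleftrightarrow> x = y"
    "h (inv h y) = y" "inv h (h x) = x"
proof -
  have h: "strict_mono h" "surj h"
    using assms by (auto simp: oiso_def)
  show "h x < h y \<longleftrightarrow> x < y" "h x \<le> h y \<longleftrightarrow> x \<le> y"
    using h(1) by (auto simp: strict_mono_less strict_mono_less_eq)
  show "h x = h y \<longleftrightarrow> x = y" "inv h (h x) = x"
    using strict_mono_imp_inj_on[OF h(1)] by (auto simp: inj_eq)
  show "h (inv h y) = y"
    using h(2) by (rule surj_f_inv_f)
qed

lemma oiso_inv: "oiso h \<Longrightarrow> oiso (inv h)"
  unfolding oiso_def[of "inv h"] by (metis oisoD(1,4,5) strict_monoI surjI)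

lemma oiso_id: "oiso (\<lambda>x. x)"
  by (auto simp: oiso_def strict_mono_def)

lemma oiso_comp: "oiso g \<Longrightarrow> oiso h \<Longrightarrow> oiso (\<lambda>x. g (h x))"
  unfolding oiso_def strict_mono_def surj_def by metis

text \<open>The identity plus \<open>v - u\<close> times a tent with peak 1 at \<open>u\<close>. The
  flanks have slopes \<open>1 / (u - c)\<close> and \<open>- 1 / (d - u)\<close>, and
  \<open>v\<close> lies strictly between \<open>c\<close> and \<open>d\<close>, so the sum still
  increases strictly.\<close>

lemma oiso_bump:
  assumes uv: "c < u" "u < d" "c < v" "v < d"
  shows "\<exists>g. oiso g \<and> g u = v \<and> (\<forall>x. x \<le> c \<or> d \<le> x \<longrightarrow> g x = x)"
proof -
  define tent where "tent = (\<lambda>x. max 0 (min ((x - c) / (u - c)) ((d - x) / (d - u))))"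
  define g where "g = (\<lambda>x. x + (v - u) * tent x)"
  have out: "g x = x" if "x \<le> c \<or> d \<le> x" for x
  proof -
    have "(x - c) / (u - c) \<le> 0 \<or> (d - x) / (d - u) \<le> 0"
      using that uv by (auto simp: divide_nonpos_pos)
    then have "tent x = 0"
      unfolding tent_def by linarith
    then show ?thesis
      by (simp add: g_def)
  qed
  have "g u = v"
    using uv by (simp add: g_def tent_def)
  have "g x < g y" if "x < y" for x y
  proof -
    have a: "(y - c) / (u - c) = (x - c) / (u - c) + (y - x) / (u - c)" "(d - x) / (d - u) = (d - y) / (d - u) + (y - x) / (d - u)"
      by (simp_all add: diff_divide_distrib)
    have pos: "(y - x) / (u - c) > 0" "(y - x) / (d - u) > 0"
      using that uv by auto
    have up: "tent y - tent x \<le> (y - x) / (u - c)" and down: "- ((y - x) / (d - u)) \<le> tent y - tent x"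
      unfolding tent_def using a pos by linarith+
    show ?thesis
    proof (cases "u \<le> v")
      case True
      have "(v - u) * ((y - x) / (d - u)) < y - x"
      proof -
        have "(v - u) * ((y - x) / (d - u)) = (y - x) * ((v - u) / (d - u))"
          by simp
        also have "\<dots> < (y - x) * 1"
          using that uv by (intro mult_strict_left_mono) (auto simp: field_simps)
        finally show ?thesis
          by simp
      qed
      moreover have "(v - u) * - ((y - x) / (d - u)) \<le> (v - u) * (tent y - tent x)"
        using True down by (intro mult_left_mono) auto
      ultimately show ?thesis
        by (simp add: g_def algebra_simps)
    next
      case False
      have "(u - v) * ((y - x) / (u - c)) < y - x"
      proof -
        have "(u - v) * ((y - x) / (u - c)) = (y - x) * ((u - v) / (u - c))"
          by simp
        also have "\<dots> < (y - x) * 1"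
          using that uv by (intro mult_strict_left_mono) (auto simp: field_simps)
        finally show ?thesis
          by simp
      qed
      moreover have "(u - v) * (tent y - tent x) \<le> (u - v) * ((y - x) / (u - c))"
        using False up by (intro mult_left_mono) auto
      ultimately show ?thesis
        by (simp add: g_def algebra_simps)
    qed
  qed
  then have "strict_mono g"
    by (rule strict_monoI)
  moreover have "surj g"
    unfolding surj_def
  proof
    fix y
    show "\<exists>x. y = g x"
    proof (cases "y \<le> c \<or> d \<le> y")
      case True
      then show ?thesis
        using out[of y] by metis
    next
      case False
      have "continuous_on {c..d} g"
        unfolding g_def tent_def using uv by (intro continuous_intros) auto
      moreover have "g c \<le> y" "y \<le> g d"
        using out[of c] out[of d] False by auto
      moreover have "c \<le> d"
        using uv by simp
      ultimately show ?thesis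
        using IVT'[of g c y d] by metis
    qed
  qed
  ultimately show ?thesis
    using \<open>g u = v\<close> out by (auto simp: oiso_def)
qed

lemma finite_avoid_neighbourhood:
  fixes m M :: real
  assumes "finite Z" "\<And>z. z \<in> Z \<Longrightarrow> z < m \<or> M < z"
  shows "\<exists>e>0. \<forall>z\<in>Z. z < m - e \<or> M + e < z"
  using assms
proof (induction Z rule: finite_induct)
  case empty
  then show ?case
    by (intro exI[of _ 1]) auto
next
  case (insert z Z)
  then obtain e where e: "e > 0" "\<forall>z\<in>Z. z < m - e \<or> M + e < z"
    by auto
  have "z < m \<or> M < z"
    using insert.prems by blast
  then show ?case
  proof
    assume "z < m"
    then show ?thesis
      using e by (intro exI[of _ "min e ((m - z) / 2)"]) (auto simp: min_def field_simps)
  next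
    assume "M < z"
    then show ?thesis
      using e by (intro exI[of _ "min e ((z - M) / 2)"]) (auto simp: min_def field_simps)
  qed
qed

text \<open>Between neighbouring points of \<open>Z\<close> the polynomial \<open>q\<close> is
  monotone and crosses 0 at \<open>r\<close>, so its signs at the neighbours are opposite; where a
  neighbour is missing, the behaviour at infinity takes its place. \<open>h\<close> carries these
  signs to \<open>q'\<close>. Without a root in the image gap, \<open>q'\<close> would have both
  signs at \<open>h r\<close>.\<close>

lemma poly_root_transfer:
  fixes q q' :: "real poly"
  assumes h: "oiso h" and Z: "finite Z" "\<And>x. poly (pderiv q) x = 0 \<Longrightarrow> x \<in> Z"
      "\<And>y. poly (pderiv q') y = 0 \<Longrightarrow> y \<in> h ` Z" "\<And>x. x \<in> Z \<Longrightarrow> sgn (poly q x) = sgn (poly q' (h x))"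
    and deg: "degree q' > 0"
    and r: "r \<notin> Z" "poly q r = 0" "sgn (poly (pderiv q) r) = sgn (poly (pderiv q') (h r))"
  shows "\<exists>r'. poly q' r' = 0 \<and> (\<forall>z\<in>Z. h z < min (h r) r' \<or> max (h r) r' < h z)"
proof (rule ccontr)
  assume no: "\<nexists>r'. poly q' r' = 0 \<and> (\<forall>z\<in>Z. h z < min (h r) r' \<or> max (h r) r' < h z)"
  note H = oisoD[OF h]
  have nz: "poly q' y \<noteq> 0" if "\<And>z. z \<in> Z \<Longrightarrow> h z < min (h r) y \<or> max (h r) y < h z" for y
    using no that by blast
  \<comment> \<open>The direction of the crossing, nonzero because the critical points of
    \<open>q\<close> lie in \<open>Z\<close> and \<open>r\<close> does not.\<close>
  define \<sigma> where "\<sigma> = sgn (poly (pderiv q) r)"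
  have \<sigma>: "\<sigma> \<noteq> 0" "\<sigma> = sgn (poly (pderiv q') (h r))"
    using Z(2) r(1,3) by (auto simp: \<sigma>_def sgn_0_0)
  have "sgn (poly q' (h r)) = \<sigma>"
  proof (cases "\<exists>z\<in>Z. r < z")
    case True
    define b where "b = Min {z\<in>Z. r < z}"
    have b: "b \<in> Z" "r < b"
    proof -
      have "b \<in> {z\<in>Z. r < z}"
        unfolding b_def using True Z(1) by (intro Min_in) auto
      then show "b \<in> Z" "r < b"
        by auto
    qed
    have b_le: "b \<le> z" if "z \<in> Z" "r < z" for z
      using that Z(1) by (auto simp: b_def)
    have gap: "z < r \<or> b \<le> z" if "z \<in> Z" for z
      using b_le[OF that] that r(1) by (cases z r rule: linorder_cases) auto
    have dnz: "poly (pderiv q) y \<noteq> 0" if "r \<le> y" "y < b" for y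
      using Z(2)[of y] gap[of y] that by force
    have "sgn (poly q b - poly q r) = sgn (poly (pderiv q) ((r + b) / 2))"
      by (rule poly_diff_sgn) (use b(2) dnz in auto)
    also have "\<dots> = sgn (poly (pderiv q) r)"
      by (rule poly_sgn_const) (use b(2) dnz in \<open>auto simp: min_def max_def split: if_splits\<close>)
    finally have qb: "sgn (poly q' (h b)) = \<sigma>"
      using r(2) Z(4)[OF b(1)] by (simp add: \<sigma>_def)
    have "sgn (poly q' (h r)) = sgn (poly q' (h b))"
    proof (rule poly_sgn_const)
      fix y assume y: "min (h r) (h b) \<le> y" "y \<le> max (h r) (h b)"
      have "h r < h b"
        using b(2) H by simp
      then have "h r \<le> y" "y \<le> h b"
        using y by auto
      show "poly q' y \<noteq> 0"
      proof (cases "y = h b")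
        case True
        then show ?thesis
          using qb \<sigma>(1) by auto
      next
        case False
        then have "y < h b"
          using \<open>y \<le> h b\<close> by simp
        show ?thesis
        proof (rule nz)
          fix z assume "z \<in> Z"
          then have "h z < h r \<or> h b \<le> h z"
            using gap[of z] H by simp
          then show "h z < min (h r) y \<or> max (h r) y < h z"
            using \<open>h r \<le> y\<close> \<open>y < h b\<close> by auto
        qed
      qed
    qed
    with qb show ?thesis
      by simp
  next
    case False
    then have gap: "z < r" if "z \<in> Z" for z
      using that r(1) by (cases z r rule: linorder_cases) auto
    have "sgn (poly q' (h r)) = sgn (poly (pderiv q') (h r))"
    proof (rule poly_sgn_at_top[OF deg])
      fix y assume y: "h r \<le> y"
      show "poly q' y \<noteq> 0"
        by (rule nz) (use gap H y in auto)
      show "poly (pderiv q') y \<noteq> 0"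
        using Z(3)[of y] gap H y by force
    qed
    with \<sigma> show ?thesis
      by simp
  qed
  moreover have "sgn (poly q' (h r)) = - \<sigma>"
  proof (cases "\<exists>z\<in>Z. z < r")
    case True
    define b where "b = Max {z\<in>Z. z < r}"
    have b: "b \<in> Z" "b < r"
    proof -
      have "b \<in> {z\<in>Z. z < r}"
        unfolding b_def using True Z(1) by (intro Max_in) auto
      then show "b \<in> Z" "b < r"
        by auto
    qed
    have b_le: "z \<le> b" if "z \<in> Z" "z < r" for z
      using that Z(1) by (auto simp: b_def)
    have gap: "r < z \<or> z \<le> b" if "z \<in> Z" for z
      using b_le[OF that] that r(1) by (cases z r rule: linorder_cases) auto
    have dnz: "poly (pderiv q) y \<noteq> 0" if "y \<le> r" "b < y" for y
      using Z(2)[of y] gap[of y] that by force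
    have "sgn (poly q r - poly q b) = sgn (poly (pderiv q) ((r + b) / 2))"
      by (rule poly_diff_sgn) (use b(2) dnz in auto)
    also have "\<dots> = sgn (poly (pderiv q) r)"
      by (rule poly_sgn_const) (use b(2) dnz in \<open>auto simp: min_def max_def split: if_splits\<close>)
    finally have qb: "sgn (poly q' (h b)) = - \<sigma>"
      using r(2) Z(4)[OF b(1)] by (simp add: \<sigma>_def sgn_minus)
    have "sgn (poly q' (h r)) = sgn (poly q' (h b))"
    proof (rule poly_sgn_const)
      fix y assume y: "min (h r) (h b) \<le> y" "y \<le> max (h r) (h b)"
      have "h b < h r"
        using b(2) H by simp
      then have "h b \<le> y" "y \<le> h r"
        using y by auto
      show "poly q' y \<noteq> 0"
      proof (cases "y = h b")
        case True
        then show ?thesis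
          using qb \<sigma>(1) by auto
      next
        case False
        then have "h b < y"
          using \<open>h b \<le> y\<close> by simp
        show ?thesis
        proof (rule nz)
          fix z assume "z \<in> Z"
          then have "h r < h z \<or> h z \<le> h b"
            using gap[of z] H by simp
          then show "h z < min (h r) y \<or> max (h r) y < h z"
            using \<open>y \<le> h r\<close> \<open>h b < y\<close> by auto
        qed
      qed
    qed
    with qb show ?thesis
      by simp
  next
    case False
    then have gap: "r < z" if "z \<in> Z" for z
      using that r(1) by (cases z r rule: linorder_cases) auto
    have "sgn (poly q' (h r)) = - sgn (poly (pderiv q') (h r))"
    proof (rule poly_sgn_at_bot[OF deg])
      fix y assume y: "y \<le> h r"
      show "poly q' y \<noteq> 0"
        by (rule nz) (use gap H y in auto)
      show "poly (pderiv q') y \<noteq> 0"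
        using Z(3)[of y] gap H y by force
    qed
    with \<sigma> show ?thesis
      by simp
  qed
  ultimately show False
    using \<sigma>(1) by simp
qed

text \<open>
  The inductive step of the Cohen--Hoermander procedure: \<open>h\<close> is corrected, one root of \<open>p\<close> at a
  time, by bumps supported in intervals on which no member of the old family vanishes.
\<close>

lemma poly_sign_match_extend:
  fixes P P' :: "'i \<Rightarrow> real poly"
  assumes I: "finite I" "j \<in> I" "P j = pderiv p" "P' j = pderiv p'" and deg: "degree p > 0" "degree p' > 0"
    and h: "oiso h" "\<And>i x. i \<in> I \<Longrightarrow> sgn (poly (P i) x) = sgn (poly (P' i) (h x))"
    and zero: "\<And>i x. i \<in> I \<Longrightarrow> P i \<noteq> 0 \<Longrightarrow> poly (P i) x = 0 \<Longrightarrow> sgn (poly p x) = sgn (poly p' (h x))"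
  shows "\<exists>k. oiso k \<and> (\<forall>i\<in>I. \<forall>x. sgn (poly (P i) x) = sgn (poly (P' i) (k x))) \<and>
     (\<forall>x. sgn (poly p x) = sgn (poly p' (k x)))"
proof -
  \<comment> \<open>The derivative of \<open>p\<close> is among the members, so \<open>p\<close> is
    strictly monotone between neighbouring points of \<open>Z\<close>. Identically vanishing members
    are left out to keep \<open>Z\<close> finite.\<close>
  define Z where "Z = (\<Union>i\<in>{i\<in>I. P i \<noteq> 0}. {x. poly (P i) x = 0})"
  have Z: "finite Z"
    unfolding Z_def using I(1) poly_roots_finite by auto
  have Zp: "sgn (poly p x) = sgn (poly p' (h x))" if "x \<in> Z" for x
    using that zero by (auto simp: Z_def)
  have dp: "pderiv p \<noteq> 0"
    using deg by (simp add: pderiv_eq_0_iff)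
  have dpZ: "x \<in> Z" if "poly (pderiv p) x = 0" for x
    using that dp I(2,3) by (auto simp: Z_def intro!: bexI[of _ j])
  \<comment> \<open>Zeros of the primed family come from \<open>Z\<close>: since \<open>h\<close> is
    surjective, the partner of an identically vanishing member vanishes identically too.\<close>
  have P'Z: "y \<in> h ` Z" if "i \<in> I" "P' i \<noteq> 0" "poly (P' i) y = 0" for i y
  proof -
    have "P i \<noteq> 0"
    proof
      assume "P i = 0"
      then have "poly (P' i) (h x) = 0" for x
        using h(2)[OF that(1), of x] by (simp add: sgn_0_0)
      then have "\<forall>y. poly (P' i) y = 0"
        using oisoD(4)[OF h(1)] by metis
      then show False
        using that(2) poly_all_0_iff_0 by blast
    qed
    moreover have "poly (P i) (inv h y) = 0"
      using h(2)[OF that(1), of "inv h y"] that(3) oisoD(4)[OF h(1)] by (simp add: sgn_0_0)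
    ultimately have "inv h y \<in> Z"
      using that(1) by (auto simp: Z_def)
    then show ?thesis
      using oisoD(4)[OF h(1), of y] by force
  qed
  have dp': "pderiv p' \<noteq> 0"
    using deg by (simp add: pderiv_eq_0_iff)
  have dpZ': "y \<in> h ` Z" if "poly (pderiv p') y = 0" for y
    using P'Z[of j y] dp' I that by simp
  \<comment> \<open>A correction must not move the images of \<open>Z\<close>, because there the
    signs of \<open>p\<close> and \<open>p'\<close> are already known to match.\<close>
  define good where "good = (\<lambda>k. oiso k \<and> (\<forall>i\<in>I. \<forall>x. sgn (poly (P i) x) = sgn (poly (P' i) (k x))) \<and>
     (\<forall>z\<in>Z. k z = h z))"
  have good_h: "good h"
    using h by (simp add: good_def)
  have goodD: "oiso k" "\<And>i x. i \<in> I \<Longrightarrow> sgn (poly (P i) x) = sgn (poly (P' i) (k x))" "\<And>z. z \<in> Z \<Longrightarrow> k z = h z"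
    "k ` Z = h ` Z" "\<And>x. sgn (poly (pderiv p) x) = sgn (poly (pderiv p') (k x))"
    "\<And>x. x \<in> Z \<Longrightarrow> sgn (poly p x) = sgn (poly p' (k x))" if "good k" for k
  proof -
    show *: "oiso k" "\<And>i x. i \<in> I \<Longrightarrow> sgn (poly (P i) x) = sgn (poly (P' i) (k x))"
      and **: "\<And>z. z \<in> Z \<Longrightarrow> k z = h z"
      using that by (auto simp: good_def)
    show "k ` Z = h ` Z"
      using ** by simp
    show "sgn (poly (pderiv p) x) = sgn (poly (pderiv p') (k x))" for x
      using *(2)[OF I(2), of x] I(3,4) by simp
    show "sgn (poly p x) = sgn (poly p' (k x))" if "x \<in> Z" for x
      using Zp[OF that] **[OF that] by simp
  qed
  define U where "U = {r. r \<notin> Z \<and> poly p r = 0}"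
  have "p \<noteq> 0"
    using deg by auto
  then have U: "finite U"
    unfolding U_def using finite_subset[OF _ poly_roots_finite[of p], of "{r. r \<notin> Z \<and> poly p r = 0}"] by auto
  have "\<exists>k. good k \<and> (\<forall>r\<in>V. poly p' (k r) = 0)" if "finite V" "V \<subseteq> U" for V
    using that
  proof (induction V rule: finite_induct)
    case empty
    then show ?case
      using good_h by blast
  next
    case (insert r V)
    then obtain k where k: "good k" "\<forall>r\<in>V. poly p' (k r) = 0"
      by auto
    note K = goodD[OF k(1)]
    note O = oisoD[OF K(1)]
    have r: "r \<notin> Z" "poly p r = 0"
      using insert.prems by (auto simp: U_def)
    obtain r' where r': "poly p' r' = 0" "\<forall>z\<in>Z. k z < min (k r) r' \<or> max (k r) r' < k z"
      using poly_root_transfer[OF K(1) Z dpZ _ K(6) deg(2) r K(5)] dpZ' K(4) by auto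
    obtain e where e: "e > 0" "\<forall>y\<in>k ` Z. y < min (k r) r' - e \<or> max (k r) r' + e < y"
      using finite_avoid_neighbourhood[of "k ` Z" "min (k r) r'" "max (k r) r'"] Z r'(2) by auto
    \<comment> \<open>The bump interval reaches beyond \<open>k r\<close> and \<open>r'\<close> by
      \<open>e\<close> and still contains no image of a point of \<open>Z\<close>, so no member of
      the primed family changes sign on it.\<close>
    define c where "c = min (k r) r' - e"
    define d where "d = max (k r) r' + e"
    have cd: "c < k r" "k r < d" "c < r'" "r' < d"
      using e(1) by (auto simp: c_def d_def)
    obtain g where g: "oiso g" "g (k r) = r'" "\<And>x. x \<le> c \<or> d \<le> x \<Longrightarrow> g x = x"
      using oiso_bump[OF cd] by blast
    note G = oisoD[OF g(1)]
    have noZ: "z \<notin> Z" if "c \<le> k z" "k z \<le> d" for z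
      using e(2) that by (auto simp: c_def d_def)
    have noZ': "y \<notin> h ` Z" if "c \<le> y" "y \<le> d" for y
      using e(2) that K(4) by (auto simp: c_def d_def)
    have inside: "c < g y" "g y < d" if "c < y" "y < d" for y
      using G(1)[of c y] G(1)[of y d] g(3)[of c] g(3)[of d] that by auto
    have "sgn (poly (P' i) (g y)) = sgn (poly (P' i) y)" if i: "i \<in> I" for i y
    proof (cases "y \<le> c \<or> d \<le> y \<or> P' i = 0")
      case True
      then show ?thesis
        using g(3)[of y] by auto
    next
      case False
      then have y: "c < y" "y < d" "P' i \<noteq> 0"
        by auto
      show ?thesis
      proof (rule poly_sgn_const)
        fix x assume "min (g y) y \<le> x" "x \<le> max (g y) y"
        then have "c \<le> x" "x \<le> d"
          using inside[OF y(1,2)] y by auto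
        then show "poly (P' i) x \<noteq> 0"
          using noZ' P'Z[OF i y(3), of x] by auto
      qed
    qed
    then have "good (\<lambda>x. g (k x))"
      unfolding good_def
    proof (intro conjI ballI allI)
      show "oiso (\<lambda>x. g (k x))"
        using g(1) K(1) by (rule oiso_comp)
      show "g (k z) = h z" if "z \<in> Z" for z
      proof -
        have "k z \<le> c \<or> d \<le> k z"
          using noZ[of z] that by force
        then show ?thesis
          using g(3) K(3)[OF that] by simp
      qed
    qed (use K(2) in simp)
    moreover have "poly p' (g (k w)) = 0" if w: "w \<in> insert r V" for w
    proof (cases "w = r")
      case True
      then show ?thesis
        using g(2) r'(1) by simp
    next
      case False
      then have w: "w \<in> V" "poly p w = 0"
        using w insert.prems by (auto simp: U_def)
      \<comment> \<open>A root treated earlier is not moved: two roots of \<open>p\<close> whose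
        images lie in the bump interval would enclose a zero of its derivative, hence a point of
        \<open>Z\<close>.\<close>
      have "k w \<le> c \<or> d \<le> k w"
      proof (rule ccontr)
        assume "\<not> (k w \<le> c \<or> d \<le> k w)"
        then have kw: "c < k w" "k w < d"
          by auto
        have "w = r"
        proof (rule poly_roots_eq[OF w(2) r(2)])
          fix y assume "min w r < y" "y < max w r"
          then have "c \<le> k y" "k y \<le> d"
            using O(1)[of w y] O(1)[of r y] O(1)[of y w] O(1)[of y r] kw cd by (auto simp: min_def max_def split: if_splits)
          then show "poly (pderiv p) y \<noteq> 0"
            using noZ dpZ by blast
        qed
        then show False
          using False by simp
      qed
      then show ?thesis
        using g(3) k(2) w(1) by simp
    qed
    ultimately show ?case
      by blast
  qed
  from this[OF U order_refl] obtain k where k: "good k" "\<And>r. r \<in> U \<Longrightarrow> poly p' (k r) = 0"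
    by blast
  note K = goodD[OF k(1)]
  note O = oisoD[OF K(1)]
  have root: "poly p' (k x) = 0 \<longleftrightarrow> poly p x = 0" for x
  proof (cases "x \<in> Z")
    case True
    then show ?thesis
      using K(6)[OF True] by (metis sgn_0_0)
  next
    case False
    show ?thesis
    proof
      assume "poly p x = 0"
      then show "poly p' (k x) = 0"
        using False by (intro k(2)) (simp add: U_def)
    next
      assume x: "poly p' (k x) = 0"
      have inv_img: "inv k ` k ` Z = Z"
        using O(5) by (auto simp: image_image)
      \<comment> \<open>The same transfer along the inverse of \<open>k\<close>, with the two sides
        exchanged, yields a root \<open>r\<close> of \<open>p\<close> in the gap of
        \<open>x\<close>; Rolle's argument for \<open>p'\<close> then identifies \<open>k r\<close>
        with \<open>k x\<close>.\<close>
      have "\<exists>r. poly p r = 0 \<and> (\<forall>z\<in>k ` Z. inv k z < min (inv k (k x)) r \<or> max (inv k (k x)) r < inv k z)"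
      proof (rule poly_root_transfer[OF oiso_inv[OF K(1)], of "k ` Z" p' p "k x"])
        show "finite (k ` Z)"
          using Z by simp
        show "y \<in> k ` Z" if "poly (pderiv p') y = 0" for y
          using dpZ'[OF that] K(4) by simp
        show "y \<in> inv k ` k ` Z" if "poly (pderiv p) y = 0" for y
          using dpZ[OF that] inv_img by simp
        show "sgn (poly p' y) = sgn (poly p (inv k y))" if "y \<in> k ` Z" for y
          using that K(6) O(5) by auto
        show "k x \<notin> k ` Z"
          using False O(3) by auto
        show "sgn (poly (pderiv p') (k x)) = sgn (poly (pderiv p) (inv k (k x)))"
          using K(5)[of x] O(5) by simp
      qed (use deg x in auto)
      then obtain r where r: "poly p r = 0" "\<forall>z\<in>Z. z < min x r \<or> max x r < z"
        using O(5) by auto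
      have "r \<notin> Z"
        using r(2) by force
      then have kr: "poly p' (k r) = 0"
        using r(1) by (intro k(2)) (simp add: U_def)
      have "k x = k r"
      proof (rule poly_roots_eq[OF x kr])
        fix y assume y: "min (k x) (k r) < y" "y < max (k x) (k r)"
        show "poly (pderiv p') y \<noteq> 0"
        proof
          assume "poly (pderiv p') y = 0"
          then obtain z where z: "z \<in> Z" "y = k z"
            using dpZ' K(4) by (metis image_iff)
          then have "min x r < z" "z < max x r"
            using y O(1)[of x z] O(1)[of z x] O(1)[of r z] O(1)[of z r] O(1)[of x r] O(2)[of x r]
            by (auto simp: min_def max_def split: if_splits)
          then show False
            using r(2) z(1) by force
        qed
      qed
      then have "x = r"
        using O(3) by simp
      then show "poly p x = 0"
        using r(1) by simp
    qed
  qed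
  have "sgn (poly p x) = sgn (poly p' (k x))" for x
  proof (cases "poly p x = 0 \<or> x \<in> Z")
    case True
    then show ?thesis
      using root[of x] K(6)[of x] by (auto simp: sgn_0_0)
  next
    case False
    \<comment> \<open>Outside \<open>W\<close> the sign of \<open>p\<close> is read off from the
      nearest point of \<open>W\<close> to the left: from the derivative if that point is a root,
      from the sign there otherwise, and from the behaviour at minus infinity if there is none. The
      same reading applies to \<open>p'\<close> at the images.\<close>
    define W where "W = Z \<union> {r. poly p r = 0}"
    have W: "finite W"
      unfolding W_def using Z poly_roots_finite[OF \<open>p \<noteq> 0\<close>] by simp
    have xW: "x \<notin> W"
      using False by (simp add: W_def)
    have dW: "poly (pderiv p) y \<noteq> 0" "poly p y \<noteq> 0" if "y \<notin> W" for y
      using that dpZ by (auto simp: W_def)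
    have dW': "poly (pderiv p') (k y) \<noteq> 0" "poly p' (k y) \<noteq> 0" if "y \<notin> W" for y
      using dW[OF that] K(5)[of y] root[of y] by (auto simp: sgn_0_0)
    have sur: "\<exists>u. y = k u" for y
      using O(4)[of y] by metis
    show ?thesis
    proof (cases "\<exists>w\<in>W. w < x")
      case True
      define w where "w = Max {w\<in>W. w < x}"
      have "w \<in> {w\<in>W. w < x}"
        unfolding w_def using True W by (intro Max_in) auto
      then have w: "w \<in> W" "w < x"
        by auto
      have gap: "y \<notin> W" if "w < y" "y \<le> x" for y
      proof
        assume "y \<in> W"
        then have "y < x"
          using xW that by (cases "y = x") auto
        then have "y \<le> w"
          unfolding w_def using W \<open>y \<in> W\<close> by (intro Max_ge) auto
        then show False
          using that by simp
      qed
      show ?thesis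
      proof (cases "poly p w = 0")
        case True
        have "sgn (poly p x - poly p w) = sgn (poly (pderiv p) ((w + x) / 2))"
          by (rule poly_diff_sgn) (use w(2) gap dW in auto)
        moreover have "sgn (poly p' (k x) - poly p' (k w)) = sgn (poly (pderiv p') (k ((w + x) / 2)))"
        proof (rule poly_diff_sgn)
          show "poly (pderiv p') y \<noteq> 0" if y: "k w < y" "y < k x" for y
          proof -
            obtain u where "y = k u"
              using sur by blast
            then show ?thesis
              using y gap[of u] dW'[of u] O(1) by auto
          qed
        qed (use w(2) O(1) in auto)
        ultimately show ?thesis
          using True root[of w] K(5) by simp
      next
        case False
        then have "w \<in> Z"
          using w by (auto simp: W_def)
        have "sgn (poly p w) = sgn (poly p x)"
        proof (rule poly_sgn_const)
          show "poly p y \<noteq> 0" if "min w x \<le> y" "y \<le> max w x" for y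
            using that w(2) gap[of y] dW[of y] False by (cases "y = w") auto
        qed
        moreover have "sgn (poly p' (k w)) = sgn (poly p' (k x))"
        proof (rule poly_sgn_const)
          show "poly p' y \<noteq> 0" if y: "min (k w) (k x) \<le> y" "y \<le> max (k w) (k x)" for y
          proof -
            obtain u where u: "y = k u"
              using sur by blast
            then have "w \<le> u" "u \<le> x"
              using y w(2) O(2)[of w u] O(2)[of u x] O(1)[of w x] by auto
            then show ?thesis
              using u gap[of u] dW'[of u] False root[of w] by (cases "u = w") auto
          qed
        qed
        ultimately show ?thesis
          using K(6)[OF \<open>w \<in> Z\<close>] by simp
      qed
    next
      case False
      then have gap: "y \<notin> W" if "y \<le> x" for y
        using xW that by force
      have "sgn (poly p x) = - sgn (poly (pderiv p) x)"
        by (rule poly_sgn_at_bot[OF deg(1)]) (use gap dW in auto)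
      moreover have "sgn (poly p' (k x)) = - sgn (poly (pderiv p') (k x))"
      proof (rule poly_sgn_at_bot[OF deg(2)])
        fix y assume y: "y \<le> k x"
        obtain u where "y = k u"
          using sur by blast
        then show "poly p' y \<noteq> 0" "poly (pderiv p') y \<noteq> 0"
          using y gap[of u] dW'[of u] O(2) by auto
      qed
      ultimately show ?thesis
        using K(5)[of x] by simp
    qed
  qed
  then show ?thesis
    using K(1,2) by blast
qed


subsection \<open>Formulas of first-order real arithmetic only depend on finitely many signs\<close>

text \<open>The coefficients are terms, lowest power first. At a given state leading ones may
  vanish, so the elimination measures formal length, not degree.\<close>

definition tpoly :: "('f \<Rightarrow> real list \<Rightarrow> real) \<Rightarrow> 'v state \<Rightarrow> ('v, 'f) trm list \<Rightarrow> real poly" where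
  "tpoly fi s cs = Poly (map (\<lambda>c. eval fi c s) cs)"

definition same_signs ::
  "('f \<Rightarrow> real list \<Rightarrow> real) \<Rightarrow> ('v, 'f) trm set \<Rightarrow> 'v state \<Rightarrow> 'v state \<Rightarrow> bool" where
  "same_signs fi Q s s' \<longleftrightarrow> (\<forall>q\<in>Q. sgn (eval fi q s) = sgn (eval fi q s'))"

definition arith_list :: "('v, 'f) trm list \<Rightarrow> bool" where
  "arith_list cs \<longleftrightarrow> (\<forall>c\<in>set cs. arith_trm c)"

lemma poly_tpoly: "poly (tpoly fi s cs) x = (\<Sum>i<length cs. eval fi (cs ! i) s * x ^ i)"
proof (induction cs)
  case (Cons c cs)
  then show ?case
    by (simp add: tpoly_def sum.lessThan_Suc_shift sum_distrib_left mult_ac del: sum.lessThan_Suc)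
qed (simp add: tpoly_def)

lemma tpoly_Nil [simp]: "tpoly fi s [] = 0"
  by (simp add: tpoly_def)

lemma tpoly_butlast: "cs \<noteq> [] \<Longrightarrow> eval fi (last cs) s = 0 \<Longrightarrow> tpoly fi s cs = tpoly fi s (butlast cs)"
  by (metis (no_types, lifting) Poly_snoc_zero append_butlast_last_id list.simps(8,9) map_append tpoly_def)

definition tderiv :: "('v, 'f) trm list \<Rightarrow> ('v, 'f) trm list" where
  "tderiv cs = map (\<lambda>i. Mul (Const (of_nat (Suc i))) (cs ! Suc i)) [0..<length cs - 1]"

lemma tpoly_tderiv: "tpoly fi s (tderiv cs) = pderiv (tpoly fi s cs)"
  by (rule poly_eqI) (auto simp: tpoly_def coeff_pderiv tderiv_def nth_default_def of_rat_add)

lemma arith_tderiv: "arith_list cs \<Longrightarrow> arith_list (tderiv cs)"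
  by (auto simp: arith_list_def tderiv_def)

text \<open>
  One step of polynomial division, \<open>lc(q) p - lc(p) x\<^sup>k q\<close>: at the roots of \<open>q\<close> it has the
  sign of \<open>p\<close> up to the sign of \<open>lc(q)\<close>, and its formal degree is smaller than that of \<open>p\<close>.
\<close>

definition treduce :: "('v, 'f) trm list \<Rightarrow> ('v, 'f) trm list \<Rightarrow> ('v, 'f) trm list" where
  "treduce p q = map (\<lambda>i. Add (Mul (last q) (p ! i)) (Mul (Const (- 1)) (Mul (last p)
      (if i < length p - length q then Const 0 else q ! (i - (length p - length q)))))) [0..<length p - 1]"

lemma length_treduce: "length (treduce p q) = length p - 1"
  by (simp add: treduce_def)

lemma length_tderiv: "length (tderiv p) = length p - 1"
  by (simp add: tderiv_def)

lemma arith_treduce: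
  assumes "arith_list p" "arith_list q" "p \<noteq> []" "q \<noteq> []" "length q \<le> length p"
  shows "arith_list (treduce p q)"
  using assms by (auto simp: arith_list_def treduce_def)

lemma poly_treduce:
  assumes "p \<noteq> []" "q \<noteq> []" "length q \<le> length p"
  shows "poly (tpoly fi s (treduce p q)) x = eval fi (last q) s * poly (tpoly fi s p) x -
     eval fi (last p) s * (x ^ (length p - length q) * poly (tpoly fi s q) x)"
proof -
  define k where "k = length p - length q"
  define c where "c = (\<lambda>i. eval fi (last q) s * eval fi (p ! i) s -
      eval fi (last p) s * (if i < k then 0 else eval fi (q ! (i - k)) s))"
  have lens: "length p = k + length q" "length p = Suc (length p - 1)" "length q = Suc (length q - 1)"
    using assms by (auto simp: k_def)
  have "poly (tpoly fi s (treduce p q)) x = (\<Sum>i<length p - 1. c i * x ^ i)"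
    unfolding poly_tpoly length_treduce
    by (rule sum.cong) (auto simp: treduce_def c_def k_def)
  \<comment> \<open>The coefficient at the top index cancels by construction, so the sum may run
    over the full length of \<open>p\<close>.\<close>
  also have "\<dots> = (\<Sum>i<length p. c i * x ^ i)"
  proof -
    have "\<not> length p - 1 < k" "length p - 1 - k = length q - 1"
      using lens by auto
    then have "c (length p - 1) = 0"
      using assms by (simp add: c_def last_conv_nth)
    then have "(\<Sum>i<Suc (length p - 1). c i * x ^ i) = (\<Sum>i<length p - 1. c i * x ^ i)"
      by simp
    then show ?thesis
      unfolding lens(2)[symmetric] by (rule sym)
  qed
  also have "\<dots> = eval fi (last q) s * poly (tpoly fi s p) x -
      eval fi (last p) s * (\<Sum>i<length p. (if i < k then 0 else eval fi (q ! (i - k)) s) * x ^ i)"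
    by (simp add: c_def poly_tpoly sum_distrib_left algebra_simps flip: sum_subtractf)
  also have "(\<Sum>i<length p. (if i < k then 0 else eval fi (q ! (i - k)) s) * x ^ i) =
      (\<Sum>i<length q. eval fi (q ! i) s * x ^ (k + i))"
  proof -
    have "(\<Sum>i<length q. eval fi (q ! i) s * x ^ (k + i)) =
        (\<Sum>i\<in>{k..<k + length q}. eval fi (q ! (i - k)) s * x ^ i)"
      by (rule sum.reindex_bij_witness[of _ "\<lambda>i. i - k" "\<lambda>i. k + i"]) auto
    also have "\<dots> = (\<Sum>i<length p. (if i < k then 0 else eval fi (q ! (i - k)) s) * x ^ i)"
      unfolding lens(1) by (rule sum.mono_neutral_cong_left) auto
    finally show ?thesis
      by simp
  qed
  also have "\<dots> = x ^ k * poly (tpoly fi s q) x"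
    by (simp add: poly_tpoly sum_distrib_left power_add mult_ac)
  finally show ?thesis
    by (simp add: k_def)
qed

lemma degree_tpoly:
  assumes "cs \<noteq> []" "eval fi (last cs) s \<noteq> 0"
  shows "degree (tpoly fi s cs) = length cs - 1"
proof (rule antisym)
  show "degree (tpoly fi s cs) \<le> length cs - 1"
    by (rule degree_le) (auto simp: tpoly_def nth_default_def)
  have "coeff (tpoly fi s cs) (length cs - 1) \<noteq> 0"
    using assms by (simp add: tpoly_def nth_default_def last_conv_nth)
  then show "length cs - 1 \<le> degree (tpoly fi s cs)"
    by (rule le_degree)
qed

text \<open>Induction on the multiset of formal lengths. If a leading coefficient vanishes, it is
  dropped; otherwise a longest \<open>p\<close> gives way to its derivative and to remainders of
  \<open>p\<close>, all shorter. Which case applies depends on the state, so \<open>Q\<close>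
  collects the leading coefficients and the terms needed in every branch; agreement of signs puts
  both states into the same branch.\<close>

lemma sign_match_family:
  fixes fi :: "'f \<Rightarrow> real list \<Rightarrow> real" and ps :: "('v, 'f) trm list list"
  shows "\<forall>p\<in>set ps. arith_list p \<Longrightarrow> \<exists>Q. finite Q \<and> (\<forall>q\<in>Q. arith_trm q) \<and>
     (\<forall>s s'. same_signs fi Q s s' \<longrightarrow>
        (\<exists>h. oiso h \<and> (\<forall>p\<in>set ps. \<forall>x. sgn (poly (tpoly fi s p) x) = sgn (poly (tpoly fi s' p) (h x)))))"
proof (induction "mset (map length ps)" arbitrary: ps rule: wf_induct_rule[OF wf_mult1[OF wf_less_than]])
  case (1 ps)
  show ?case
  proof (cases "\<forall>p\<in>set ps. length p \<le> 1")
    \<comment> \<open>Lists of length at most 1 are constants; the identity matches them once the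
      coefficients have equal signs.\<close>
    case True
    have "sgn (poly (tpoly fi s p) x) = sgn (poly (tpoly fi s' p) x)"
      if "same_signs fi (\<Union>p\<in>set ps. set p) s s'" "p \<in> set ps" for s s' p x
    proof (cases p)
      case (Cons c cs)
      then have "p = [c]"
        using True that(2) by fastforce
      then show ?thesis
        using that by (auto simp: same_signs_def poly_tpoly)
    qed simp
    then show ?thesis
      using 1(2) oiso_id by (intro exI[of _ "\<Union>p\<in>set ps. set p"]) (auto simp: arith_list_def)
  next
    case False
    then have "set ps \<noteq> {}"
      by auto
    \<comment> \<open>A longest polynomial is eliminated, so that the division step applies to it
      with every other one as divisor.\<close>
    define N where "N = Max (length ` set ps)"
    have "N \<in> length ` set ps"
      unfolding N_def using \<open>set ps \<noteq> {}\<close> by (intro Max_in) auto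
    then obtain p where p: "p \<in> set ps" "length p = N"
      by auto
    have len_le: "length q \<le> length p" if "q \<in> set ps" for q
      unfolding p(2) N_def using that by (intro Max_ge) auto
    have len_p: "length p \<ge> 2"
      using False len_le by force
    then have "p \<noteq> []"
      by auto
    define rest where "rest = remove1 p ps"
    define base where "base = tderiv p # rest"
    \<comment> \<open>Empty lists stand for the zero polynomial and are skipped as divisors.\<close>
    define ps' where "ps' = base @ map (treduce p) (filter (\<lambda>q. q \<noteq> []) base)"
    have rest_sub: "set rest \<subseteq> set ps"
      unfolding rest_def by (rule set_remove1_subset)
    have ps_cases: "q = p \<or> q \<in> set rest" if "q \<in> set ps" for q
      using that unfolding rest_def by (cases "q = p") (auto simp: in_set_remove1)
    have base_arith: "arith_list q" "length q \<le> length p" if "q \<in> set base" for q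
      using that rest_sub 1(2) p(1) arith_tderiv len_le by (auto simp: base_def length_tderiv)
    have ps'_arith: "\<forall>q\<in>set ps'. arith_list q"
      using base_arith 1(2) p(1) \<open>p \<noteq> []\<close> by (auto simp: ps'_def intro!: arith_treduce)
    have msplit: "mset (map length ps) = add_mset (length q) (mset (map length (remove1 q ps)))" if "q \<in> set ps" for q
      using that by (metis image_mset_add_mset mset_map mset_remove1 insert_DiffM set_mset_mset)
    have "(mset (map length ps'), mset (map length ps)) \<in> mult1 less_than"
    proof (rule mult1I[OF msplit[OF p(1)]])
      show "mset (map length ps') = mset (map length (remove1 p ps)) +
          mset (map length (tderiv p # map (treduce p) (filter (\<lambda>q. q \<noteq> []) base)))"
        by (simp add: ps'_def base_def rest_def)
      show "(b, length p) \<in> less_than"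
        if "b \<in># mset (map length (tderiv p # map (treduce p) (filter (\<lambda>q. q \<noteq> []) base)))" for b
        using that \<open>p \<noteq> []\<close> by (auto simp: length_tderiv length_treduce)
    qed
    from 1(1)[OF this ps'_arith] obtain Q1 where Q1: "finite Q1" "\<forall>q\<in>Q1. arith_trm q"
      "\<And>s s'. same_signs fi Q1 s s' \<Longrightarrow>
        \<exists>h. oiso h \<and> (\<forall>p\<in>set ps'. \<forall>x. sgn (poly (tpoly fi s p) x) = sgn (poly (tpoly fi s' p) (h x)))"
      by metis
    define good where "good = (\<lambda>(ps :: ('v, 'f) trm list list) Q. finite Q \<and> (\<forall>q\<in>Q. arith_trm q) \<and>
      (\<forall>s s'. same_signs fi Q s s' \<longrightarrow> (\<exists>h. oiso h \<and>
        (\<forall>p\<in>set ps. \<forall>x. sgn (poly (tpoly fi s p) x) = sgn (poly (tpoly fi s' p) (h x))))))"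
    define L where "L = {q\<in>set ps. q \<noteq> []}"
    have "\<exists>Q. good (butlast q # remove1 q ps) Q" if "q \<in> L" for q
      unfolding good_def
    proof (rule 1(1))
      have q: "q \<in> set ps" "q \<noteq> []"
        using that by (auto simp: L_def)
      show "(mset (map length (butlast q # remove1 q ps)), mset (map length ps)) \<in> mult1 less_than"
        by (rule mult1I[OF msplit[OF q(1)], of _ "{#length q - 1#}"]) (use q(2) in auto)
      have "set (remove1 q ps) \<subseteq> set ps"
        by (rule set_remove1_subset)
      then show "\<forall>p\<in>set (butlast q # remove1 q ps). arith_list p"
        using 1(2) q(1) by (auto simp: arith_list_def dest: in_set_butlastD)
    qed
    then have "\<forall>q\<in>L. \<exists>Q. good (butlast q # remove1 q ps) Q"
      by blast
    from bchoice[OF this] obtain Q2 where Q2': "\<forall>q\<in>L. good (butlast q # remove1 q ps) (Q2 q)"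
      by blast
    have Q2: "finite (Q2 q)" "\<forall>c\<in>Q2 q. arith_trm c" if "q \<in> L" for q
      using Q2' that by (auto simp: good_def)
    have Q2h: "\<exists>h. oiso h \<and> (\<forall>p\<in>set (butlast q # remove1 q ps). \<forall>x.
          sgn (poly (tpoly fi s p) x) = sgn (poly (tpoly fi s' p) (h x)))"
      if "q \<in> L" "same_signs fi (Q2 q) s s'" for q s s'
      using Q2' that unfolding good_def by blast
    define Q where "Q = last ` L \<union> Q1 \<union> (\<Union>q\<in>L. Q2 q)"
    have "arith_trm (last q)" if "q \<in> L" for q
      using that 1(2) by (auto simp: L_def arith_list_def)
    moreover have "finite L"
      by (simp add: L_def)
    ultimately have "finite Q" "\<forall>q\<in>Q. arith_trm q"
      using Q1(1,2) Q2 by (auto simp: Q_def)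
    moreover have "\<exists>h. oiso h \<and> (\<forall>p\<in>set ps. \<forall>x. sgn (poly (tpoly fi s p) x) = sgn (poly (tpoly fi s' p) (h x)))"
      if same: "same_signs fi Q s s'" for s s'
    proof (cases "\<exists>q\<in>L. eval fi (last q) s = 0")
      case True
      then obtain q where q: "q \<in> L" "eval fi (last q) s = 0"
        by blast
      have "sgn (eval fi (last q) s) = sgn (eval fi (last q) s')"
        using same q(1) by (auto simp: same_signs_def Q_def)
      then have q': "eval fi (last q) s' = 0"
        using q(2) by (simp add: sgn_0_0)
      have "same_signs fi (Q2 q) s s'"
        using same q(1) by (auto simp: same_signs_def Q_def)
      then obtain h where h: "oiso h" "\<forall>p\<in>set (butlast q # remove1 q ps). \<forall>x.
          sgn (poly (tpoly fi s p) x) = sgn (poly (tpoly fi s' p) (h x))"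
        using Q2h[OF q(1)] by blast
      have "sgn (poly (tpoly fi s u) x) = sgn (poly (tpoly fi s' u) (h x))" if "u \<in> set ps" for u x
      proof (cases "u = q")
        case True
        then show ?thesis
          using h(2) q q' tpoly_butlast[of q fi] by (auto simp: L_def)
      next
        case False
        then show ?thesis
          using h(2) that by (simp add: in_set_remove1)
      qed
      with h(1) show ?thesis
        by blast
    next
      case False
      then have nz: "eval fi (last q) s \<noteq> 0" "eval fi (last q) s' \<noteq> 0" if "q \<in> L" for q
        using same that unfolding same_signs_def Q_def by (metis UnI1 imageI sgn_0_0)+
      have "same_signs fi Q1 s s'"
        using same by (auto simp: same_signs_def Q_def)
      then obtain h where h: "oiso h" "\<And>p x. p \<in> set ps' \<Longrightarrow> sgn (poly (tpoly fi s p) x) = sgn (poly (tpoly fi s' p) (h x))"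
        using Q1(3) by blast
      have pL: "p \<in> L"
        using p(1) \<open>p \<noteq> []\<close> by (simp add: L_def)
      \<comment> \<open>The leading coefficient of the derivative is a positive integer multiple of
        that of \<open>p\<close>, so its sign is controlled without adding it to
        \<open>Q\<close>.\<close>
      have last_d: "last (tderiv p) = Mul (Const (of_nat (length p - 1))) (last p)"
      proof -
        obtain n where "length p = Suc (Suc n)"
          using len_p by (metis add_2_eq_Suc le_Suc_ex)
        then show ?thesis
          using \<open>p \<noteq> []\<close> by (simp add: tderiv_def last_conv_nth nth_append)
      qed
      have last_sgn: "sgn (eval fi (last q) s) = sgn (eval fi (last q) s')" "eval fi (last q) s \<noteq> 0"
        if q: "q \<in> set base" "q \<noteq> []" for q
      proof -
        have L: "sgn (eval fi (last u) s) = sgn (eval fi (last u) s')" if "u \<in> L" for u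
          using same that by (auto simp: same_signs_def Q_def)
        consider "q = tderiv p" | "q \<in> L"
          using q rest_sub by (auto simp: base_def L_def)
        then have "sgn (eval fi (last q) s) = sgn (eval fi (last q) s') \<and> eval fi (last q) s \<noteq> 0"
        proof cases
          case 1
          then show ?thesis
            using L[OF pL] nz(1)[OF pL] len_p by (simp add: last_d sgn_mult)
        next
          case 2
          then show ?thesis
            using L nz by blast
        qed
        then show "sgn (eval fi (last q) s) = sgn (eval fi (last q) s')" "eval fi (last q) s \<noteq> 0"
          by auto
      qed
      have "\<exists>k. oiso k \<and> (\<forall>i\<in>set base. \<forall>x. sgn (poly (tpoly fi s i) x) = sgn (poly (tpoly fi s' i) (k x))) \<and>
          (\<forall>x. sgn (poly (tpoly fi s p) x) = sgn (poly (tpoly fi s' p) (k x)))"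
      proof (rule poly_sign_match_extend[of _ "tderiv p"])
        show "0 < degree (tpoly fi s p)" "0 < degree (tpoly fi s' p)"
          using degree_tpoly[OF \<open>p \<noteq> []\<close>] nz[OF pL] len_p by auto
        show "sgn (poly (tpoly fi s i) x) = sgn (poly (tpoly fi s' i) (h x))" if "i \<in> set base" for i x
          using h(2) that by (simp add: ps'_def)
        show "sgn (poly (tpoly fi s p) x) = sgn (poly (tpoly fi s' p) (h x))"
          if q: "q \<in> set base" "tpoly fi s q \<noteq> 0" "poly (tpoly fi s q) x = 0" for q x
        proof -
          have "q \<noteq> []"
            using q(2) by auto
          note red = poly_treduce[OF \<open>p \<noteq> []\<close> this base_arith(2)[OF q(1)]]
          have "sgn (poly (tpoly fi s q) x) = sgn (poly (tpoly fi s' q) (h x))"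
            using h(2) q(1) by (simp add: ps'_def)
          then have q': "poly (tpoly fi s' q) (h x) = 0"
            using q(3) by (simp add: sgn_0_0)
          have "sgn (poly (tpoly fi s (treduce p q)) x) = sgn (poly (tpoly fi s' (treduce p q)) (h x))"
            using h(2) q(1) \<open>q \<noteq> []\<close> by (simp add: ps'_def)
          \<comment> \<open>At a root of \<open>q\<close> the remainder is the leading coefficient
            of \<open>q\<close> times the value of \<open>p\<close>; that coefficient has the same
            nonzero sign at both states and cancels.\<close>
          then have "sgn (eval fi (last q) s) * sgn (poly (tpoly fi s p) x) =
              sgn (eval fi (last q) s') * sgn (poly (tpoly fi s' p) (h x))"
            unfolding red using q(3) q' by (simp add: sgn_mult)
          then show ?thesis
            using last_sgn[OF q(1) \<open>q \<noteq> []\<close>] by (metis mult_left_cancel sgn_0_0)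
        qed
      qed (use h(1) tpoly_tderiv in \<open>auto simp: base_def\<close>)
      then obtain k where k: "oiso k" "\<forall>i\<in>set base. \<forall>x. sgn (poly (tpoly fi s i) x) = sgn (poly (tpoly fi s' i) (k x))"
        "\<forall>x. sgn (poly (tpoly fi s p) x) = sgn (poly (tpoly fi s' p) (k x))"
        by blast
      have "sgn (poly (tpoly fi s u) x) = sgn (poly (tpoly fi s' u) (k x))" if "u \<in> set ps" for u x
        using ps_cases[OF that] k(2,3) by (auto simp: base_def)
      with k(1) show ?thesis
        by blast
    qed
    ultimately show ?thesis
      by blast
  qed
qed

section \<open>Arithmetic terms as polynomials in one variable\<close>

fun tadd :: "('v, 'f) trm list \<Rightarrow> ('v, 'f) trm list \<Rightarrow> ('v, 'f) trm list" where
  "tadd [] bs = bs"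
| "tadd (a # as) [] = a # as"
| "tadd (a # as) (b # bs) = Add a b # tadd as bs"

fun tmul :: "('v, 'f) trm list \<Rightarrow> ('v, 'f) trm list \<Rightarrow> ('v, 'f) trm list" where
  "tmul [] bs = []"
| "tmul (a # as) bs = tadd (map (Mul a) bs) (Const 0 # tmul as bs)"

lemma tpoly_Cons: "poly (tpoly fi s (c # cs)) x = eval fi c s + x * poly (tpoly fi s cs) x"
  by (simp add: tpoly_def)

lemma poly_tadd: "poly (tpoly fi s (tadd as bs)) x = poly (tpoly fi s as) x + poly (tpoly fi s bs) x"
  by (induction as bs rule: tadd.induct) (auto simp: tpoly_Cons algebra_simps)

lemma poly_tscale: "poly (tpoly fi s (map (Mul a) bs)) x = eval fi a s * poly (tpoly fi s bs) x"
  by (induction bs) (auto simp: tpoly_Cons algebra_simps)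

lemma poly_tmul: "poly (tpoly fi s (tmul as bs)) x = poly (tpoly fi s as) x * poly (tpoly fi s bs) x"
  by (induction as) (auto simp: tpoly_Cons poly_tadd poly_tscale algebra_simps)

lemma arith_tadd: "arith_list as \<Longrightarrow> arith_list bs \<Longrightarrow> arith_list (tadd as bs)"
  by (induction as bs rule: tadd.induct) (auto simp: arith_list_def)

lemma arith_tmul: "arith_list as \<Longrightarrow> arith_list bs \<Longrightarrow> arith_list (tmul as bs)"
proof (induction as)
  case (Cons a as)
  then have "arith_list (map (Mul a) bs)" "arith_list (Const 0 # tmul as bs)"
    by (auto simp: arith_list_def)
  then show ?case
    by (simp add: arith_tadd)
qed (simp add: arith_list_def)

lemma arith_trm_as_tpoly:
  "arith_trm e \<Longrightarrow> \<exists>cs. arith_list cs \<and> (\<forall>s r. eval fi e (s(x := r)) = poly (tpoly fi s cs) r)"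
proof (induction e rule: arith_trm.induct)
  case (1 y)
  show ?case
  proof (cases "y = x")
    case True
    then show ?thesis
      by (intro exI[of _ "[Const 0, Const 1]"]) (simp add: arith_list_def tpoly_def)
  next
    case False
    then show ?thesis
      by (intro exI[of _ "[Var y]"]) (simp add: arith_list_def tpoly_def)
  qed
next
  case (2 c)
  show ?case
    by (intro exI[of _ "[Const c]"]) (simp add: arith_list_def tpoly_def)
next
  case (3 e g)
  then have "arith_trm e" "arith_trm g"
    by auto
  with 3(1,2) obtain as bs where "arith_list as" "\<forall>s r. eval fi e (s(x := r)) = poly (tpoly fi s as) r"
      "arith_list bs" "\<forall>s r. eval fi g (s(x := r)) = poly (tpoly fi s bs) r"
    by blast
  then show ?case
    by (intro exI[of _ "tmul as bs"] conjI arith_tmul) (simp_all only: eval.simps poly_tmul simp_thms)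
next
  case (4 e g)
  then have "arith_trm e" "arith_trm g"
    by auto
  with 4(1,2) obtain as bs where "arith_list as" "\<forall>s r. eval fi e (s(x := r)) = poly (tpoly fi s as) r"
      "arith_list bs" "\<forall>s r. eval fi g (s(x := r)) = poly (tpoly fi s bs) r"
    by blast
  then show ?case
    by (intro exI[of _ "tadd as bs"] conjI arith_tadd) (simp_all only: eval.simps poly_tadd simp_thms)
qed auto

text \<open>In the quantifier case the test terms for the body become polynomials in the value of
  \<open>x\<close>. The order isomorphism pairs each value \<open>r\<close> at one state with
  \<open>h r\<close> at the other so that the body has equal truth values, and by surjectivity every
  value at the second state is reached.\<close>

theorem fo_arith_finitely_many_signs:
  "fo_arith A \<Longrightarrow> \<exists>Q. finite Q \<and> (\<forall>q\<in>Q. arith_trm q) \<and>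
     (\<forall>s s'. same_signs fi Q s s' \<longrightarrow> (s \<in> fsem fi qi A \<longleftrightarrow> s' \<in> fsem fi qi A))"
proof (induction A rule: fo_arith.induct)
  case (1 e g)
  have "eval fi e s \<le> eval fi g s \<longleftrightarrow> eval fi e s' \<le> eval fi g s'"
    if "same_signs fi {Add g (Mul (Const (- 1)) e)} s s'" for s s'
    using that by (auto simp: same_signs_def sgn_if split: if_splits)
  with 1 show ?case
    by (intro exI[of _ "{Add g (Mul (Const (- 1)) e)}"]) simp
next
  case (2 A B)
  then obtain Q1 Q2 where "finite Q1" "\<forall>q\<in>Q1. arith_trm q"
      "\<forall>s s'. same_signs fi Q1 s s' \<longrightarrow> (s \<in> fsem fi qi A \<longleftrightarrow> s' \<in> fsem fi qi A)"
      "finite Q2" "\<forall>q\<in>Q2. arith_trm q"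
      "\<forall>s s'. same_signs fi Q2 s s' \<longrightarrow> (s \<in> fsem fi qi B \<longleftrightarrow> s' \<in> fsem fi qi B)"
    by auto
  moreover have "same_signs fi Q1 s s'" "same_signs fi Q2 s s'" if "same_signs fi (Q1 \<union> Q2) s s'" for s s'
    using that by (auto simp: same_signs_def)
  ultimately have "\<forall>s s'. same_signs fi (Q1 \<union> Q2) s s' \<longrightarrow>
      (s \<in> fsem fi qi (And A B) \<longleftrightarrow> s' \<in> fsem fi qi (And A B))" "finite (Q1 \<union> Q2)" "\<forall>q\<in>Q1 \<union> Q2. arith_trm q"
    unfolding fsem.simps by blast+
  then show ?case
    by blast
next
  case (3 A)
  then show ?case
    by simp
next
  case (4 x A)
  then obtain Q where Q: "finite Q" "\<forall>q\<in>Q. arith_trm q"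
      "\<And>s s'. same_signs fi Q s s' \<Longrightarrow> s \<in> fsem fi qi A \<longleftrightarrow> s' \<in> fsem fi qi A"
    by auto
  have "\<forall>q\<in>Q. \<exists>cs. arith_list cs \<and> (\<forall>s r. eval fi q (s(x := r)) = poly (tpoly fi s cs) r)"
    using Q(2) arith_trm_as_tpoly by blast
  then obtain cs where cs: "\<And>q. q \<in> Q \<Longrightarrow> arith_list (cs q)"
      "\<And>q s r. q \<in> Q \<Longrightarrow> eval fi q (s(x := r)) = poly (tpoly fi s (cs q)) r"
    by metis
  obtain qs where qs: "set qs = Q"
    using Q(1) finite_list by blast
  have "\<forall>p\<in>set (map cs qs). arith_list p"
    using cs(1) qs by auto
  from sign_match_family[OF this, of fi] obtain R where R: "finite R" "\<forall>q\<in>R. arith_trm q"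
      "\<And>s s'. same_signs fi R s s' \<Longrightarrow>
        \<exists>h. oiso h \<and> (\<forall>p\<in>set (map cs qs). \<forall>x. sgn (poly (tpoly fi s p) x) = sgn (poly (tpoly fi s' p) (h x)))"
    by metis
  have "s \<in> fsem fi qi (Forall x A) \<longleftrightarrow> s' \<in> fsem fi qi (Forall x A)" if same: "same_signs fi R s s'" for s s'
  proof -
    obtain h where h: "oiso h" "\<And>q r. q \<in> Q \<Longrightarrow> sgn (poly (tpoly fi s (cs q)) r) = sgn (poly (tpoly fi s' (cs q)) (h r))"
      using R(3)[OF same] qs by auto
    have *: "s(x := r) \<in> fsem fi qi A \<longleftrightarrow> s'(x := h r) \<in> fsem fi qi A" for r
      by (rule Q(3)) (use h(2) cs(2) in \<open>auto simp: same_signs_def\<close>)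
    have "(\<forall>r. s'(x := r) \<in> fsem fi qi A) \<longleftrightarrow> (\<forall>r. s'(x := h r) \<in> fsem fi qi A)"
      using oisoD(4)[OF h(1)] by metis
    then show ?thesis
      using * by simp
  qed
  with R(1,2) show ?case
    by blast
qed auto

subsection \<open>Finitely many switches along analytic flows\<close>

text \<open>Identity theorem: zeros of a holomorphic function on a disc are isolated unless it
  vanishes throughout.\<close>

lemma real_ext_zero_dichotomy:
  assumes "real_ext g t0 \<delta> G"
  shows "\<exists>d>0. (\<forall>t. \<bar>t - t0\<bar> < d \<longrightarrow> g t = 0) \<or> (\<forall>t. t \<noteq> t0 \<longrightarrow> \<bar>t - t0\<bar> < d \<longrightarrow> g t \<noteq> 0)"
proof -
  have \<delta>: "\<delta> > 0" and hol: "G holomorphic_on ball (of_real t0) \<delta>"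
    and val: "\<And>t. \<bar>t - t0\<bar> < \<delta> \<Longrightarrow> G (of_real t) = of_real (g t)"
    using assms by (auto simp: real_ext_def)
  consider "\<forall>z\<in>ball (of_real t0) \<delta>. G z = 0" | "g t0 \<noteq> 0" |
    z where "z \<in> ball (of_real t0) \<delta>" "G z \<noteq> 0" "g t0 = 0"
    by blast
  then show ?thesis
  proof cases
    case 1
    then have "g t = 0" if "\<bar>t - t0\<bar> < \<delta>" for t
      using val[OF that] that of_real_in_ball[of t t0 \<delta>] by (metis of_real_eq_0_iff)
    then show ?thesis
      using \<delta> by blast
  next
    case 2
    have "g \<midarrow>t0\<rightarrow> g t0"
      using real_ext_isCont[OF assms] by (simp add: isCont_def)
    then have "eventually (\<lambda>t. g t \<noteq> 0) (at t0)"
      using 2 by (rule tendsto_imp_eventually_ne)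
    then show ?thesis
      unfolding eventually_at dist_real_def by blast
  next
    case 3
    have "G (of_real t0) = 0"
      using val[of t0] 3(3) \<delta> by simp
    moreover have "complex_of_real t0 \<in> ball (of_real t0) \<delta>"
      using \<delta> by simp
    ultimately obtain r where r: "r > 0" "\<forall>z\<in>ball (complex_of_real t0) r - {of_real t0}. G z \<noteq> 0"
      using isolated_zeros[OF hol open_ball connected_ball _ _ 3(1,2), of "of_real t0"] by metis
    have "g t \<noteq> 0" if "t \<noteq> t0" "\<bar>t - t0\<bar> < min r \<delta>" for t
    proof -
      have "complex_of_real t \<in> ball (of_real t0) r - {of_real t0}"
        using that of_real_in_ball[of t t0 r] by simp
      then have "G (of_real t) \<noteq> 0"
        using r(2) by blast
      then show ?thesis
        using val[of t] that by auto
    qed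
    then show ?thesis
      using r(1) \<delta> by (intro exI[of _ "min r \<delta>"]) auto
  qed
qed

lemma continuous_nonzero_sgn_const:
  fixes g :: "real \<Rightarrow> real"
  assumes "continuous_on {a<..<b} g" "\<And>t. a < t \<Longrightarrow> t < b \<Longrightarrow> g t \<noteq> 0" "a < t" "t < b" "a < u" "u < b"
  shows "sgn (g t) = sgn (g u)"
proof (rule ccontr)
  assume ne: "sgn (g t) \<noteq> sgn (g u)"
  have conn: "connected (g ` {a<..<b})"
    using assms(1) by (intro connected_continuous_image) auto
  have "g t \<in> g ` {a<..<b}" "g u \<in> g ` {a<..<b}" "g t \<noteq> 0" "g u \<noteq> 0"
    using assms by auto
  then have "0 \<in> g ` {a<..<b}"
    using connectedD_interval[OF conn, of "g t" "g u" 0] connectedD_interval[OF conn, of "g u" "g t" 0] ne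
    by (auto simp: sgn_if split: if_splits)
  then show False
    using assms(2) by auto
qed

lemma real_ext_one_sided_sgn:
  assumes "real_ext g t0 \<delta> G"
  shows "\<exists>d>0. (\<forall>t u. t0 < t \<longrightarrow> t < t0 + d \<longrightarrow> t0 < u \<longrightarrow> u < t0 + d \<longrightarrow> sgn (g t) = sgn (g u)) \<and>
     (\<forall>t u. t0 - d < t \<longrightarrow> t < t0 \<longrightarrow> t0 - d < u \<longrightarrow> u < t0 \<longrightarrow> sgn (g t) = sgn (g u))"
proof -
  obtain d where d: "d > 0" and
    *: "(\<forall>t. \<bar>t - t0\<bar> < d \<longrightarrow> g t = 0) \<or> (\<forall>t. t \<noteq> t0 \<longrightarrow> \<bar>t - t0\<bar> < d \<longrightarrow> g t \<noteq> 0)"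
    using real_ext_zero_dichotomy[OF assms] by blast
  define e where "e = min d \<delta>"
  have e: "e > 0" "e \<le> d" "e \<le> \<delta>"
    using d assms by (auto simp: e_def real_ext_def)
  have cont: "continuous_on {a<..<b} g" if "t0 - e \<le> a" "b \<le> t0 + e" for a b
  proof (rule continuous_at_imp_continuous_on, rule ballI)
    fix t assume "t \<in> {a<..<b}"
    then have "\<bar>t - t0\<bar> < \<delta>"
      using that e by auto
    then show "isCont g t"
      using real_ext_has_derivative(1)[OF assms] DERIV_isCont by blast
  qed
  from * show ?thesis
  proof
    assume 0: "\<forall>t. \<bar>t - t0\<bar> < d \<longrightarrow> g t = 0"
    show ?thesis
      using 0 d by (intro exI[of _ d]) auto
  next
    assume nz: "\<forall>t. t \<noteq> t0 \<longrightarrow> \<bar>t - t0\<bar> < d \<longrightarrow> g t \<noteq> 0"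
    have R: "sgn (g t) = sgn (g u)" if "t0 < t" "t < t0 + e" "t0 < u" "u < t0 + e" for t u
      by (rule continuous_nonzero_sgn_const[OF cont[of t0 "t0 + e"]]) (use e that nz in auto)
    have L: "sgn (g t) = sgn (g u)" if "t0 - e < t" "t < t0" "t0 - e < u" "u < t0" for t u
      by (rule continuous_nonzero_sgn_const[OF cont[of "t0 - e" t0]]) (use e that nz in auto)
    show ?thesis
      using e(1) R L by blast
  qed
qed

section \<open>One-sided behaviour along flows\<close>

lemma finite_common_radius:
  assumes "finite Q" "\<And>q. q \<in> Q \<Longrightarrow> \<exists>d>0. R q d" "\<And>q d e. R q d \<Longrightarrow> 0 < e \<Longrightarrow> e \<le> d \<Longrightarrow> R q e"
  shows "\<exists>d>0::real. \<forall>q\<in>Q. R q d"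
  using assms(1,2)
proof (induction Q rule: finite_induct)
  case empty
  then show ?case
    by (intro exI[of _ 1]) auto
next
  case (insert q Q)
  then obtain d e where "d > 0" "\<forall>q\<in>Q. R q d" "e > 0" "R q e"
    by (metis insertCI)
  then show ?case
    using assms(3) by (intro exI[of _ "min d e"]) (auto intro: assms(3))
qed

text \<open>The instant \<open>t0\<close> is excluded and the two sides are kept apart: a formula
  may hold at \<open>t0\<close> alone, or change there.\<close>

lemma flow_one_sided_truth:
  fixes A :: "('v, 'f, 'p) fml"
  assumes fi: "analytic_interp fi" and A: "fo_arith A" and \<phi>: "is_flow xs a b \<phi>" "a < t0" "t0 < b"
  shows "\<exists>d>0. (\<forall>t u. t0 < t \<longrightarrow> t < t0 + d \<longrightarrow> t0 < u \<longrightarrow> u < t0 + d \<longrightarrow>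
        (\<phi> t \<in> fsem fi qi A \<longleftrightarrow> \<phi> u \<in> fsem fi qi A)) \<and>
     (\<forall>t u. t0 - d < t \<longrightarrow> t < t0 \<longrightarrow> t0 - d < u \<longrightarrow> u < t0 \<longrightarrow>
        (\<phi> t \<in> fsem fi qi A \<longleftrightarrow> \<phi> u \<in> fsem fi qi A))"
proof -
  obtain Q :: "('v, 'f) trm set" where Q: "finite Q"
      "\<And>s s'. same_signs fi Q s s' \<Longrightarrow> s \<in> fsem fi qi A \<longleftrightarrow> s' \<in> fsem fi qi A"
    using fo_arith_finitely_many_signs[OF A, of fi qi] by metis
  define R where "R = (\<lambda>q d. (\<forall>t u. t0 < t \<longrightarrow> t < t0 + d \<longrightarrow> t0 < u \<longrightarrow> u < t0 + d \<longrightarrow>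
        sgn (eval fi q (\<phi> t)) = sgn (eval fi q (\<phi> u))) \<and>
     (\<forall>t u. t0 - d < t \<longrightarrow> t < t0 \<longrightarrow> t0 - d < u \<longrightarrow> u < t0 \<longrightarrow>
        sgn (eval fi q (\<phi> t)) = sgn (eval fi q (\<phi> u))))"
  have "\<exists>d>0. \<forall>q\<in>Q. R q d"
  proof (rule finite_common_radius[OF Q(1)])
    show "\<exists>d>0. R q d" for q
    proof -
      obtain \<delta> G where "real_ext (\<lambda>t. eval fi q (\<phi> t)) t0 \<delta> G"
        using eval_flow_real_ext[OF fi \<phi>] by blast
      from real_ext_one_sided_sgn[OF this] show ?thesis
        unfolding R_def by blast
    qed
    show "R q e" if "R q d" "0 < e" "e \<le> d" for q d e
      using that unfolding R_def by (meson diff_left_mono le_less_trans less_le_trans add_left_mono)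
  qed
  then obtain d where d: "d > 0" "\<And>q. q \<in> Q \<Longrightarrow> R q d"
    by blast
  have "\<phi> t \<in> fsem fi qi A \<longleftrightarrow> \<phi> u \<in> fsem fi qi A" if "t0 < t" "t < t0 + d" "t0 < u" "u < t0 + d" for t u
    by (rule Q(2), unfold same_signs_def, rule ballI, drule d(2)) (use that in \<open>unfold R_def, blast\<close>)
  moreover have "\<phi> t \<in> fsem fi qi A \<longleftrightarrow> \<phi> u \<in> fsem fi qi A" if "t0 - d < t" "t < t0" "t0 - d < u" "u < t0" for t u
    by (rule Q(2), unfold same_signs_def, rule ballI, drule d(2)) (use that in \<open>unfold R_def, blast\<close>)
  ultimately show ?thesis
    using d(1) by blast
qed

text \<open>The progress formula asks the flow to leave its starting point, so it can be established
  for moving flows only. The alternative is harmless: if no variable of \<open>xs\<close> moves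
  away, then by analyticity all are constant near \<open>t0\<close>, their differentials are 0, and
  the modes cannot change.\<close>

lemma flow_rest_or_move:
  assumes \<phi>: "is_flow xs a b \<phi>" "a < t0" "t0 < b"
  shows "\<exists>d>0. (\<forall>t. \<bar>t - t0\<bar> < d \<longrightarrow> \<phi> t = \<phi> t0) \<or>
     (\<exists>x\<in>set xs. \<forall>t. t \<noteq> t0 \<longrightarrow> \<bar>t - t0\<bar> < d \<longrightarrow> \<phi> t x \<noteq> \<phi> t0 x)"
proof -
  have dich: "\<exists>d>0. (\<forall>t. \<bar>t - t0\<bar> < d \<longrightarrow> \<phi> t x = \<phi> t0 x) \<or>
      (\<forall>t. t \<noteq> t0 \<longrightarrow> \<bar>t - t0\<bar> < d \<longrightarrow> \<phi> t x \<noteq> \<phi> t0 x)" if x: "x \<in> set xs" for x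
  proof -
    obtain \<delta> G where G: "real_ext (\<lambda>t. \<phi> t x) t0 \<delta> G"
      using is_flow_real_ext(1)[OF \<phi> x] by blast
    then have "real_ext (\<lambda>t. \<phi> t x - \<phi> t0 x) t0 \<delta> (\<lambda>z. G z - of_real (\<phi> t0 x))"
      by (auto simp: real_ext_def intro!: holomorphic_intros)
    from real_ext_zero_dichotomy[OF this] show ?thesis
      by simp
  qed
  show ?thesis
  proof (cases "\<exists>x\<in>set xs. \<exists>d>0. \<forall>t. t \<noteq> t0 \<longrightarrow> \<bar>t - t0\<bar> < d \<longrightarrow> \<phi> t x \<noteq> \<phi> t0 x")
    case True
    then show ?thesis
      by blast
  next
    case False
    have "\<exists>d>0. \<forall>x\<in>set xs. \<forall>t. \<bar>t - t0\<bar> < d \<longrightarrow> \<phi> t x = \<phi> t0 x"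
    proof (rule finite_common_radius)
      show "\<exists>d>0. \<forall>t. \<bar>t - t0\<bar> < d \<longrightarrow> \<phi> t x = \<phi> t0 x" if "x \<in> set xs" for x
        using dich[OF that] False that by blast
      show "\<forall>t. \<bar>t - t0\<bar> < e \<longrightarrow> \<phi> t x = \<phi> t0 x"
        if "\<forall>t. \<bar>t - t0\<bar> < d \<longrightarrow> \<phi> t x = \<phi> t0 x" "e \<le> d" for x d e
        using that by (meson less_le_trans)
    qed (rule finite_set)
    then obtain d' where d': "d' > 0" "\<And>x t. x \<in> set xs \<Longrightarrow> \<bar>t - t0\<bar> < d' \<Longrightarrow> \<phi> t x = \<phi> t0 x"
      by blast
    define d where "d = Min {d', t0 - a, b - t0}"
    have d: "d > 0" "d \<le> d'" "d \<le> t0 - a" "d \<le> b - t0"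
      using d'(1) \<phi>(2,3) by (auto simp: d_def)
    have prime0: "\<phi> t (Prime x) = 0" if x: "x \<in> set xs" and t: "\<bar>t - t0\<bar> < d" for x t
    proof -
      have "((\<lambda>s. \<phi> s x) has_real_derivative 0) (at t)"
      proof (rule has_field_derivative_transform_within_open)
        show "((\<lambda>s. \<phi> t0 x) has_real_derivative 0) (at t)"
          by simp
        show "\<phi> t0 x = \<phi> s x" if "s \<in> {t0 - d<..<t0 + d}" for s
          using d'(2)[OF x, of s] that d(2) by auto
      qed (use t in auto)
      moreover have "((\<lambda>s. \<phi> s x) has_real_derivative \<phi> t (Prime x)) (at t)"
        using is_flow_has_derivative[OF \<phi>(1) _ _ x, of t] t d by auto
      ultimately show ?thesis
        by (rule DERIV_unique[symmetric])
    qed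
    have "\<phi> t = \<phi> t0" if t: "\<bar>t - t0\<bar> < d" for t
    proof
      fix z
      consider "z \<in> set xs" | "z \<in> Prime ` set xs" | "z \<notin> set xs" "z \<notin> Prime ` set xs"
        by blast
      then show "\<phi> t z = \<phi> t0 z"
      proof cases
        case 1
        then show ?thesis
          using d'(2)[of z t] t d(2) by simp
      next
        case 2
        then show ?thesis
          using prime0[of _ t] prime0[of _ t0] t d(1) by auto
      next
        case 3
        then show ?thesis
          using is_flow_outside[OF \<phi>(1), of t z] is_flow_outside[OF \<phi>, of z] t d by auto
      qed
    qed
    with d(1) show ?thesis
      by blast
  qed
qed


subsection \<open>Time reversal\<close>

definition negate_primes :: "'v var list \<Rightarrow> 'v state \<Rightarrow> 'v state" where
  "negate_primes xs s = (\<lambda>z. if z \<in> Prime ` set xs then - s z else s z)"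

lemma negate_primes_negate_primes [simp]: "negate_primes xs (negate_primes xs s) = s"
  by (auto simp: negate_primes_def)

lemma fsem_reverse:
  "distinct (primes xs) \<Longrightarrow> s \<in> fsem fi qi (reverse xs A) \<longleftrightarrow> negate_primes xs s \<in> fsem fi qi A"
proof (induction xs arbitrary: s)
  case Nil
  then show ?case
    by (simp add: reverse_def negate_primes_def)
next
  case (Cons x xs)
  have "negate_primes xs (s(Prime x := - s (Prime x))) = negate_primes (x # xs) s"
    using Cons.prems by (auto simp: negate_primes_def)
  moreover have "s(Prime x := - s (Prime x)) \<in> fsem fi qi (reverse xs A) \<longleftrightarrow>
      negate_primes xs (s(Prime x := - s (Prime x))) \<in> fsem fi qi A"
    by (rule Cons.IH) (use Cons.prems in simp)
  moreover have "s \<in> fsem fi qi (reverse (x # xs) A) \<longleftrightarrow> s(Prime x := - s (Prime x)) \<in> fsem fi qi (reverse xs A)"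
    by (simp add: reverse_def)
  ultimately show ?case
    by (simp only:)
qed

lemma fvf_reverse: "fvf (reverse xs A) \<subseteq> fvf A \<union> Prime ` set xs"
  by (induction xs) (auto simp: reverse_def)

text \<open>Reversing time changes the sign of all derivatives, so negating the differentials
  restores the flow condition. The tuple must not contain a differential of one of its own members,
  whose value would be negated as well.\<close>

lemma is_flow_reverse:
  assumes \<phi>: "is_flow xs a b \<phi>" "a < c" "c < b" and xs: "distinct (xs @ primes xs)"
  shows "is_flow xs (c - b) (c - a) (\<lambda>s. negate_primes xs (\<phi> (c - s)))"
  unfolding is_flow_def
proof (intro conjI ballI allI impI)
  fix x assume x: "x \<in> set xs"
  then have x': "x \<notin> Prime ` set xs"
    using xs by auto
  show "real_analytic_on (\<lambda>s. negate_primes xs (\<phi> (c - s)) x) {c - b<..<c - a}"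
    unfolding real_analytic_on_iff_real_ext
  proof
    fix t assume "t \<in> {c - b<..<c - a}"
    then obtain \<delta> G where G: "real_ext (\<lambda>t. \<phi> t x) (c - t) \<delta> G"
      using is_flow_real_ext(1)[OF \<phi>(1) _ _ x, of "c - t"] by auto
    have "(\<lambda>z. of_real c - z) ` ball (of_real t) \<delta> \<subseteq> ball (complex_of_real (c - t)) \<delta>"
      by (auto simp: dist_norm norm_minus_commute algebra_simps)
    moreover have "(\<lambda>z. of_real c - z) holomorphic_on ball (complex_of_real t) \<delta>"
      by (intro holomorphic_intros)
    ultimately have "(\<lambda>z. G (of_real c - z)) holomorphic_on ball (of_real t) \<delta>"
      using holomorphic_on_compose_gen[of "\<lambda>z. of_real c - z" "ball (of_real t) \<delta>" G "ball (of_real (c - t)) \<delta>"] G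
      by (simp add: real_ext_def o_def)
    moreover have "G (of_real c - of_real s) = of_real (\<phi> (c - s) x)" if "\<bar>s - t\<bar> < \<delta>" for s
    proof -
      have "\<bar>(c - s) - (c - t)\<bar> < \<delta>"
        using that by simp
      then have "G (of_real (c - s)) = of_real (\<phi> (c - s) x)"
        using G by (simp only: real_ext_def)
      then show ?thesis
        by simp
    qed
    ultimately have "real_ext (\<lambda>s. negate_primes xs (\<phi> (c - s)) x) t \<delta> (\<lambda>z. G (of_real c - z))"
      using G x' by (simp add: real_ext_def negate_primes_def)
    then show "\<exists>\<delta> G. real_ext (\<lambda>s. negate_primes xs (\<phi> (c - s)) x) t \<delta> G"
      by blast
  qed
  fix t assume t: "t \<in> {c - b<..<c - a}"
  then have D: "((\<lambda>s. \<phi> s x) has_real_derivative \<phi> (c - t) (Prime x)) (at (c - t))"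
    by (intro is_flow_has_derivative[OF \<phi>(1) _ _ x]) auto
  have "((\<lambda>s. c - s) has_real_derivative - 1) (at t)"
    by (auto intro!: derivative_eq_intros)
  from DERIV_chain2[OF D this] show "((\<lambda>s. negate_primes xs (\<phi> (c - s)) x) has_real_derivative
      negate_primes xs (\<phi> (c - t)) (Prime x)) (at t)"
    using x x' by (simp add: negate_primes_def)
next
  fix t z assume "t \<in> {c - b<..<c - a}" "z \<notin> set xs \<union> set (primes xs)"
  then show "negate_primes xs (\<phi> (c - t)) z = negate_primes xs (\<phi> (c - 0)) z"
    using is_flow_outside[OF \<phi>(1), of "c - t" z] is_flow_outside[OF \<phi>, of z] by (simp add: negate_primes_def)
qed


subsection \<open>Local progress\<close>

lemma fsem_Exs_primes:
  "\<mu> \<in> fsem fi qi (Exs ws (Exs (primes ws) A)) \<longleftrightarrow>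
     (\<exists>\<nu>. (\<forall>z. z \<notin> set ws \<longrightarrow> z \<notin> Prime ` set ws \<longrightarrow> \<nu> z = \<mu> z) \<and> \<nu> \<in> fsem fi qi A)"
proof -
  have "Exs ws (Exs (primes ws) A) = Exs (ws @ primes ws) A"
    by (simp add: Exs_def)
  then show ?thesis
    by (simp only: fsem_Exs) auto
qed

text \<open>The fresh variables record the starting point. At time 0 the equality disjunct of the
  constraint is satisfied, so \<open>A\<close> is needed after time 0 only.\<close>

lemma progressI:
  assumes ws: "new_tuple ws xs" "length ws = length xs" "no_free ws (fvf A)"
    and \<psi>: "is_flow xs (- e) (\<tau> + e) \<psi>" "e > 0" "\<tau> \<ge> 0"
    and A: "\<And>s. 0 < s \<Longrightarrow> s \<le> \<tau> \<Longrightarrow> \<psi> s \<in> fsem fi qi A"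
    and move: "x \<in> set xs" "\<psi> \<tau> x \<noteq> \<psi> 0 x"
  shows "\<psi> 0 \<in> fsem fi qi (progress ws xs A)"
proof -
  note D = new_tupleD[OF ws(1)]
  define idx where "idx = (\<lambda>w. the (map_of (zip ws xs) w))"
  have idx: "idx (ws ! i) = xs ! i" if "i < length xs" for i
    using that ws(2) D(1) by (simp add: idx_def map_of_zip_nth)
  define \<nu> where "\<nu> = extend_state ws (\<psi> 0) (\<lambda>w. \<psi> 0 (idx w)) (\<lambda>w. \<psi> 0 (Prime (idx w)))"
  have \<nu>_other: "\<nu> z = \<psi> 0 z" if "z \<notin> set ws" "z \<notin> Prime ` set ws" for z
    using that by (simp add: \<nu>_def extend_state_other)
  have \<nu>_ws: "\<nu> (ws ! i) = \<psi> 0 (xs ! i)" "\<nu> (Prime (ws ! i)) = \<psi> 0 (Prime (xs ! i))" if "i < length xs" for i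
    using that ws(2) D(3) by (simp_all add: \<nu>_def extend_state_var extend_state_Prime idx)
  have xs_ws: "z \<notin> set ws" "z \<notin> Prime ` set ws" if "z \<in> set xs \<union> Prime ` set xs" for z
    using that D(4,5)[of z] D(6,7) by auto
  \<comment> \<open>The recorded values stay in the fresh variables for the whole run, so comparing
    \<open>xs\<close> with \<open>ws\<close> at a later time compares with the start.\<close>
  define \<rho> where "\<rho> = (\<lambda>t z. if z \<in> set xs \<union> set (primes xs) then \<psi> t z else \<nu> z)"
  have \<rho>: "is_flow xs (- e) (\<tau> + e) \<rho>"
    unfolding \<rho>_def by (rule is_flow_coincidence[OF \<psi>(1)]) (use \<nu>_other xs_ws in auto)
  have \<rho>0: "\<rho> 0 = \<nu>"
    using \<nu>_other xs_ws by (auto simp: \<rho>_def fun_eq_iff)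
  have \<rho>_ws: "\<rho> s (ws ! i) = \<psi> 0 (xs ! i)" "\<rho> s (Prime (ws ! i)) = \<psi> 0 (Prime (xs ! i))"
    "\<rho> s (xs ! i) = \<psi> s (xs ! i)" "\<rho> s (Prime (xs ! i)) = \<psi> s (Prime (xs ! i))" if "i < length xs" for s i
    using that D(4-7)[of "ws ! i"] ws(2) \<nu>_ws[OF that] by (auto simp: \<rho>_def)
  have \<rho>_other: "\<rho> s z = \<psi> s z" if "z \<notin> set ws" "z \<notin> Prime ` set ws" "0 \<le> s" "s \<le> \<tau>" for s z
  proof (cases "z \<in> set xs \<union> set (primes xs)")
    case True
    then show ?thesis
      by (simp add: \<rho>_def)
  next
    case False
    then have "\<rho> s z = \<psi> 0 z"
      using \<nu>_other[OF that(1,2)] by (simp add: \<rho>_def)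
    also have "\<dots> = \<psi> s z"
      using is_flow_outside[OF \<psi>(1), of s z] False that \<psi>(2) by auto
    finally show ?thesis .
  qed
  have eqs: "\<rho> s \<in> fsem fi qi (VarEqs xs ws) \<longleftrightarrow> (\<forall>i<length xs. \<psi> s (xs ! i) = \<psi> 0 (xs ! i))"
    "\<rho> s \<in> fsem fi qi (VarEqs (primes xs) (primes ws)) \<longleftrightarrow>
      (\<forall>i<length xs. \<psi> s (Prime (xs ! i)) = \<psi> 0 (Prime (xs ! i)))" for s
    unfolding fsem_VarEqs[OF ws(2)] using fsem_VarEqs[of "primes ws" "primes xs" "\<rho> s" fi qi] ws(2) \<rho>_ws by simp_all
  have run: "(\<nu>, \<rho> \<tau>) \<in> psem fi qi (DAP xs (Or A (And (VarEqs xs ws) (VarEqs (primes xs) (primes ws)))))"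
  proof (rule DAP_I[OF \<psi>(3,2) \<rho> _ \<rho>0 refl])
    fix s assume s: "0 \<le> s" "s \<le> \<tau>"
    show "\<rho> s \<in> fsem fi qi (Or A (And (VarEqs xs ws) (VarEqs (primes xs) (primes ws))))"
    proof (cases "s = 0")
      case True
      then have "\<rho> s \<in> fsem fi qi (VarEqs xs ws)" "\<rho> s \<in> fsem fi qi (VarEqs (primes xs) (primes ws))"
        unfolding eqs by auto
      then show ?thesis
        unfolding fsem_Or fsem.simps(3) by blast
    next
      case False
      have "\<rho> s \<in> fsem fi qi A \<longleftrightarrow> \<psi> s \<in> fsem fi qi A"
        by (rule fsem_coincidence, rule \<rho>_other) (use ws(3) s in \<open>auto simp: no_free_def\<close>)
      then show ?thesis
        using A[of s] s False unfolding fsem_Or by auto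
    qed
  qed
  have "\<rho> \<tau> \<notin> fsem fi qi (VarEqs xs ws)"
    unfolding eqs using move by (metis in_set_conv_nth)
  with run have "\<nu> \<in> fsem fi qi (Diamond (DAP xs (Or A (And (VarEqs xs ws) (VarEqs (primes xs) (primes ws)))))
      (Neg (VarEqs xs ws)))"
    unfolding fsem_Diamond fsem.simps(4) by blast
  moreover have "\<nu> \<in> fsem fi qi (VarEqs xs ws)" "\<nu> \<in> fsem fi qi (VarEqs (primes xs) (primes ws))"
    unfolding \<rho>0[symmetric] eqs by auto
  ultimately show ?thesis
    unfolding progress_def fsem_Exs_primes using \<nu>_other unfolding fsem.simps(3) by blast
qed

lemma progress_right:
  assumes ws: "new_tuple ws xs" "length ws = length xs" "no_free ws (fvf A)"
    and \<phi>: "is_flow xs a b \<phi>" "a < t0" "t0 < b" and d: "d > 0" "t0 + d \<le> b"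
    and A: "\<And>t. t0 < t \<Longrightarrow> t < t0 + d \<Longrightarrow> \<phi> t \<in> fsem fi qi A"
    and move: "x \<in> set xs" "\<And>t. t0 < t \<Longrightarrow> t < t0 + d \<Longrightarrow> \<phi> t x \<noteq> \<phi> t0 x"
  shows "\<phi> t0 \<in> fsem fi qi (progress ws xs A)"
proof -
  \<comment> \<open>The run lasts \<open>d / 2\<close>; the margin \<open>e\<close> keeps the
    surrounding open interval inside the domain of \<open>\<phi>\<close>.\<close>
  define e where "e = min (d / 2) (t0 - a)"
  have e: "e > 0" "e \<le> t0 - a"
    using d \<phi> by (auto simp: e_def)
  have e2: "e \<le> d / 2"
    unfolding e_def by (rule min.cobounded1)
  have "is_flow xs (a - t0) (b - t0) (\<lambda>s. \<phi> (t0 + s))"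
    using \<phi> by (rule is_flow_shift)
  then have "is_flow xs (- e) (d / 2 + e) (\<lambda>s. \<phi> (t0 + s))"
    by (rule is_flow_restrict) (use e e2 d in auto)
  then have "(\<lambda>s. \<phi> (t0 + s)) 0 \<in> fsem fi qi (progress ws xs A)"
    by (rule progressI[OF ws _ e(1) _ _ move(1)]) (use d A move(2)[of "t0 + d / 2"] in auto)
  then show ?thesis
    by simp
qed

text \<open>The past of \<open>t0\<close> is the future of the reversed flow, which starts in the
  state with negated differentials; the outer \<open>reverse\<close> accounts for that
  start.\<close>

lemma progress_left:
  assumes ws: "new_tuple ws xs" "length ws = length xs" "no_free ws (fvf B)" and xs: "distinct (xs @ primes xs)"
    and \<phi>: "is_flow xs a b \<phi>" "a < t0" "t0 < b" and d: "d > 0" "a \<le> t0 - d"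
    and B: "\<And>t. t0 - d < t \<Longrightarrow> t < t0 \<Longrightarrow> negate_primes xs (\<phi> t) \<in> fsem fi qi B"
    and move: "x \<in> set xs" "\<And>t. t0 - d < t \<Longrightarrow> t < t0 \<Longrightarrow> \<phi> t x \<noteq> \<phi> t0 x"
  shows "\<phi> t0 \<in> fsem fi qi (reverse xs (progress ws xs B))"
proof -
  define e where "e = min (d / 2) (b - t0)"
  have e: "e > 0" "e \<le> b - t0"
    using d \<phi> by (auto simp: e_def)
  have e2: "e \<le> d / 2"
    unfolding e_def by (rule min.cobounded1)
  have "x \<notin> Prime ` set xs"
    using xs move(1) by auto
  then have nx: "negate_primes xs s x = s x" for s
    by (simp add: negate_primes_def)
  have "is_flow xs (t0 - b) (t0 - a) (\<lambda>s. negate_primes xs (\<phi> (t0 - s)))"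
    using \<phi> xs by (rule is_flow_reverse)
  then have "is_flow xs (- e) (d / 2 + e) (\<lambda>s. negate_primes xs (\<phi> (t0 - s)))"
    by (rule is_flow_restrict) (use e e2 d in auto)
  then have "(\<lambda>s. negate_primes xs (\<phi> (t0 - s))) 0 \<in> fsem fi qi (progress ws xs B)"
    by (rule progressI[OF ws _ e(1) _ _ move(1)]) (use d B move(2)[of "t0 - d / 2"] nx in auto)
  then show ?thesis
    using xs by (simp add: fsem_reverse)
qed


subsection \<open>The switching axiom\<close>

text \<open>If neither mode holds on the closed side, then one holds throughout \<open>S\<close> but
  not at \<open>c\<close>, and the other at \<open>c\<close> but nowhere in \<open>S\<close>; these
  two patterns are excluded.\<close>

lemma flow_one_sided_mode:
  fixes F G :: "'a \<Rightarrow> bool"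
  assumes "S \<noteq> {}" "\<And>t u. t \<in> S \<Longrightarrow> u \<in> S \<Longrightarrow> F t \<longleftrightarrow> F u" "\<And>t u. t \<in> S \<Longrightarrow> u \<in> S \<Longrightarrow> G t \<longleftrightarrow> G u"
    and "\<And>t. t \<in> S \<Longrightarrow> F t \<or> G t" "F c \<or> G c"
    and "\<not> ((\<forall>t\<in>S. F t) \<and> \<not> F c \<and> (\<forall>t\<in>S. \<not> G t) \<and> G c)"
    and "\<not> ((\<forall>t\<in>S. G t) \<and> \<not> G c \<and> (\<forall>t\<in>S. \<not> F t) \<and> F c)"
  shows "(\<forall>t\<in>insert c S. F t) \<or> (\<forall>t\<in>insert c S. G t)"
proof -
  obtain s where "s \<in> S"
    using assms(1) by blast
  then show ?thesis
    using assms(2-) by (metis insert_iff)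
qed

text \<open>A fault at \<open>t0\<close> would be one mode ending exactly where the other begins,
  with no instant in common. There the exit and entry formulas hold, and consistency would give both
  modes the same truth value at \<open>t0\<close>. So within the run every instant has closed
  one-sided neighbourhoods inside a mode, and a supremum argument over the times reached by the loop
  finishes.\<close>

lemma GS_sound:
  fixes F G :: "('v, 'f, 'p) fml"
  assumes fi: "analytic_interp fi" and FG: "fo_arith F" "fo_arith G"
    and xs: "distinct (xs @ primes xs)"
    and ws: "new_tuple ws xs" "length ws = length xs" "no_free ws (fvf F \<union> fvf G)"
  shows "valid fi qi
          (Imp (Box (DAP xs (Or F G)) (And (consis ws xs F G) (consis ws xs G F)))
            (Imp
              (Imp (Or F G) (Box (Loop (Choice (DAP xs F) (DAP xs G))) P))
              (Box (DAP xs (Or F G)) P)))"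
  unfolding valid_def fsem_Imp
proof (intro allI impI)
  fix \<mu> assume con: "\<mu> \<in> fsem fi qi (Box (DAP xs (Or F G)) (And (consis ws xs F G) (consis ws xs G F)))"
    and loop: "\<mu> \<in> fsem fi qi (Or F G) \<longrightarrow> \<mu> \<in> fsem fi qi (Box (Loop (Choice (DAP xs F) (DAP xs G))) P)"
  have "\<nu> \<in> fsem fi qi P" if "(\<mu>, \<nu>) \<in> psem fi qi (DAP xs (Or F G))" for \<nu>
    using that
  proof (rule DAP_E)
    fix T \<epsilon> \<phi>
    assume \<phi>: "T \<ge> 0" "\<epsilon> > 0" "is_flow xs (- \<epsilon>) (T + \<epsilon>) \<phi>"
      "\<forall>t\<in>{0..T}. \<phi> t \<in> fsem fi qi (Or F G)" "\<phi> 0 = \<mu>" "\<phi> T = \<nu>"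
    let ?F = "\<lambda>t. \<phi> t \<in> fsem fi qi F" and ?G = "\<lambda>t. \<phi> t \<in> fsem fi qi G"
    have or: "?F t \<or> ?G t" if "0 \<le> t" "t \<le> T" for t
      using \<phi>(4) that by auto
    have consis: "\<phi> t \<in> fsem fi qi (exit_fml ws xs A) \<Longrightarrow> \<phi> t \<in> fsem fi qi (enter_fml ws xs B) \<Longrightarrow>
        \<phi> t \<in> fsem fi qi A \<longleftrightarrow> \<phi> t \<in> fsem fi qi B"
      if t: "0 \<le> t" "t \<le> T" and AB: "A = F \<and> B = G \<or> A = G \<and> B = F" for t A B
    proof -
      have "(\<phi> 0, \<phi> t) \<in> psem fi qi (DAP xs (Or F G))"
        by (rule DAP_segment[OF \<phi>(3,2)]) (use \<phi>(4) t in auto)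
      then have "\<phi> t \<in> fsem fi qi (And (consis ws xs F G) (consis ws xs G F))"
        using con \<phi>(5) unfolding fsem.simps(6) by blast
      then have "\<phi> t \<in> fsem fi qi (consis ws xs A B)"
        using AB unfolding fsem.simps(3) by blast
      then show "\<phi> t \<in> fsem fi qi (exit_fml ws xs A) \<Longrightarrow> \<phi> t \<in> fsem fi qi (enter_fml ws xs B) \<Longrightarrow>
          \<phi> t \<in> fsem fi qi A \<longleftrightarrow> \<phi> t \<in> fsem fi qi B"
        unfolding consis_def fsem_Imp fsem_Iff fsem.simps(3) by blast
    qed
    have FGxs: "no_free ws (fvf F \<union> fvf G \<union> Prime ` set xs)"
      using ws(1,3) by (auto simp: no_free_def new_tuple_def)
    have mono: "no_free ws X" if "X \<subseteq> fvf F \<union> fvf G \<union> Prime ` set xs" for X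
      using FGxs that unfolding no_free_def by blast
    have free: "no_free ws (fvf A)" "no_free ws (fvf (Neg A))" "no_free ws (fvf (reverse xs A))"
      "no_free ws (fvf (Neg (reverse xs A)))" if "A = F \<or> A = G" for A
      by (rule mono, use that fvf_reverse[of xs A] in auto)+
    have neg: "s \<in> fsem fi qi (reverse xs A) \<longleftrightarrow> negate_primes xs s \<in> fsem fi qi A" for s A
      using xs by (intro fsem_reverse) auto
    have local: "\<exists>d>0. (t0 < T \<longrightarrow> (\<forall>t. t0 \<le> t \<longrightarrow> t < t0 + d \<longrightarrow> ?F t) \<or> (\<forall>t. t0 \<le> t \<longrightarrow> t < t0 + d \<longrightarrow> ?G t)) \<and>
        (0 < t0 \<longrightarrow> (\<forall>t. t0 - d < t \<longrightarrow> t \<le> t0 \<longrightarrow> ?F t) \<or> (\<forall>t. t0 - d < t \<longrightarrow> t \<le> t0 \<longrightarrow> ?G t))"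
      if t0: "0 \<le> t0" "t0 \<le> T" for t0
    proof -
      have ab: "- \<epsilon> < t0" "t0 < T + \<epsilon>"
        using t0 \<phi>(2) by auto
      obtain d1 where d1: "d1 > 0" "\<And>t u. t0 < t \<Longrightarrow> t < t0 + d1 \<Longrightarrow> t0 < u \<Longrightarrow> u < t0 + d1 \<Longrightarrow> ?F t \<longleftrightarrow> ?F u"
        "\<And>t u. t0 - d1 < t \<Longrightarrow> t < t0 \<Longrightarrow> t0 - d1 < u \<Longrightarrow> u < t0 \<Longrightarrow> ?F t \<longleftrightarrow> ?F u"
        using flow_one_sided_truth[OF fi FG(1) \<phi>(3) ab, of qi] by blast
      obtain d2 where d2: "d2 > 0" "\<And>t u. t0 < t \<Longrightarrow> t < t0 + d2 \<Longrightarrow> t0 < u \<Longrightarrow> u < t0 + d2 \<Longrightarrow> ?G t \<longleftrightarrow> ?G u"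
        "\<And>t u. t0 - d2 < t \<Longrightarrow> t < t0 \<Longrightarrow> t0 - d2 < u \<Longrightarrow> u < t0 \<Longrightarrow> ?G t \<longleftrightarrow> ?G u"
        using flow_one_sided_truth[OF fi FG(2) \<phi>(3) ab, of qi] by blast
      obtain d3 where d3: "d3 > 0" "(\<forall>t. \<bar>t - t0\<bar> < d3 \<longrightarrow> \<phi> t = \<phi> t0) \<or>
          (\<exists>x\<in>set xs. \<forall>t. t \<noteq> t0 \<longrightarrow> \<bar>t - t0\<bar> < d3 \<longrightarrow> \<phi> t x \<noteq> \<phi> t0 x)"
        using flow_rest_or_move[OF \<phi>(3) ab] by blast
      \<comment> \<open>Distances to the ends of \<open>[0, T]\<close>, beyond which
        \<open>F\<close> or \<open>G\<close> need not hold; at an end itself the value 1 is a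
        dummy.\<close>
      define Tr where "Tr = (if t0 < T then T - t0 else 1)"
      define Tl where "Tl = (if 0 < t0 then t0 else 1)"
      define d where "d = Min {d1, d2, d3, \<epsilon>, Tr, Tl}"
      have "Tr > 0" "Tl > 0"
        by (auto simp: Tr_def Tl_def)
      then have "d > 0"
        unfolding d_def using d1(1) d2(1) d3(1) \<phi>(2) by (subst Min_gr_iff) auto
      moreover have d_le: "d \<le> z" if "z \<in> {d1, d2, d3, \<epsilon>, Tr, Tl}" for z
        unfolding d_def using that by (intro Min_le) auto
      have "d \<le> T - t0" if "t0 < T"
        using d_le[of Tr] that by (simp add: Tr_def)
      moreover have "d \<le> t0" if "0 < t0"
        using d_le[of Tl] that by (simp add: Tl_def)
      ultimately have d: "d > 0" "d \<le> d1" "d \<le> d2" "d \<le> d3" "d \<le> \<epsilon>"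
        "t0 < T \<Longrightarrow> d \<le> T - t0" "0 < t0 \<Longrightarrow> d \<le> t0"
        using d_le by simp_all
      from d3(2) show ?thesis
      proof
        assume rest: "\<forall>t. \<bar>t - t0\<bar> < d3 \<longrightarrow> \<phi> t = \<phi> t0"
        have "\<phi> t = \<phi> t0" if "t0 - d < t" "t < t0 + d" for t
        proof -
          have "\<bar>t - t0\<bar> < d3"
            using that d(4) by linarith
          with rest show ?thesis
            by blast
        qed
        note eq = this
        have "?F t = ?F t0" "?G t = ?G t0" if "t0 - d < t" "t < t0 + d" for t
          using eq[OF that] by (simp_all only:)
        then show ?thesis
          using or[OF t0] d(1) by (intro exI[of _ d]) (smt (verit, best))
      next
        assume "\<exists>x\<in>set xs. \<forall>t. t \<noteq> t0 \<longrightarrow> \<bar>t - t0\<bar> < d3 \<longrightarrow> \<phi> t x \<noteq> \<phi> t0 x"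
        then obtain x where x: "x \<in> set xs" and move': "\<forall>t. t \<noteq> t0 \<longrightarrow> \<bar>t - t0\<bar> < d3 \<longrightarrow> \<phi> t x \<noteq> \<phi> t0 x"
          by blast
        have move: "\<phi> t x \<noteq> \<phi> t0 x" if "t \<noteq> t0" "t0 - d < t" "t < t0 + d" for t
        proof -
          have "\<bar>t - t0\<bar> < d3"
            using that d(4) by linarith
          with move' that show ?thesis
            by blast
        qed
        define R where "R = {t0<..<t0 + d}"
        define L where "L = {t0 - d<..<t0}"
        \<comment> \<open>\<open>A\<close> is entered just after \<open>t0\<close> and
          \<open>B\<close> is left at \<open>t0\<close>, so \<open>consis ws xs B A\<close> forces
          them to agree at \<open>t0\<close>.\<close>
        have bad_right: "\<not> ((\<forall>t\<in>R. \<phi> t \<in> fsem fi qi A) \<and> \<phi> t0 \<notin> fsem fi qi A \<and>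
            (\<forall>t\<in>R. \<not> \<phi> t \<in> fsem fi qi B) \<and> \<phi> t0 \<in> fsem fi qi B)"
          if AB: "A = F \<and> B = G \<or> A = G \<and> B = F" for A B
        proof
          assume *: "(\<forall>t\<in>R. \<phi> t \<in> fsem fi qi A) \<and> \<phi> t0 \<notin> fsem fi qi A \<and>
            (\<forall>t\<in>R. \<not> \<phi> t \<in> fsem fi qi B) \<and> \<phi> t0 \<in> fsem fi qi B"
          have "\<phi> t0 \<in> fsem fi qi (progress ws xs A)"
            by (rule progress_right[OF ws(1,2) free(1) \<phi>(3) ab d(1) _ _ x]) (use AB * d(5) t0 move in \<open>auto simp: R_def\<close>)
          moreover have "\<phi> t0 \<in> fsem fi qi (progress ws xs (Neg B))"
            by (rule progress_right[OF ws(1,2) free(2) \<phi>(3) ab d(1) _ _ x]) (use AB * d(5) t0 move in \<open>auto simp: R_def\<close>)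
          ultimately have "\<phi> t0 \<in> fsem fi qi (exit_fml ws xs B)" "\<phi> t0 \<in> fsem fi qi (enter_fml ws xs A)"
            using * unfolding exit_fml_def enter_fml_def fsem_Or fsem.simps(3,4) by blast+
          then show False
            using consis[OF t0, of B A] AB * by blast
        qed
        \<comment> \<open>Mirror image: \<open>A\<close> ends just before \<open>t0\<close> and
          \<open>B\<close> begins at \<open>t0\<close>, expressed by progress of the reversed flow,
          so \<open>consis ws xs A B\<close> applies.\<close>
        have bad_left: "\<not> ((\<forall>t\<in>L. \<phi> t \<in> fsem fi qi A) \<and> \<phi> t0 \<notin> fsem fi qi A \<and>
            (\<forall>t\<in>L. \<not> \<phi> t \<in> fsem fi qi B) \<and> \<phi> t0 \<in> fsem fi qi B)"
          if AB: "A = F \<and> B = G \<or> A = G \<and> B = F" for A B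
        proof
          assume *: "(\<forall>t\<in>L. \<phi> t \<in> fsem fi qi A) \<and> \<phi> t0 \<notin> fsem fi qi A \<and>
            (\<forall>t\<in>L. \<not> \<phi> t \<in> fsem fi qi B) \<and> \<phi> t0 \<in> fsem fi qi B"
          have "\<phi> t0 \<in> fsem fi qi (reverse xs (progress ws xs (reverse xs A)))"
            by (rule progress_left[OF ws(1,2) free(3) xs \<phi>(3) ab d(1) _ _ x])
              (use AB * d(5) t0 move in \<open>auto simp: L_def neg\<close>)
          moreover have "\<phi> t0 \<in> fsem fi qi (reverse xs (progress ws xs (Neg (reverse xs B))))"
            by (rule progress_left[OF ws(1,2) free(4) xs \<phi>(3) ab d(1) _ _ x])
              (use AB * d(5) t0 move in \<open>auto simp: L_def neg\<close>)
          ultimately have "\<phi> t0 \<in> fsem fi qi (exit_fml ws xs A)" "\<phi> t0 \<in> fsem fi qi (enter_fml ws xs B)"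
            using * unfolding exit_fml_def enter_fml_def fsem_Or fsem.simps(3,4) by blast+
          then show False
            using consis[OF t0, of A B] AB * by blast
        qed
        have right: "(\<forall>t\<in>insert t0 R. ?F t) \<or> (\<forall>t\<in>insert t0 R. ?G t)" if "t0 < T"
        proof (rule flow_one_sided_mode)
          show "R \<noteq> {}"
            using d(1) by (simp add: R_def)
          show "?F t \<longleftrightarrow> ?F u" "?G t \<longleftrightarrow> ?G u" if "t \<in> R" "u \<in> R" for t u
            using that d(2,3) d1(2)[of t u] d2(2)[of t u] by (auto simp: R_def)
          show "?F t \<or> ?G t" if "t \<in> R" for t
            using or[of t] that d(6)[OF \<open>t0 < T\<close>] t0 by (auto simp: R_def)
        qed (use or[OF t0] bad_right[of F G] bad_right[of G F] in auto)
        have left: "(\<forall>t\<in>insert t0 L. ?F t) \<or> (\<forall>t\<in>insert t0 L. ?G t)" if "0 < t0"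
        proof (rule flow_one_sided_mode)
          show "L \<noteq> {}"
            using d(1) by (simp add: L_def)
          show "?F t \<longleftrightarrow> ?F u" "?G t \<longleftrightarrow> ?G u" if "t \<in> L" "u \<in> L" for t u
            using that d(2,3) d1(3)[of t u] d2(3)[of t u] by (auto simp: L_def)
          show "?F t \<or> ?G t" if "t \<in> L" for t
            using or[of t] that d(7)[OF \<open>0 < t0\<close>] t0 by (auto simp: L_def)
        qed (use or[OF t0] bad_left[of F G] bad_left[of G F] in auto)
        have "t \<in> insert t0 R" if "t0 \<le> t" "t < t0 + d" for t
          using that by (auto simp: R_def)
        moreover have "t \<in> insert t0 L" if "t0 - d < t" "t \<le> t0" for t
          using that by (auto simp: L_def)
        ultimately show ?thesis
          using left right d(1) by (intro exI[of _ d]) blast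
      qed
    qed
    define r where "r = psem fi qi (DAP xs F) \<union> psem fi qi (DAP xs G)"
    have seg: "(\<phi> s, \<phi> t) \<in> r" if "0 \<le> s" "s \<le> t" "t \<le> T"
        "(\<forall>u. s \<le> u \<longrightarrow> u \<le> t \<longrightarrow> ?F u) \<or> (\<forall>u. s \<le> u \<longrightarrow> u \<le> t \<longrightarrow> ?G u)" for s t
      using that DAP_segment[OF \<phi>(3,2), of s t fi qi F] DAP_segment[OF \<phi>(3,2), of s t fi qi G]
      unfolding r_def by blast
    \<comment> \<open>The left neighbourhood of the supremum \<open>c\<close> shows that
      \<open>c\<close> is attained, the right one that \<open>c\<close> cannot lie before
      \<open>T\<close>.\<close>
    define S where "S = {t. 0 \<le> t \<and> t \<le> T \<and> (\<phi> 0, \<phi> t) \<in> r\<^sup>*}"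
    have S: "0 \<in> S" "bdd_above S" "S \<noteq> {}"
      using \<phi>(1) by (auto simp: S_def bdd_above_def)
    define c where "c = Sup S"
    have c: "0 \<le> c" "c \<le> T"
      unfolding c_def using S by (auto simp: S_def intro!: cSup_upper cSup_least)
    obtain d where d: "d > 0"
        "c < T \<longrightarrow> (\<forall>t. c \<le> t \<longrightarrow> t < c + d \<longrightarrow> ?F t) \<or> (\<forall>t. c \<le> t \<longrightarrow> t < c + d \<longrightarrow> ?G t)"
        "0 < c \<longrightarrow> (\<forall>t. c - d < t \<longrightarrow> t \<le> c \<longrightarrow> ?F t) \<or> (\<forall>t. c - d < t \<longrightarrow> t \<le> c \<longrightarrow> ?G t)"
      using local[OF c] by blast
    have "c \<in> S"
    proof (cases "0 < c")
      case True
      obtain s where s: "s \<in> S" "c - d < s"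
        using less_cSupD[OF S(3), of "c - d"] d(1) by (auto simp: c_def)
      have "s \<le> c"
        unfolding c_def using s(1) S(2) by (rule cSup_upper)
      then have "(\<phi> s, \<phi> c) \<in> r"
        using s d(3) True c by (intro seg) (auto simp: S_def)
      then show ?thesis
        using s(1) c by (auto simp: S_def)
    next
      case False
      then show ?thesis
        using S(1) c by (cases "c = 0") auto
    qed
    have "\<not> c < T"
    proof
      assume cT: "c < T"
      define t where "t = min T (c + d / 2)"
      have t: "c < t" "t \<le> T" "t < c + d"
        using cT d(1) by (auto simp: t_def)
      then have "(\<phi> c, \<phi> t) \<in> r"
        using d(2) cT c by (intro seg) auto
      then have "t \<in> S"
        using \<open>c \<in> S\<close> t c by (auto simp: S_def)
      then have "t \<le> c"
        unfolding c_def using S(2) by (rule cSup_upper)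
      then show False
        using t(1) by simp
    qed
    then have "(\<phi> 0, \<phi> T) \<in> r\<^sup>*"
      using \<open>c \<in> S\<close> c by (auto simp: S_def)
    then have "(\<phi> 0, \<phi> T) \<in> psem fi qi (Loop (Choice (DAP xs F) (DAP xs G)))"
      unfolding psem.simps(4,5) r_def rtrancl_is_UN_relpow .
    moreover have "\<mu> \<in> fsem fi qi (Or F G)"
      using \<phi>(1,4,5) by force
    ultimately show "\<nu> \<in> fsem fi qi P"
      using loop \<phi>(5,6) unfolding fsem.simps(6) by blast
  qed
  then show "\<mu> \<in> fsem fi qi (Box (DAP xs (Or F G)) P)"
    unfolding fsem.simps(6) by blast
qed

theorem theorem1:
  fixes fi :: "'f \<Rightarrow> real list \<Rightarrow> real"
    and qi :: "'p \<Rightarrow> real list \<Rightarrow> bool"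
    and xs ys :: "'v var list"
    and F G P :: "('v, 'f, 'p) fml"
    and e :: "('v, 'f) trm"
  assumes "analytic_interp fi"
    and "fo_arith F"
    and "fo_arith G"
  shows
    \<comment> \<open>DW\<close>
    "valid fi qi (Box (DAP xs F) F)
    \<and> \<comment> \<open>C\<close>
     valid fi qi (Iff (Box (DAP xs (And F G)) P) (Box (DAP xs (And G F)) P))
    \<and> \<comment> \<open>DE\<close>
     (\<forall>zs. set (primes xs) \<inter> fvt e = {} \<and> parameters zs xs (fvt e) \<longrightarrow>
        valid fi qi
          (Imp (Constant zs)
            (Imp (Box (Test (Eq e (Const 0))) (Eq (Differential e) (Const 0)))
              (Box (DAP xs (Eq e (Const 0))) (Eq (Differential e) (Const 0))))))
    \<and> \<comment> \<open>DX\<close>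
     valid fi qi (Imp (Box (DAP xs F) P) (Box (Test F) P))
    \<and> \<comment> \<open>DI\<close>
     (\<forall>zs. comparisons P \<and> set (primes xs) \<inter> fvf P = {} \<and> parameters zs xs (fvf P) \<longrightarrow>
        valid fi qi
          (Imp (Constant zs)
            (Imp (Imp F (Box (DAP xs F) (fdiff P)))
              (Imp (Box (Test F) P) (Box (DAP xs F) P)))))
    \<and> \<comment> \<open>DR\<close>
     (new_tuple ys xs \<and> no_free ys (fvf P \<union> fvf F) \<longrightarrow>
        valid fi qi
          (Imp (Box (DAP xs F) P)
            (Foralls ys (Foralls (primes ys) (Box (DAP (xs @ ys) (And F G)) P)))))
    \<and> \<comment> \<open>AG\<close>
     (\<forall>us hs. new_tuple ys xs
        \<and> distinct us \<and> length us = length ys \<and> length hs = length ys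
        \<and> no_free ys (fvf P \<union> fvf F \<union> (fvf G - set us) \<union> (\<Union>h\<in>set hs. fvt h)) \<longrightarrow>
        valid fi qi
          (Imp (Box (DAP xs F) (apply_args us G hs))
            (Imp
              (Foralls ys (Foralls (primes ys)
                (Box (DAP (xs @ ys) (And F (apply_args us G (map Var ys)))) P)))
              (Box (DAP xs F) P))))
    \<and> \<comment> \<open>BDG\<close>
     (\<forall>gs h. new_tuple ys xs
        \<and> length gs = length ys \<and> (\<forall>g\<in>set gs. set (primes ys) \<inter> fvt g = {})
        \<and> no_free ys (fvf P \<union> fvf F \<union> fvt h) \<longrightarrow>
        valid fi qi
          (Imp (Eqs (map Var (primes ys)) gs)
            (Imp (Box (DAP (xs @ ys) (And F (Eqs (map Var (primes ys)) gs))) (Leq (sqnorm ys) h))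
              (Iff
                (Box (DAP xs F) P)
                (Box (DAP (xs @ ys) (And F (Eqs (map Var (primes ys)) gs))) P)))))
    \<and> \<comment> \<open>GS\<close>
     (\<forall>ws. distinct (xs @ primes xs)
        \<and> new_tuple ws xs \<and> length ws = length xs \<and> no_free ws (fvf F \<union> fvf G) \<longrightarrow>
        valid fi qi
          (Imp (Box (DAP xs (Or F G)) (And (consis ws xs F G) (consis ws xs G F)))
            (Imp
              (Imp (Or F G) (Box (Loop (Choice (DAP xs F) (DAP xs G))) P))
              (Box (DAP xs (Or F G)) P))))"
proof (intro conjI allI impI, goal_cases)
  case 1
  show ?case
    by (rule DW_sound)
next
  case 2
  show ?case
    by (rule C_sound)
next
  case 3
  then show ?case
    using DE_sound[OF assms(1)] by blast
next
  case 4
  show ?case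
    by (rule DX_sound)
next
  case 5
  then show ?case
    using DI_sound[OF assms(1)] by blast
next
  case 6
  then show ?case
    using DR_sound by blast
next
  case 7
  then show ?case
    by (elim conjE) (rule AG_sound[OF assms(1,3)])
next
  case 8
  then show ?case
    by (elim conjE) (rule BDG_sound[OF assms(1)])
next
  case 9
  then show ?case
    by (elim conjE) (rule GS_sound[OF assms])
qed

end
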